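(* Let $P(T)\in K[T]$ with $P(0)=0$ and $\deg P\le D$, and assume the equation $y'=P'(T)\,y$ is soluble. Write uniquely $P(T)=\sum_{1\le m\le D,\ p\nmid m}P_m(T^m)$ with each $P_m\in\bigoplus_{j\ge0}K\,T^{p^j}$. For each such $m$ let $\widehat e_m(U)$ be the truncated series with $\widehat e_m(T^m)=\widehat e_{(m)}(T)$ as in the context. Then the index of the equation is $$\chi=1-\max_{1\le m\le D,\ p\nmid m}\frac{m\cdot p^{d_m}}{v_U(\widehat e_m(U)-1)},$$ where $v_U(\widehat e_m-1)$ is the multiplicity of $0$ as a root of $\widehat e_m(U)-1$, with the convention that this is $+\infty$ (and the fraction is $0$) when $\widehat e_m=1$.
   Context: $p$ is a prime, $K$ an ultrametric (complete) field extension of $\mathbb{Q}_p$, $R$ its ring of integers, $\kappa$ its residue field. For $L=P'$ with $P(0)=0$, $e(T)=\exp(P(T))$. $\mathcal{O}^\dagger\subseteq K[[T]]$ is the algebra of power series with radius of convergence $>1$; the equation $y'=Ly$ is soluble if $e$ has radius $\ge1$. For a soluble equation, the index $\chi$ is $\dim H^0-\dim H^1$ of the complex $0\to\mathcal{O}^\dagger\xrightarrow{f\mapsto f'-Lf}\mathcal{O}^\dagger\to0$. Fix an integer $D\ge1$, $d=\lfloor\log_pD\rfloor$, $d_i=\lfloor\log_p(D/i)\rfloor$ for $1\le i\le D$; assume $K$ contains a primitive $p^{d+1}$-th root of unity $\zeta$, $\pi_k=\zeta^{p^{d-k}}-1$ for $0\le k\le d$. For $P=\sum_{i=1}^Da_iT^i$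 and $m$ prime to $p$, let $\tilde P_{(m)}(T)=\sum_{j:\,mp^j\le D}a_{mp^j}T^{mp^j}/\pi_{d_{mp^j}}$ and $\tilde e_{(m)}=\exp(\tilde P_{(m)})\bmod T^{D+1}$. When the equation is soluble, each $\tilde e_{(m)}$ has coefficients in $R$ (known), and $\widehat e_{(m)}\in\kappa[T]/(T^{D+1})$ is its reduction; it is a series in $T^m$, and $\widehat e_m(U)\in\kappa[U]/(U^{\lfloor D/m\rfloor+1})$ is defined by $\widehat e_m(T^m)=\widehat e_{(m)}(T)$. One has $\widehat e=\prod_m\widehat e_{(m)}$, where $\widehat e$ is the reduction of $\exp(\sum_ia_iT^i/\pi_{d_i})\bmod T^{D+1}$. *)

theory Defs
  imports "HOL-Analysis.Analysis" "HOL-Computational_Algebra.Computational_Algebra"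
begin

section \<open>Complete ultrametric fields of characteristic 0\<close>

text \<open>An absolute value of its own is needed because \<^const>\<open>norm\<close> is constrained to real normed
  spaces. Its definiteness comes from the metric-space axioms, completeness from
  \<^class>\<open>complete_space\<close>.\<close>

class ultrametric_field = field_char_0 + complete_space +
  fixes absv :: "'a \<Rightarrow> real"
  assumes dist_absv: "dist x y = absv (x - y)"
    and absv_mult: "absv (x * y) = absv x * absv y"
    and absv_ultrametric: "absv (x + y) \<le> max (absv x) (absv y)"

text \<open>The absolute value restricts to the normalised \<open>p\<close>-adic one on the integers, hence on the
  rationals. By completeness the closure of the rationals is then \<open>\<rat>\<^sub>p\<close>, so this says that
  the field is an ultrametric extension of \<open>\<rat>\<^sub>p\<close>.\<close>

definition extends_Qp :: "nat \<Rightarrow> 'k::ultrametric_field itself \<Rightarrow> bool" where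
  "extends_Qp p _ \<longleftrightarrow>
     (\<forall>n::int. n \<noteq> 0 \<longrightarrow> absv (of_int n :: 'k) = 1 / real p ^ multiplicity (int p) n)"

definition primitive_root_of_unity :: "nat \<Rightarrow> 'k::field \<Rightarrow> bool" where
  "primitive_root_of_unity n z \<longleftrightarrow> 0 < n \<and> z ^ n = 1 \<and> (\<forall>j. 0 < j \<and> j < n \<longrightarrow> z ^ j \<noteq> 1)"

lemma absv_0 [simp]: "absv (0::'k::ultrametric_field) = 0"
  by (metis dist_absv dist_self diff_self)

lemma absv_eq_0 [simp]: "absv (x::'k::ultrametric_field) = 0 \<longleftrightarrow> x = 0"
  by (metis dist_absv dist_eq_0_iff diff_zero)

lemma absv_nonneg [simp]: "0 \<le> absv (x::'k::ultrametric_field)"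
  by (metis dist_absv zero_le_dist diff_zero)

lemma absv_1 [simp]: "absv (1::'k::ultrametric_field) = 1"
  using absv_mult[of "1::'k" 1] by simp

lemma absv_minus [simp]: "absv (- x) = absv (x::'k::ultrametric_field)"
  by (metis dist_absv dist_commute diff_zero diff_0)

lemma absv_diff: "absv (x - y) \<le> max (absv x) (absv (y::'k::ultrametric_field))"
  using absv_ultrametric[of x "- y"] by simp

lemma absv_inverse: "absv (inverse x) = inverse (absv (x::'k::ultrametric_field))"
proof (cases "x = 0")
  case False
  then have "absv x * absv (inverse x) = 1"
    by (simp flip: absv_mult)
  then show ?thesis by (metis inverse_unique)
qed auto


section \<open>The residue field\<close>

definition residue_rel :: "'k::ultrametric_field \<Rightarrow> 'k \<Rightarrow> bool" where
  "residue_rel x y \<longleftrightarrow> absv x \<le> 1 \<and> absv y \<le> 1 \<and> absv (x - y) < 1"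

lemma residue_rel_add:
  assumes "residue_rel x x'" "residue_rel y y'"
  shows "residue_rel (x + y) (x' + y')"
proof -
  have "absv ((x - x') + (y - y')) < 1"
    using absv_ultrametric[of "x - x'" "y - y'"] assms by (auto simp: residue_rel_def)
  moreover have "(x - x') + (y - y') = (x + y) - (x' + y')" by simp
  ultimately show ?thesis
    using assms absv_ultrametric[of x y] absv_ultrametric[of x' y'] by (auto simp: residue_rel_def)
qed

lemma residue_rel_minus: "residue_rel x x' \<Longrightarrow> residue_rel (- x) (- x')"
  unfolding residue_rel_def by (metis minus_diff_minus absv_minus)

lemma residue_rel_diff:
  "residue_rel x x' \<Longrightarrow> residue_rel y y' \<Longrightarrow> residue_rel (x - y) (x' - y')"
  using residue_rel_add[of x x' "- y" "- y'"] residue_rel_minus[of y y'] by simp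

lemma residue_rel_mult:
  assumes "residue_rel x x'" "residue_rel y y'"
  shows "residue_rel (x * y) (x' * y')"
proof -
  have a: "absv (u * w) < 1" if "absv u < 1" "absv w \<le> 1" for u w :: 'a
    using that mult_left_le[of "absv w" "absv u"] by (simp add: absv_mult)
  have "absv ((x - x') * y + (y - y') * x') < 1"
    using absv_ultrametric[of "(x - x') * y" "(y - y') * x'"] a[of "x - x'" y] a[of "y - y'" x'] assms
    by (auto simp: residue_rel_def)
  moreover have "(x - x') * y + (y - y') * x' = x * y - x' * y'" by (simp add: algebra_simps)
  ultimately show ?thesis
    using assms by (auto simp: residue_rel_def absv_mult mult_le_one)
qed

lemma residue_rel_absv_less_1:
  assumes "residue_rel x y"
  shows "absv x < 1 \<longleftrightarrow> absv y < 1"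
  using assms absv_ultrametric[of "x - y" y] absv_diff[of x "x - y"]
  by (auto simp: residue_rel_def)

quotient_type (overloaded) 'k residue_field = "'k::ultrametric_field" / partial: residue_rel
proof (rule part_equivpI)
  show "\<exists>x::'k. residue_rel x x"
    by (rule exI[of _ 0]) (simp add: residue_rel_def)
  show "symp (residue_rel :: 'k \<Rightarrow> _)"
    by (rule sympI) (metis residue_rel_def minus_diff_eq absv_minus)
  show "transp (residue_rel :: 'k \<Rightarrow> _)"
  proof (rule transpI)
    fix x y z :: 'k
    assume "residue_rel x y" "residue_rel y z"
    then show "residue_rel x z"
      using absv_ultrametric[of "x - y" "y - z"] by (auto simp: residue_rel_def)
  qed
qed

instantiation residue_field :: (ultrametric_field) field
begin

lift_definition zero_residue_field :: "'a residue_field" is 0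
  by (simp add: residue_rel_def)

lift_definition one_residue_field :: "'a residue_field" is 1
  by (simp add: residue_rel_def)

lift_definition plus_residue_field :: "'a residue_field \<Rightarrow> 'a residue_field \<Rightarrow> 'a residue_field"
  is "(+)" by (rule residue_rel_add)

lift_definition uminus_residue_field :: "'a residue_field \<Rightarrow> 'a residue_field"
  is uminus by (rule residue_rel_minus)

lift_definition minus_residue_field :: "'a residue_field \<Rightarrow> 'a residue_field \<Rightarrow> 'a residue_field"
  is "(-)" by (rule residue_rel_diff)

lift_definition times_residue_field :: "'a residue_field \<Rightarrow> 'a residue_field \<Rightarrow> 'a residue_field"
  is "(*)" by (rule residue_rel_mult)

lift_definition inverse_residue_field :: "'a residue_field \<Rightarrow> 'a residue_field"
  is "\<lambda>x. if absv x < 1 then 0 else inverse x"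
proof -
  fix x y :: 'a
  assume xy: "residue_rel x y"
  show "residue_rel (if absv x < 1 then 0 else inverse x) (if absv y < 1 then 0 else inverse y)"
  proof (cases "absv x < 1")
    case True
    then show ?thesis using residue_rel_absv_less_1[OF xy] by (simp add: residue_rel_def)
  next
    case False
    then have n: "absv x = 1" "absv y = 1"
      using residue_rel_absv_less_1[OF xy] xy by (auto simp: residue_rel_def)
    then have "x \<noteq> 0" "y \<noteq> 0" by auto
    then have "inverse x - inverse y = inverse x * inverse y * (y - x)"
      by (simp add: field_simps)
    moreover have "absv (y - x) < 1"
      using xy by (metis residue_rel_def minus_diff_eq absv_minus)
    ultimately have "absv (inverse x - inverse y) < 1"
      using n by (simp add: absv_mult absv_inverse)
    then show ?thesis using n by (simp add: residue_rel_def absv_inverse)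
  qed
qed

definition divide_residue_field :: "'a residue_field \<Rightarrow> 'a residue_field \<Rightarrow> 'a residue_field" where
  "divide_residue_field x y = x * inverse y"

instance
proof
  fix a b c :: "'a residue_field"
  have inv: "inverse x * x = 1" if "absv x = 1" for x :: 'a
    using that by (intro left_inverse) auto
  note simps = residue_rel_add residue_rel_mult residue_rel_minus
  show "a + b + c = a + (b + c)"
    by transfer (auto simp: add.assoc intro!: simps)
  show "a + b = b + a"
    by transfer (auto simp: add.commute intro!: simps)
  show "0 + a = a"
    by transfer auto
  show "- a + a = 0"
    by transfer (auto simp: residue_rel_def)
  show "a - b = a + - b"
    by transfer (auto intro!: simps residue_rel_diff)
  show "a * b * c = a * (b * c)"
    by transfer (auto simp: mult.assoc intro!: simps)
  show "a * b = b * a"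
    by transfer (auto simp: mult.commute intro!: simps)
  show "1 * a = a"
    by transfer auto
  show "(a + b) * c = a * c + b * c"
    by transfer (auto simp: distrib_right intro!: simps)
  show "(0::'a residue_field) \<noteq> 1"
    by transfer (auto simp: residue_rel_def)
  show "inverse (0::'a residue_field) = 0"
    by transfer (auto simp: residue_rel_def)
  show "a div b = a * inverse b"
    by (simp add: divide_residue_field_def)
  show "a \<noteq> 0 \<Longrightarrow> inverse a * a = 1"
    by transfer (auto simp: residue_rel_def inv)
qed

end

text \<open>The reduction map; it is meaningful only on the ring of integers \<open>absv x \<le> 1\<close>.\<close>

definition residue :: "'k::ultrametric_field \<Rightarrow> 'k residue_field" where
  "residue = abs_residue_field"

lemma residue_eq_iff:
  assumes "absv x \<le> 1" "absv y \<le> 1"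
  shows "residue x = residue y \<longleftrightarrow> absv (x - y) < 1"
  using assms Quotient_rel[OF Quotient_residue_field, of x y]
  by (auto simp: residue_def residue_rel_def)


section \<open>Solubility and index\<close>

text \<open>The library's \<^const>\<open>conv_radius\<close> is Hadamard's formula; it is applied to the real
  sequence of absolute values because \<open>'k\<close> is not a real normed space.\<close>

definition ultra_radius :: "'k::ultrametric_field fps \<Rightarrow> ereal" where
  "ultra_radius f = conv_radius (\<lambda>n. absv (fps_nth f n))"

definition overconvergent :: "'k::ultrametric_field fps set" where
  "overconvergent = {f. ultra_radius f > 1}"

definition exp_poly :: "'k::field_char_0 poly \<Rightarrow> 'k fps" where
  "exp_poly P = fps_exp 1 oo fps_of_poly P"

text \<open>Solubility of \<open>y' = P' y\<close>, for \<open>P\<close> without constant term.\<close>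

definition soluble :: "'k::ultrametric_field poly \<Rightarrow> bool" where
  "soluble P \<longleftrightarrow> ultra_radius (exp_poly P) \<ge> 1"

definition diff_op :: "'k::field poly \<Rightarrow> 'k fps \<Rightarrow> 'k fps" where
  "diff_op L f = fps_deriv f - fps_of_poly L * f"

text \<open>\<open>V / W\<close> has finite dimension \<open>n\<close> for \<open>'k\<close>-subspaces \<open>W \<subseteq> V\<close> of the power series: the classes
  of some \<open>b 0, \<dots>, b (n - 1) \<in> V\<close> form a basis of \<open>V / W\<close>, i.e. each class in \<open>V / W\<close> is a unique
  linear combination of them.\<close>

definition has_quotient_dim :: "'k::field fps set \<Rightarrow> 'k fps set \<Rightarrow> nat \<Rightarrow> bool" where
  "has_quotient_dim V W n \<longleftrightarrow>
     (\<exists>b. (\<forall>i<n. b i \<in> V) \<and>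
          (\<forall>f\<in>V. \<exists>!c. (\<forall>i\<ge>n. c i = 0) \<and> f - (\<Sum>i<n. fps_const (c i) * b i) \<in> W))"

text \<open>\<open>y' = L y\<close> has finite-dimensional \<open>H\<^sup>0\<close> and \<open>H\<^sup>1\<close>, and index \<open>h\<close>.\<close>

definition has_index :: "'k::ultrametric_field poly \<Rightarrow> real \<Rightarrow> bool" where
  "has_index L h \<longleftrightarrow>
     (\<exists>h0 h1. has_quotient_dim {f \<in> overconvergent. diff_op L f = 0} {0} h0 \<and>
              has_quotient_dim overconvergent (diff_op L ` overconvergent) h1 \<and>
              h = real h0 - real h1)"


section \<open>The reduced truncated exponentials\<close>

text \<open>\<open>log_idx p D i\<close> is \<open>d\<^sub>i\<close>; the paper's \<open>d\<close> is \<open>d\<^sub>1\<close>.\<close>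

definition log_idx :: "nat \<Rightarrow> nat \<Rightarrow> nat \<Rightarrow> nat" where
  "log_idx p D i = nat \<lfloor>log (real p) (real D / real i)\<rfloor>"

definition pi_elt :: "nat \<Rightarrow> nat \<Rightarrow> 'k::field \<Rightarrow> nat \<Rightarrow> 'k" where
  "pi_elt p D \<zeta> k = \<zeta> ^ (p ^ (log_idx p D 1 - k)) - 1"

definition P_tilde :: "nat \<Rightarrow> nat \<Rightarrow> 'k::field \<Rightarrow> 'k poly \<Rightarrow> nat \<Rightarrow> 'k poly" where
  "P_tilde p D \<zeta> P m =
     (\<Sum>j\<in>{j. m * p ^ j \<le> D}.
        monom (coeff P (m * p ^ j) / pi_elt p D \<zeta> (log_idx p D (m * p ^ j))) (m * p ^ j))"

text \<open>Elements of \<open>\<kappa>[T]/(T ^ (N + 1))\<close> are represented by polynomials of degree at most \<open>N\<close>;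
  here \<open>N = D\<close>, and \<open>N = D div m\<close> in \<open>e_hat\<close>.\<close>

definition e_hat_T ::
  "nat \<Rightarrow> nat \<Rightarrow> 'k::ultrametric_field \<Rightarrow> 'k poly \<Rightarrow> nat \<Rightarrow> 'k residue_field poly" where
  "e_hat_T p D \<zeta> P m =
     (\<Sum>i\<le>D. monom (residue (fps_nth (exp_poly (P_tilde p D \<zeta> P m)) i)) i)"

definition e_hat ::
  "nat \<Rightarrow> nat \<Rightarrow> 'k::ultrametric_field \<Rightarrow> 'k poly \<Rightarrow> nat \<Rightarrow> 'k residue_field poly" where
  "e_hat p D \<zeta> P m =
     (THE Q. degree Q \<le> D div m \<and> pcompose Q (monom 1 m) = e_hat_T p D \<zeta> P m)"

text \<open>\<open>m p\<^bsup>d\<^sub>m\<^esup> / v\<^sub>U(e_hat - 1)\<close>, with value 0 when the denominator is infinite; for a nonzero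
  polynomial \<open>order 0\<close> is the multiplicity of the root 0.\<close>

definition index_term :: "nat \<Rightarrow> nat \<Rightarrow> 'k::ultrametric_field \<Rightarrow> 'k poly \<Rightarrow> nat \<Rightarrow> real" where
  "index_term p D \<zeta> P m =
     (if e_hat p D \<zeta> P m = 1 then 0
      else real (m * p ^ log_idx p D m) / real (order 0 (e_hat p D \<zeta> P m - 1)))"

end

theory Submission
  imports Defs
begin

text \<open>The operator \<open>D = e \<circ> d/dT \<circ> e\<^sup>-\<^sup>1\<close> has divided powers \<open>D\<^sup>q / q! = \<Sum> G\<^sub>k f\<^bsup>[q-k]\<^esup>\<close>, where
  \<open>\<Sum> G\<^sub>k X\<^sup>k = e(T) / e(T + X)\<close>. Factor \<open>e\<close> into exponentials \<open>E(\<lambda>\<^sub>i T\<^sup>i)\<close>, \<open>1 \<le> i \<le> D\<close>, with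
  \<open>E(X) = AH(z X) / AH(X)\<close> for the Artin-Hasse exponential \<open>AH\<close> and a root of unity \<open>z\<close> of order
  \<open>p\<^bsup>s+1\<^esup>\<close>, \<open>s = d\<^sub>i\<close>; let \<open>i = m p\<^sup>j\<close> with \<open>p \<nmid> m\<close> and \<open>N\<^sub>i = m p\<^sup>s\<close>. Just beyond the radius
  \<open>r\<^sub>0 = min |\<lambda>\<^sub>i|\<^bsup>-1/i\<^esup>\<close>, the critical index \<open>i\<close> with the largest \<open>N = N\<^sub>i\<close> contributes
  \<open>exp(c (T\<^bsup>N-1\<^esup> X)\<^bsup>p\<^sup>j\<^esup>)\<close> to \<open>e(T) / e(T + X)\<close>, and everything else converges on a strictly larger
  disc in \<open>X\<close>. Hence, for \<open>q\<close> a large power of \<open>p\<close>, the operator \<open>D\<^sup>q / q!\<close> is a small perturbation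
  of multiplication by a monomial of degree \<open>(N - 1) q\<close> on the bounded functions on \<open>|T| < r\<close>; so \<open>D\<close> is
  injective there with cokernel of dimension \<open>N - 1\<close>. As \<open>e\<close> is in the kernel, solubility forces
  \<open>r\<^sub>0 \<ge> 1\<close>; if \<open>r\<^sub>0 = 1\<close> the index is \<open>1 - N\<close>, and if \<open>r\<^sub>0 > 1\<close> both \<open>e\<close> and \<open>e\<^sup>-\<^sup>1\<close> are
  overconvergent and the index is 1. Modulo \<open>T\<^bsup>D+1\<^esup>\<close> the exponential of index \<open>m\<close> is
  \<open>\<Prod> AH(\<lambda>\<^bsub>m p\<^sup>j\<^esub> T\<^bsup>m p\<^sup>j\<^esup>)\<close>, so the order of its reduction finds the least \<open>j\<close> for which
  \<open>\<lambda>\<^bsub>m p\<^sup>j\<^esub>\<close> is a unit, which is the one with the largest \<open>N\<^sub>i\<close>.\<close>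


section \<open>Ultrametric estimates\<close>

text \<open>Near \<open>r\<^sub>0\<close>, \<open>T P'\<close> has norm below 1, because its terms
  carry factors \<open>z - 1\<close> with \<open>z\<close> of \<open>p\<close>-power order, while
  \<open>T d/dT\<close> has norm 1; so \<open>D\<close> itself is no small perturbation of a
  multiplication. Dividing by \<open>q!\<close> changes the balance: divided derivatives of order
  \<open>q\<close> have norm at most \<open>r^(-q)\<close>, whereas the order-zero coefficient
  \<open>G\<^sub>q\<close> outgrows this geometrically in \<open>q\<close> once
  \<open>r > r\<^sub>0\<close>. Powers of \<open>p\<close> are taken for \<open>q\<close> because,
  with \<open>\<pi> = z - 1\<close> and \<open>z\<close> of order \<open>p\<close>, the quotient
  \<open>|\<pi>|^n / |n!|\<close> for \<open>n >= 1\<close> is at most \<open>|\<pi>|\<close> and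
  reaches this bound at powers of \<open>p\<close>. At \<open>r = r\<^sub>0\<close> this growth is
  absent, so all estimates live on radii slightly beyond it, and for \<open>r\<^sub>0 = 1\<close>
  the index is carried over to the union of the spaces with \<open>r > 1\<close>. The exponent
  \<open>q\<close> may depend on \<open>r\<close>, because it cancels when the cokernel of
  \<open>D\<close> is compared with that of its \<open>q\<close>-th power. A single factor dominates
  because the numbers \<open>N\<^sub>i\<close> are pairwise distinct. Radii are arbitrary reals, not
  tied to the value group of the field: norms are bounds on coefficients, not suprema over
  points.\<close>

lemma absv_power: "absv (x ^ n) = absv (x::'k::ultrametric_field) ^ n"
  by (induction n) (simp_all add: absv_mult)

lemma absv_divide: "absv (x / y) = absv x / absv (y::'k::ultrametric_field)"
  by (simp add: divide_inverse absv_mult absv_inverse)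

lemma absv_pos: "x \<noteq> 0 \<Longrightarrow> 0 < absv (x::'k::ultrametric_field)"
  by (simp add: less_le)

lemma absv_sum_le:
  fixes f :: "'b \<Rightarrow> 'k::ultrametric_field"
  assumes "\<And>i. i \<in> A \<Longrightarrow> absv (f i) \<le> C" and "0 \<le> C"
  shows "absv (sum f A) \<le> C"
proof (cases "finite A")
  case True
  then show ?thesis using assms(1)
  proof (induction A rule: finite_induct)
    case (insert x A)
    have "absv (sum f A) \<le> C" "absv (f x) \<le> C" using insert by auto
    then show ?case using insert(1,2) absv_ultrametric[of "f x" "sum f A"] by simp
  qed (use assms in auto)
qed (use assms in auto)

lemma absv_sum_less:
  fixes f :: "'b \<Rightarrow> 'k::ultrametric_field"
  assumes "\<And>i. i \<in> A \<Longrightarrow> absv (f i) < C" and "0 < C"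
  shows "absv (sum f A) < C"
proof (cases "finite A")
  case True
  then show ?thesis using assms(1)
  proof (induction A rule: finite_induct)
    case (insert x A)
    have "absv (sum f A) < C" "absv (f x) < C" using insert by auto
    then show ?case using insert(1,2) absv_ultrametric[of "f x" "sum f A"] by simp
  qed (use assms in auto)
qed (use assms in auto)

lemma absv_add_le: "absv x \<le> C \<Longrightarrow> absv y \<le> C \<Longrightarrow> absv (x + y :: 'k::ultrametric_field) \<le> C"
  using absv_ultrametric[of x y] by simp

lemma absv_diff_le: "absv x \<le> C \<Longrightarrow> absv y \<le> C \<Longrightarrow> absv (x - y :: 'k::ultrametric_field) \<le> C"
  using absv_diff[of x y] by simp

lemma absv_add_dominant:
  assumes "absv y < absv (x::'k::ultrametric_field)"
  shows "absv (x + y) = absv x"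
proof (rule antisym)
  show "absv (x + y) \<le> absv x" using absv_ultrametric[of x y] assms by simp
  show "absv x \<le> absv (x + y)" using absv_diff[of "x + y" y] assms by (simp add: max_def split: if_splits)
qed

lemma absv_of_nat_le_1: "absv (of_nat n :: 'k::ultrametric_field) \<le> 1"
proof (induction n)
  case (Suc n)
  then show ?case using absv_ultrametric[of "1::'k" "of_nat n"] by simp
qed simp

lemma absv_of_int_le_1: "absv (of_int n :: 'k::ultrametric_field) \<le> 1"
  by (cases n rule: int_cases2) (use absv_of_nat_le_1 in auto)

lemma absv_of_nat_prime_power:
  assumes "extends_Qp p TYPE('k::ultrametric_field)" "prime p"
  shows "absv (of_nat (p ^ j) :: 'k) = 1 / real p ^ j"
proof -
  have "absv (of_int (int p ^ j) :: 'k) = 1 / real p ^ multiplicity (int p) (int p ^ j)"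
    using assms unfolding extends_Qp_def by (metis of_nat_0_eq_iff power_not_zero prime_gt_0_nat neq0_conv)
  moreover have "multiplicity (int p) (int p ^ j) = j"
    using assms(2) prime_gt_1_nat by (intro multiplicity_same_power) auto
  ultimately show ?thesis by simp
qed

lemma absv_of_nat_prime:
  assumes "extends_Qp p TYPE('k::ultrametric_field)" "prime p"
  shows "absv (of_nat p :: 'k) = 1 / real p"
  using absv_of_nat_prime_power[OF assms, of 1] by simp

lemma absv_of_int_not_dvd:
  assumes "extends_Qp p TYPE('k::ultrametric_field)" "\<not> int p dvd n"
  shows "absv (of_int n :: 'k) = 1"
proof -
  have "n \<noteq> 0" using assms by auto
  then show ?thesis using assms unfolding extends_Qp_def by (simp add: not_dvd_imp_multiplicity_0)
qed

lemma absv_of_nat_not_dvd: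
  assumes "extends_Qp p TYPE('k::ultrametric_field)" "\<not> p dvd n"
  shows "absv (of_nat n :: 'k) = 1"
  using absv_of_int_not_dvd[OF assms(1), of "int n"] assms(2) by simp

lemma absv_of_int_dvd:
  assumes "extends_Qp p TYPE('k::ultrametric_field)" "prime p" "int p dvd n"
  shows "absv (of_int n :: 'k) \<le> 1 / real p"
proof -
  obtain k where "n = int p * k" using assms(3) by auto
  then have "absv (of_int n :: 'k) = absv (of_nat p :: 'k) * absv (of_int k :: 'k)"
    by (simp add: absv_mult)
  also have "\<dots> \<le> absv (of_nat p :: 'k)"
    by (simp add: mult_left_le absv_of_int_le_1)
  finally show ?thesis using absv_of_nat_prime[OF assms(1,2)] by simp
qed

lemma absv_of_nat_dvd:
  assumes "extends_Qp p TYPE('k::ultrametric_field)" "prime p" "p dvd n"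
  shows "absv (of_nat n :: 'k) \<le> 1 / real p"
  using absv_of_int_dvd[OF assms(1,2), of "int n"] assms(3) by simp

text \<open>\<open>coeff_bound r C f\<close>: the Gauss norm of radius \<open>r\<close> of \<open>f\<close> is at most \<open>C\<close>; and
  \<open>coeff_bound2 r s C F\<close> is the same for \<open>F = \<Sum> F\<^sub>n(T) X\<^sup>n\<close> and the radii
  \<open>|T| = r\<close>, \<open>|X| = s\<close>.\<close>

definition coeff_bound :: "real \<Rightarrow> real \<Rightarrow> 'k::ultrametric_field fps \<Rightarrow> bool" where
  "coeff_bound r C f \<longleftrightarrow> (\<forall>n. absv (fps_nth f n) * r ^ n \<le> C)"

definition coeff_bound2 :: "real \<Rightarrow> real \<Rightarrow> real \<Rightarrow> 'k::ultrametric_field fps fps \<Rightarrow> bool" where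
  "coeff_bound2 r s C F \<longleftrightarrow> (\<forall>n. coeff_bound r (C / s ^ n) (fps_nth F n))"

lemma coeff_boundI: "(\<And>n. absv (fps_nth f n) * r ^ n \<le> C) \<Longrightarrow> coeff_bound r C f"
  by (simp add: coeff_bound_def)

lemma coeff_boundD: "coeff_bound r C f \<Longrightarrow> absv (fps_nth f n) * r ^ n \<le> C"
  by (simp add: coeff_bound_def)

lemma coeff_bound_nonneg: "coeff_bound r C f \<Longrightarrow> 0 \<le> C"
  using coeff_boundD[of r C f 0] absv_nonneg[of "fps_nth f 0"] by (simp del: absv_nonneg)

lemma coeff_bound_mono: "coeff_bound r C f \<Longrightarrow> C \<le> C' \<Longrightarrow> coeff_bound r C' f"
  by (meson coeff_bound_def order_trans)

lemma coeff_bound_mono_radius: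
  assumes "coeff_bound r C f" "0 \<le> r'" "r' \<le> r"
  shows "coeff_bound r' C f"
proof (rule coeff_boundI)
  fix n
  have "absv (fps_nth f n) * r' ^ n \<le> absv (fps_nth f n) * r ^ n"
    using assms by (intro mult_left_mono power_mono) auto
  then show "absv (fps_nth f n) * r' ^ n \<le> C" using coeff_boundD[OF assms(1), of n] by simp
qed

lemma coeff_bound_0: "0 \<le> C \<Longrightarrow> coeff_bound r C 0"
  by (simp add: coeff_bound_def)

lemma coeff_bound_1: "coeff_bound r 1 1"
  by (rule coeff_boundI) simp

lemma coeff_bound_add:
  assumes "coeff_bound r C f" "coeff_bound r C g" "0 \<le> r"
  shows "coeff_bound r C (f + g)"
proof (rule coeff_boundI)
  fix n
  have "absv (fps_nth f n + fps_nth g n) * r ^ n \<le> max (absv (fps_nth f n)) (absv (fps_nth g n)) * r ^ n"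
    using assms by (intro mult_right_mono absv_ultrametric) auto
  also have "\<dots> \<le> C"
    using assms by (auto simp: max_def coeff_bound_def)
  finally show "absv (fps_nth (f + g) n) * r ^ n \<le> C" by simp
qed

lemma coeff_bound_uminus: "coeff_bound r C f \<Longrightarrow> coeff_bound r C (- f)"
  by (simp add: coeff_bound_def)

lemma coeff_bound_diff:
  assumes "coeff_bound r C f" "coeff_bound r C g" "0 \<le> r"
  shows "coeff_bound r C (f - g)"
  using coeff_bound_add[OF assms(1) coeff_bound_uminus[OF assms(2)] assms(3)] by simp

lemma coeff_bound_sum:
  assumes "\<And>i. i \<in> A \<Longrightarrow> coeff_bound r C (f i)" "0 \<le> C" "0 \<le> r"
  shows "coeff_bound r C (sum f A)"
proof (cases "finite A")
  case True
  then show ?thesis using assms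
    by (induction A rule: finite_induct) (auto intro!: coeff_bound_add coeff_bound_0)
qed (use assms in \<open>auto intro: coeff_bound_0\<close>)

lemma coeff_bound_mult:
  assumes f: "coeff_bound r C f" and g: "coeff_bound r C' g" and r: "0 < r"
  shows "coeff_bound r (C * C') (f * g)"
proof (rule coeff_boundI)
  fix n
  have C: "0 \<le> C" "0 \<le> C'" using f g coeff_bound_nonneg by auto
  have "absv (fps_nth (f * g) n) \<le> C * C' / r ^ n"
    unfolding fps_mult_nth
  proof (rule absv_sum_le)
    fix i assume "i \<in> {0..n}"
    then have "r ^ n = r ^ i * r ^ (n - i)" by (simp flip: power_add)
    then have "absv (fps_nth f i * fps_nth g (n - i)) * r ^ n
        = (absv (fps_nth f i) * r ^ i) * (absv (fps_nth g (n - i)) * r ^ (n - i))"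
      by (simp add: absv_mult mult_ac)
    also have "\<dots> \<le> C * C'"
      using C r by (intro mult_mono coeff_boundD[OF f] coeff_boundD[OF g]) auto
    finally show "absv (fps_nth f i * fps_nth g (n - i)) \<le> C * C' / r ^ n"
      using r by (simp add: field_simps)
  qed (use C r in auto)
  then show "absv (fps_nth (f * g) n) * r ^ n \<le> C * C'" using r by (simp add: field_simps)
qed

lemma coeff_bound_power:
  "coeff_bound r C f \<Longrightarrow> 0 < r \<Longrightarrow> coeff_bound r (C ^ n) (f ^ n)"
  by (induction n) (auto intro: coeff_bound_1 coeff_bound_mult)

lemma coeff_bound_const_mult:
  assumes "coeff_bound r C f"
  shows "coeff_bound r (absv c * C) (fps_const c * f)"
proof (rule coeff_boundI)
  fix n show "absv (fps_nth (fps_const c * f) n) * r ^ n \<le> absv c * C"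
    using mult_left_mono[OF coeff_boundD[OF assms, of n], of "absv c"] by (simp add: absv_mult mult_ac)
qed

text \<open>With constant term 1 the recursion for the coefficients of the inverse involves no
  division, so it preserves integrality.\<close>

lemma coeff_bound_inverse:
  assumes f: "coeff_bound r 1 f" and f0: "fps_nth f 0 = 1" and r: "0 < r"
  shows "coeff_bound r 1 (inverse f)"
proof -
  have "absv (fps_nth (inverse f) n) \<le> 1 / r ^ n" for n
  proof (induction n rule: less_induct)
    case (less n)
    show ?case
    proof (cases "n = 0")
      case False
      have "fps_nth (f * inverse f) n = 0"
        using False f0 by (simp add: inverse_mult_eq_1')
      moreover have "{0..n} = insert 0 {1..n}" using False by auto
      ultimately have "fps_nth (inverse f) n = - (\<Sum>i=1..n. fps_nth f i * fps_nth (inverse f) (n - i))"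
        using f0 by (simp add: fps_mult_nth add_eq_0_iff del: fps_inverse_nth_0)
      moreover have "absv (\<Sum>i=1..n. fps_nth f i * fps_nth (inverse f) (n - i)) \<le> 1 / r ^ n"
      proof (rule absv_sum_le)
        fix i assume i: "i \<in> {1..n}"
        then have *: "r ^ n = r ^ i * r ^ (n - i)" by (simp flip: power_add)
        have "absv (fps_nth f i) \<le> 1 / r ^ i"
          using coeff_boundD[OF f, of i] r by (simp add: field_simps)
        then have "absv (fps_nth f i) * absv (fps_nth (inverse f) (n - i)) \<le> (1 / r ^ i) * (1 / r ^ (n - i))"
          using less[of "n - i"] i r by (intro mult_mono) auto
        then show "absv (fps_nth f i * fps_nth (inverse f) (n - i)) \<le> 1 / r ^ n"
          using * by (simp add: absv_mult)
      qed (use r in auto)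
      ultimately show ?thesis by simp
    qed (use f0 in simp)
  qed
  then show ?thesis using r by (auto simp: coeff_bound_def field_simps)
qed

text \<open>Natural numbers have absolute value at most 1, so a divided derivative of order
  \<open>k\<close> costs only \<open>r^k\<close>. The factors \<open>c n\<close> are left open to
  cover both \<open>fps_deriv\<close> and the coefficients of \<open>taylor\<close>.\<close>

lemma coeff_bound_hasse_deriv:
  fixes f g :: "'k::ultrametric_field fps"
  assumes "coeff_bound r C f" "0 < r" "\<And>n. fps_nth g n = of_nat (c n) * fps_nth f (n + k)"
  shows "coeff_bound r (C / r ^ k) g"
proof (rule coeff_boundI)
  fix n
  have "absv (fps_nth g n) * r ^ n \<le> absv (fps_nth f (n + k)) * r ^ n"
    using assms(2,3) absv_of_nat_le_1[of "c n", where 'k='k]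
    by (auto simp: absv_mult intro!: mult_right_mono mult_left_le_one_le)
  also have "\<dots> = absv (fps_nth f (n + k)) * r ^ (n + k) / r ^ k"
    using assms(2) by (simp add: power_add)
  also have "\<dots> \<le> C / r ^ k"
    using assms by (intro divide_right_mono coeff_boundD) auto
  finally show "absv (fps_nth g n) * r ^ n \<le> C / r ^ k" .
qed

section \<open>Gauss norms in two variables\<close>

lemma coeff_bound2_iff:
  assumes "0 < s"
  shows "coeff_bound2 r s C F \<longleftrightarrow> (\<forall>n a. absv (fps_nth (fps_nth F n) a) * r ^ a * s ^ n \<le> C)"
  using assms by (simp add: coeff_bound2_def coeff_bound_def pos_le_divide_eq)

lemma coeff_bound2_mult:
  assumes F: "coeff_bound2 r s C F" and G: "coeff_bound2 r s C' G" and r: "0 < r" and s: "0 < s"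
  shows "coeff_bound2 r s (C * C') (F * G)"
  unfolding coeff_bound2_def fps_mult_nth
proof (intro allI coeff_bound_sum)
  fix n i :: nat assume "i \<in> {0..n}"
  then have "s ^ n = s ^ i * s ^ (n - i)" by (simp flip: power_add)
  then have eq: "C * C' / s ^ n = (C / s ^ i) * (C' / s ^ (n - i))" by (simp only: times_divide_times_eq)
  show "coeff_bound r (C * C' / s ^ n) (fps_nth F i * fps_nth G (n - i))"
    using coeff_bound_mult[OF _ _ r, of "C / s ^ i" "fps_nth F i" "C' / s ^ (n - i)" "fps_nth G (n - i)"] F G
    unfolding eq coeff_bound2_def by blast
next
  fix n
  have "coeff_bound r (C / s ^ 0) (fps_nth F 0)" "coeff_bound r (C' / s ^ 0) (fps_nth G 0)"
    using F G unfolding coeff_bound2_def by blast+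
  then have "0 \<le> C" "0 \<le> C'" using coeff_bound_nonneg by fastforce+
  then show "0 \<le> C * C' / s ^ n" using s by simp
qed (use r in auto)

lemma coeff_bound2_1: "0 < s \<Longrightarrow> coeff_bound2 r s 1 1"
  by (auto simp: coeff_bound2_iff)

lemma coeff_bound2_power:
  assumes "coeff_bound2 r s C F" "0 < r" "0 < s"
  shows "coeff_bound2 r s (C ^ n) (F ^ n)"
  by (induction n) (auto intro: coeff_bound2_mult coeff_bound2_1 assms)

lemma coeff_bound2_prod:
  assumes "finite A" "\<And>i. i \<in> A \<Longrightarrow> coeff_bound2 r s 1 (f i)" "0 < r" "0 < s"
  shows "coeff_bound2 r s 1 (prod f A)"
  using assms(1,2)
proof (induction A rule: finite_induct)
  case (insert x A)
  then have "coeff_bound2 r s (1 * 1) (f x * prod f A)"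
    by (intro coeff_bound2_mult assms(3,4)) auto
  then show ?case using insert(1,2) by simp
qed (simp add: coeff_bound2_1 assms)

lemma coeff_bound_prod:
  assumes "finite A" "\<And>i. i \<in> A \<Longrightarrow> coeff_bound r 1 (f i)" "0 < r"
  shows "coeff_bound r 1 (prod f A)"
  using assms(1,2)
proof (induction A rule: finite_induct)
  case (insert x A)
  then have "coeff_bound r (1 * 1) (f x * prod f A)"
    by (intro coeff_bound_mult assms(3)) auto
  then show ?case using insert(1,2) by simp
qed (simp add: coeff_bound_1)


section \<open>Exponentials as solutions of first-order equations\<close>

text \<open>\<open>y\<close> is the exponential of the primitive of \<open>L\<close> without
  constant term. Identities between exponentials thus become identities between logarithmic
  derivatives, also when the coefficients are themselves power series.\<close>

definition log_deriv_ode :: "'a::{comm_ring_1} fps \<Rightarrow> 'a fps \<Rightarrow> bool" where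
  "log_deriv_ode L y \<longleftrightarrow> fps_nth y 0 = 1 \<and> fps_deriv y = L * y"

lemma log_deriv_ode_0: "log_deriv_ode L y \<Longrightarrow> fps_nth y 0 = 1"
  by (simp add: log_deriv_ode_def)

lemma log_deriv_ode_nth:
  "log_deriv_ode L y \<Longrightarrow>
     of_nat (n + 1) * fps_nth y (n + 1) = (\<Sum>i=0..n. fps_nth L i * fps_nth y (n - i))"
  by (metis log_deriv_ode_def fps_deriv_nth fps_mult_nth)

text \<open>The truncated form serves the exponentials of \<open>P_tilde\<close>, which agree with
  Artin-Hasse products only modulo \<open>T^(D+1)\<close>.\<close>

lemma log_deriv_ode_unique_upto:
  fixes y z :: "'a::{idom,ring_char_0} fps"
  assumes "log_deriv_ode L y" "log_deriv_ode M z" "\<And>i. i < N \<Longrightarrow> fps_nth L i = fps_nth M i" "n \<le> N"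
  shows "fps_nth y n = fps_nth z n"
  using assms(4)
proof (induction n rule: less_induct)
  case (less n)
  show ?case
  proof (cases n)
    case 0
    then show ?thesis using assms by (simp add: log_deriv_ode_def)
  next
    case (Suc k)
    have "(of_nat (k + 1) :: 'a) * fps_nth y (k + 1) = of_nat (k + 1) * fps_nth z (k + 1)"
      unfolding log_deriv_ode_nth[OF assms(1)] log_deriv_ode_nth[OF assms(2)]
      using less Suc by (intro sum.cong refl) (auto simp: assms(3))
    moreover have "(of_nat (k + 1) :: 'a) \<noteq> 0" by (simp del: of_nat_Suc of_nat_add)
    ultimately show ?thesis using Suc by (simp del: of_nat_Suc of_nat_add)
  qed
qed

lemma log_deriv_ode_unique:
  fixes y z :: "'a::{idom,ring_char_0} fps"
  assumes "log_deriv_ode L y" "log_deriv_ode L z"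
  shows "y = z"
  using log_deriv_ode_unique_upto[OF assms] by (auto simp: fps_eq_iff)

lemma log_deriv_ode_mult:
  "log_deriv_ode L y \<Longrightarrow> log_deriv_ode M z \<Longrightarrow> log_deriv_ode (L + M) (y * z)"
  by (auto simp: log_deriv_ode_def algebra_simps)

lemma log_deriv_ode_one: "log_deriv_ode 0 1"
  by (simp add: log_deriv_ode_def)

lemma log_deriv_ode_prod:
  "(\<And>i. i \<in> A \<Longrightarrow> log_deriv_ode (L i) (y i)) \<Longrightarrow> log_deriv_ode (sum L A) (prod y A)"
  by (induction A rule: infinite_finite_induct) (auto intro: log_deriv_ode_mult log_deriv_ode_one)

lemma log_deriv_ode_power:
  "log_deriv_ode L y \<Longrightarrow> log_deriv_ode (of_nat n * L) (y ^ n)"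
  by (induction n) (auto intro: log_deriv_ode_mult log_deriv_ode_one simp: algebra_simps)

lemma log_deriv_ode_inverse:
  fixes y :: "'a::field fps"
  assumes "log_deriv_ode L y"
  shows "log_deriv_ode (- L) (inverse y)"
proof -
  have y: "fps_nth y 0 = 1" "fps_deriv y = L * y" using assms by (auto simp: log_deriv_ode_def)
  have "fps_deriv (inverse y) = - (L * (y * inverse y) * inverse y)"
    using y by (simp add: fps_inverse_deriv power2_eq_square mult_ac)
  also have "\<dots> = - L * inverse y"
    using y by (simp add: inverse_mult_eq_1')
  finally have "fps_deriv (inverse y) = - L * inverse y" .
  then show ?thesis using y by (simp add: log_deriv_ode_def)
qed

lemma log_deriv_ode_compose:
  fixes y :: "'a::idom fps"
  assumes "log_deriv_ode L y" "fps_nth z 0 = 0"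
  shows "log_deriv_ode ((L oo z) * fps_deriv z) (y oo z)"
  using assms by (simp add: log_deriv_ode_def fps_compose_deriv fps_compose_mult_distrib)

lemma log_deriv_ode_exp_poly:
  fixes P :: "'k::field_char_0 poly"
  assumes "coeff P 0 = 0"
  shows "log_deriv_ode (fps_of_poly (pderiv P)) (exp_poly P)"
proof -
  have "log_deriv_ode 1 (fps_exp (1::'k))" by (simp add: log_deriv_ode_def)
  from log_deriv_ode_compose[OF this, of "fps_of_poly P"] show ?thesis
    using assms by (simp add: exp_poly_def fps_of_poly_pderiv)
qed


section \<open>Factorials and roots of unity\<close>

text \<open>Only the factors \<open>p, 2p, ..., (n div p) p\<close> of \<open>n!\<close> have
  absolute value below 1.\<close>

lemma absv_fact_div:
  assumes "extends_Qp p TYPE('k::ultrametric_field)" "prime p"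
  shows "absv (fact n :: 'k) = (1 / real p) ^ (n div p) * absv (fact (n div p) :: 'k)"
proof (induction n)
  case (Suc n)
  have f: "absv (fact (Suc n) :: 'k) = absv (of_nat (Suc n) :: 'k) * absv (fact n :: 'k)"
    by (simp add: absv_mult del: of_nat_Suc)
  show ?case
  proof (cases "p dvd Suc n")
    case True
    then obtain k where k: "Suc n = p * Suc k" by (metis dvd_def nat.distinct(1) mult_0_right not0_implies_Suc)
    have p: "p > 0" using assms prime_gt_0_nat by blast
    have "n div p = k" using k p by (intro div_nat_eqI) (auto simp: algebra_simps)
    moreover have "Suc n div p = Suc k" using k p by simp
    moreover have "absv (fact (Suc k) :: 'k) = absv (of_nat (Suc k) :: 'k) * absv (fact k :: 'k)"
      by (simp add: absv_mult del: of_nat_Suc)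
    ultimately show ?thesis
      using f Suc absv_of_nat_prime[OF assms] unfolding k
      by (simp only: of_nat_mult absv_mult power_Suc) (simp only: mult_ac)
  next
    case False
    then have "Suc n div p = n div p" by (simp add: div_Suc dvd_eq_mod_eq_0)
    then show ?thesis using f Suc absv_of_nat_not_dvd[OF assms(1) False] by (simp del: of_nat_Suc)
  qed
qed simp

text \<open>Legendre's formula \<open>v\<^sub>p(n!) = (n - s\<^sub>p(n)) / (p - 1)\<close> in multiplicative form, where the digit
  sum \<open>s\<^sub>p(n)\<close> is at least 1, and equal to 1 for powers of \<open>p\<close>.\<close>

lemma power_le_absv_fact:
  fixes a :: real
  assumes "extends_Qp p TYPE('k::ultrametric_field)" "prime p" "0 \<le> a" "a ^ (p - 1) = 1 / real p" "1 \<le> n"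
  shows "a ^ n \<le> a * absv (fact n :: 'k)"
  using assms(5)
proof (induction n rule: less_induct)
  case (less n)
  have p: "p > 1" using assms prime_gt_1_nat by blast
  have a1: "a \<le> 1"
  proof (rule ccontr)
    assume "\<not> a \<le> 1"
    then have "1 < a ^ (p - 1)" using p by (intro one_less_power) auto
    then show False using assms(4) p by simp
  qed
  define k where "k = n div p"
  have k: "absv (fact n :: 'k) = (1 / real p) ^ k * absv (fact k :: 'k)"
    unfolding k_def by (rule absv_fact_div[OF assms(1,2)])
  show ?case
  proof (cases "k = 0")
    case True
    then show ?thesis using k less.prems assms(3) a1 power_decreasing[of 1 n a] by simp
  next
    case False
    have "k < n" using p less.prems k_def by simp
    have "a ^ n \<le> a ^ (p * k)" unfolding k_def by (intro power_decreasing a1 assms(3)) simp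
    also have "p * k = (p - 1) * k + k" using p by (simp add: algebra_simps)
    also have "a ^ ((p - 1) * k + k) = (1 / real p) ^ k * a ^ k"
      by (simp only: power_add power_mult assms(4))
    also have "\<dots> \<le> (1 / real p) ^ k * (a * absv (fact k :: 'k))"
      using less.IH[OF \<open>k < n\<close>] False by (intro mult_left_mono) auto
    finally show ?thesis using k by (simp add: mult_ac)
  qed
qed

lemma power_eq_absv_fact_prime_power:
  fixes a :: real
  assumes "extends_Qp p TYPE('k::ultrametric_field)" "prime p" "a ^ (p - 1) = 1 / real p"
  shows "a ^ (p ^ h) = a * absv (fact (p ^ h) :: 'k)"
proof (induction h)
  case (Suc h)
  have p: "p > 1" using assms prime_gt_1_nat by blast
  have "p ^ Suc h = (p - 1) * p ^ h + p ^ h" using p by (simp add: algebra_simps)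
  then have "a ^ (p ^ Suc h) = (1 / real p) ^ (p ^ h) * a ^ (p ^ h)"
    by (simp only: power_add power_mult assms(3))
  also have "\<dots> = a * absv (fact (p ^ Suc h) :: 'k)"
    using absv_fact_div[OF assms(1,2), of "p ^ Suc h"] p by (simp add: Suc mult_ac)
  finally show ?case .
qed simp

text \<open>This bounds the coefficients of \<open>exp(p X)\<close>, as Dwork's criterion requires.
  It is the \<open>(p - 1)\<close>-st power of \<open>power_le_absv_fact\<close> for
  \<open>a = p^(-1/(p-1))\<close>; the exponent on \<open>|n!| \<le> 1\<close> may then be lowered
  to 1.\<close>

lemma absv_prime_power_div_fact_le:
  assumes "extends_Qp p TYPE('k::ultrametric_field)" "prime p" "1 \<le> n"
  shows "absv (of_nat p ^ n / fact n :: 'k) \<le> 1 / real p"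
proof -
  have p: "p > 1" using assms prime_gt_1_nat by blast
  define a where "a = root (p - 1) (1 / real p)"
  have a: "0 \<le> a" "a ^ (p - 1) = 1 / real p"
    unfolding a_def using p by (auto intro: real_root_pow_pos2)
  have f: "0 < absv (fact n :: 'k)" "absv (fact n :: 'k) \<le> 1"
    using absv_of_nat_le_1[of "fact n", where 'k='k] by (auto intro: absv_pos)
  have "absv (of_nat p :: 'k) ^ n = (a ^ n) ^ (p - 1)"
    using absv_of_nat_prime[OF assms(1,2)] a(2) by (metis power_mult mult.commute)
  also have "\<dots> \<le> (a * absv (fact n :: 'k)) ^ (p - 1)"
    by (intro power_mono power_le_absv_fact[OF assms(1,2) a assms(3)]) (use a in auto)
  also have "\<dots> \<le> 1 / real p * absv (fact n :: 'k)"
    unfolding power_mult_distrib a(2)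
    using f p power_decreasing[of 1 "p - 1" "absv (fact n :: 'k)"] by (intro mult_left_mono) auto
  finally show ?thesis using f by (simp add: absv_divide absv_power field_simps)
qed

lemma absv_root_of_unity:
  assumes "z ^ n = 1" "0 < n"
  shows "absv (z::'k::ultrametric_field) = 1"
proof -
  have "absv z ^ n = 1" using assms by (metis absv_1 absv_power)
  then show ?thesis using assms(2) by (metis absv_nonneg power_eq_1_iff neq0_conv abs_of_nonneg real_norm_def)
qed

text \<open>In \<open>(1 + w)^p = 1\<close> all terms of degree strictly between 0 and
  \<open>p\<close> are divisible by \<open>p\<close>. A first estimate gives \<open>|w| < 1\<close>;
  then \<open>p w\<close> strictly dominates the terms of degree 2 to \<open>p - 1\<close>, whence
  \<open>|w|^p = |w| / p\<close>.\<close>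

lemma absv_root_of_unity_minus_1:
  fixes z :: "'k::ultrametric_field"
  assumes Q: "extends_Qp p TYPE('k::ultrametric_field)" "prime p" and z: "z ^ p = 1" "z \<noteq> 1"
  shows "absv (z - 1) ^ (p - 1) = 1 / real p"
proof -
  have p: "p > 1" using Q prime_gt_1_nat by blast
  define w where "w = z - 1"
  define a where "a = absv w"
  have a0: "0 < a" using z by (simp add: a_def w_def absv_pos)
  have a1: "a \<le> 1"
    using absv_diff[of z 1] absv_root_of_unity[OF z(1)] p by (simp add: a_def w_def)
  have "(w + 1) ^ p = (\<Sum>k\<le>p. of_nat (p choose k) * w ^ k)"
    by (simp add: binomial_ring)
  then have "1 = (\<Sum>k\<le>p. of_nat (p choose k) * w ^ k)" using z by (simp add: w_def)
  also have "{..p} = insert 0 (insert p {1..p-1})" using p by auto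
  finally have sum0: "w ^ p + (\<Sum>k=1..p-1. of_nat (p choose k) * w ^ k) = 0"
    using p by simp
  have ck: "absv (of_nat (p choose k) * w ^ k) \<le> a ^ j / real p" if "k \<in> {j..p-1}" "1 \<le> j" for k j
  proof -
    have "absv (of_nat (p choose k) :: 'k) \<le> 1 / real p"
      using that p by (intro absv_of_nat_dvd Q dvd_choose_prime) auto
    moreover have "a ^ k \<le> a ^ j" using that a0 a1 by (intro power_decreasing) auto
    ultimately have "absv (of_nat (p choose k) :: 'k) * a ^ k \<le> 1 / real p * a ^ j"
      using a0 by (intro mult_mono) auto
    then show ?thesis by (simp add: absv_mult absv_power a_def)
  qed
  have "w ^ p = - (\<Sum>k=1..p-1. of_nat (p choose k) * w ^ k)"
    using sum0 by (simp add: eq_neg_iff_add_eq_0)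
  moreover have "absv (\<Sum>k=1..p-1. of_nat (p choose k) * w ^ k) \<le> a ^ 1 / real p"
    by (rule absv_sum_le) (use ck[of _ 1] a0 in auto)
  ultimately have "absv (w ^ p) \<le> a / real p" by simp
  then have "a ^ p \<le> a / real p" by (simp add: absv_power a_def)
  moreover have "a / real p < a" using a0 p by (simp add: divide_less_eq)
  ultimately have "a ^ p < a" by simp
  then have a_less: "a < 1" using a1 by (cases "a = 1") auto
  have "{1..p-1} = insert 1 {2..p-1}" using p by auto
  then have "w ^ p = - (of_nat p * w + (\<Sum>k=2..p-1. of_nat (p choose k) * w ^ k))"
    using sum0 p unfolding eq_neg_iff_add_eq_0 by simp
  moreover have "absv (\<Sum>k=2..p-1. of_nat (p choose k) * w ^ k) \<le> a ^ 2 / real p"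
    by (rule absv_sum_le) (use ck in auto)
  moreover have pw: "absv (of_nat p * w) = a / real p"
    using absv_of_nat_prime[OF Q] by (simp add: absv_mult a_def)
  moreover have "a ^ 2 / real p < a / real p"
    using a0 a_less p by (intro divide_strict_right_mono) (auto simp: power2_eq_square)
  ultimately have "absv (w ^ p) = a / real p"
    using absv_add_dominant[of "\<Sum>k=2..p-1. of_nat (p choose k) * w ^ k" "of_nat p * w"] by (simp only: absv_minus)
  then have "a * a ^ (p - 1) = a / real p"
    using p by (simp add: absv_power a_def flip: power_Suc)
  then have "a * a ^ (p - 1) = a * (1 / real p)" by simp
  then have "a ^ (p - 1) = 1 / real p" using a0 by (metis mult_left_cancel less_irrefl)
  then show ?thesis by (simp add: a_def w_def)
qed


section \<open>The Artin-Hasse exponential\<close>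

lemma fps_compose_monom_nth:
  fixes f :: "'a::comm_ring_1 fps"
  assumes "0 < i"
  shows "fps_nth (f oo (fps_const c * fps_X ^ i)) n = (if i dvd n then fps_nth f (n div i) * c ^ (n div i) else 0)"
proof -
  have "fps_nth (f oo (fps_const c * fps_X ^ i)) n
      = (\<Sum>k=0..n. fps_nth f k * (c ^ k * (if n = i * k then 1 else 0)))"
    unfolding fps_compose_nth
    by (intro sum.cong refl) (simp add: power_mult_distrib fps_const_power flip: power_mult)
  also have "\<dots> = (\<Sum>k=0..n. if i dvd n \<and> k = n div i then fps_nth f k * c ^ k else 0)"
    using assms by (intro sum.cong refl) auto
  also have "\<dots> = (if i dvd n then fps_nth f (n div i) * c ^ (n div i) else 0)"
    by (cases "i dvd n") (auto simp: sum.delta)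
  finally show ?thesis .
qed

lemma coeff_bound_compose_monom:
  fixes f :: "'k::ultrametric_field fps"
  assumes "coeff_bound 1 1 f" "0 < i" "absv c * r ^ i \<le> 1" "0 \<le> r"
  shows "coeff_bound r 1 (f oo (fps_const c * fps_X ^ i))"
proof (rule coeff_boundI)
  fix n
  show "absv (fps_nth (f oo (fps_const c * fps_X ^ i)) n) * r ^ n \<le> 1"
  proof (cases "i dvd n")
    case True
    then obtain k where k: "n = i * k" by auto
    have "absv (fps_nth f k) * (absv c * r ^ i) ^ k \<le> 1 * 1"
      using coeff_boundD[OF assms(1), of k] assms(3,4)
      by (intro mult_mono power_le_one) auto
    then show ?thesis using k assms(2)
      by (simp add: fps_compose_monom_nth absv_mult absv_power power_mult power_mult_distrib mult_ac)
  qed (use assms in \<open>simp add: fps_compose_monom_nth\<close>)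
qed

section \<open>Dwork's integrality criterion\<close>

lemma frobenius_congruence:
  fixes f g :: "'k::ultrametric_field fps"
  assumes Q: "extends_Qp p TYPE('k::ultrametric_field)" "prime p"
    and fg: "coeff_bound 1 1 f" "coeff_bound 1 1 g"
  shows "coeff_bound 1 (1 / real p) ((f + g) ^ p - (f ^ p + g ^ p))"
proof -
  have p: "p > 1" using Q prime_gt_1_nat by blast
  have "(f + g) ^ p = (\<Sum>k\<le>p. of_nat (p choose k) * f ^ k * g ^ (p - k))" by (rule binomial_ring)
  also have "{..p} = insert 0 (insert p {1..p-1})" using p by auto
  finally have "(f + g) ^ p - (f ^ p + g ^ p) = (\<Sum>k=1..p-1. of_nat (p choose k) * f ^ k * g ^ (p - k))"
    using p by (simp add: algebra_simps)
  also have "coeff_bound 1 (1 / real p) \<dots>"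
  proof (rule coeff_bound_sum)
    fix k assume k: "k \<in> {1..p-1}"
    have "coeff_bound 1 (1 ^ k * 1 ^ (p - k)) (f ^ k * g ^ (p - k))"
      by (intro coeff_bound_mult coeff_bound_power fg) auto
    then have "coeff_bound 1 (absv (of_nat (p choose k) :: 'k) * 1) (fps_const (of_nat (p choose k)) * (f ^ k * g ^ (p - k)))"
      by (intro coeff_bound_const_mult) simp
    moreover have "absv (of_nat (p choose k) :: 'k) \<le> 1 / real p"
      using k p by (intro absv_of_nat_dvd Q dvd_choose_prime) auto
    ultimately show "coeff_bound 1 (1 / real p) (of_nat (p choose k) * f ^ k * g ^ (p - k))"
      by (auto simp: mult.assoc fps_of_nat intro: coeff_bound_mono)
  qed auto
  finally show ?thesis .
qed

text \<open>The induction step \<open>(n + 1)^p - n^p - 1 = 0\<close> modulo \<open>p\<close> is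
  \<open>frobenius_congruence\<close> for constant series.\<close>

lemma absv_of_int_fermat:
  assumes Q: "extends_Qp p TYPE('k::ultrametric_field)" "prime p"
  shows "absv ((of_int n :: 'k) ^ p - of_int n) \<le> 1 / real p"
proof -
  have p: "p > 1" using Q prime_gt_1_nat by blast
  define h where "h n = (of_int n :: 'k) ^ p - of_int n" for n
  have step: "absv (h (n + 1) - h n) \<le> 1 / real p" for n
  proof -
    have "coeff_bound 1 1 (fps_const (of_int n :: 'k))" "coeff_bound 1 1 (1 :: 'k fps)"
      by (auto simp: coeff_bound_def absv_of_int_le_1)
    from coeff_boundD[OF frobenius_congruence[OF Q this], of 0] show ?thesis
      by (simp add: h_def fps_nth_power_0 algebra_simps)
  qed
  have "absv (h n) \<le> 1 / real p"
  proof (induction n rule: int_induct[where k = 0])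
    case base
    then show ?case using p by (simp add: h_def power_0_left)
  next
    case (step1 n)
    from absv_add_le[OF step[of n] step1(2)] show ?case by (simp only: diff_add_cancel)
  next
    case (step2 n)
    have "absv (h n - h (n - 1)) \<le> 1 / real p" using step[of "n - 1"] by (simp only: diff_add_cancel)
    from absv_diff_le[OF step2(2) this] show ?case by simp
  qed
  then show ?thesis by (simp add: h_def)
qed

text \<open>The congruence can fail for integral elements that are not rational; this is why the
  criterion below asks for rational coefficients.\<close>

lemma absv_Rats_fermat:
  fixes x :: "'k::ultrametric_field"
  assumes Q: "extends_Qp p TYPE('k::ultrametric_field)" "prime p" and x: "x \<in> \<rat>" "absv x \<le> 1"
  shows "absv (x ^ p - x) \<le> 1 / real p"
proof -
  have p: "p > 1" using Q prime_gt_1_nat by blast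
  obtain a b :: int where b: "b > 0" and ab: "coprime a b" and xab: "x = of_int a / of_int b"
    using x(1) by (rule Rats_cases')
  have nb: "\<not> int p dvd b"
  proof
    assume pb: "int p dvd b"
    then have "\<not> int p dvd a" using ab p Q(2) by (metis coprime_common_divisor not_prime_unit prime_int_nat_transfer prime_nat_int_transfer)
    then have "absv (of_int a :: 'k) = 1" by (rule absv_of_int_not_dvd[OF Q(1)])
    moreover have "absv (of_int b :: 'k) \<le> 1 / real p" by (rule absv_of_int_dvd[OF Q pb])
    moreover have "absv (of_int b :: 'k) > 0" using b by (intro absv_pos) simp
    moreover have "1 / real p < 1" using p by simp
    ultimately have "absv x > 1" by (simp add: xab absv_divide less_divide_eq)
    then show False using x by simp
  qed
  have ib: "absv (of_int b :: 'k) = 1" by (rule absv_of_int_not_dvd[OF Q(1) nb])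
  have "absv (((of_int a :: 'k) ^ p - of_int a) * of_int b) \<le> 1 / real p"
    using absv_of_int_fermat[OF Q, of a] ib by (simp add: absv_mult)
  moreover have "absv (of_int a * ((of_int b :: 'k) ^ p - of_int b)) \<le> 1 * (1 / real p)"
    unfolding absv_mult by (intro mult_mono absv_of_int_fermat[OF Q] absv_of_int_le_1) auto
  ultimately have "absv (((of_int a :: 'k) ^ p - of_int a) * of_int b - of_int a * ((of_int b :: 'k) ^ p - of_int b)) \<le> 1 / real p"
    by (intro absv_diff_le) auto
  moreover have "x ^ p - x = (((of_int a :: 'k) ^ p - of_int a) * of_int b - of_int a * ((of_int b :: 'k) ^ p - of_int b))
      / (of_int b ^ p * of_int b)"
    using b by (simp add: xab field_simps)
  ultimately show ?thesis using ib by (simp add: absv_divide absv_mult absv_power)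
qed

text \<open>Modulo \<open>X^(n+1)\<close> only the part of the \<open>k\<close>-th power that is
  linear in \<open>h\<close> survives, with coefficient \<open>k\<close>. For \<open>k = p\<close>
  it isolates \<open>p\<close> times the \<open>n\<close>-th coefficient of \<open>f\<close> inside
  \<open>f^p\<close>.\<close>

lemma power_add_monom_mult:
  fixes A h :: "'a::comm_ring_1 fps"
  assumes "fps_nth A 0 = 1" "0 < n"
  shows "\<exists>g. (A + fps_X ^ n * h) ^ k = A ^ k + fps_X ^ n * g \<and> fps_nth g 0 = of_nat k * fps_nth h 0"
proof (induction k)
  case (Suc k)
  then obtain g where g: "(A + fps_X ^ n * h) ^ k = A ^ k + fps_X ^ n * g" "fps_nth g 0 = of_nat k * fps_nth h 0"
    by blast
  have "(A + fps_X ^ n * h) ^ Suc k = A ^ Suc k + fps_X ^ n * (A ^ k * h + g * A + fps_X ^ n * (g * h))"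
    unfolding power_Suc2 g(1) by (simp add: algebra_simps)
  moreover have "fps_nth (A ^ k * h + g * A + fps_X ^ n * (g * h)) 0 = of_nat (Suc k) * fps_nth h 0"
    using assms g by (simp add: fps_nth_power_0 algebra_simps power_0_left)
  ultimately show ?case by blast
qed (rule exI[of _ 0], simp)

text \<open>By induction on \<open>n\<close>, compare the coefficients of \<open>X^n\<close> in
  \<open>f^p = f(X^p) g\<close> modulo \<open>p\<close>. On the right \<open>g\<close> is 1 modulo
  \<open>p\<close>. On the left the truncation \<open>A n\<close> satisfies the Frobenius
  congruence, and the only other contribution is \<open>p\<close> times the \<open>n\<close>-th
  coefficient of \<open>f\<close>, which is therefore at most \<open>1/p\<close> in absolute
  value.\<close>

lemma dwork_integrality:
  fixes f g :: "'k::ultrametric_field fps"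
  assumes Q: "extends_Qp p TYPE('k::ultrametric_field)" "prime p"
    and rat: "\<And>n. fps_nth f n \<in> \<rat>" and f0: "fps_nth f 0 = 1"
    and eq: "f ^ p = (f oo fps_X ^ p) * g" and g0: "fps_nth g 0 = 1"
    and g: "\<And>n. 1 \<le> n \<Longrightarrow> absv (fps_nth g n) \<le> 1 / real p"
  shows "absv (fps_nth f n) \<le> 1"
proof (induction n rule: less_induct)
  case (less n)
  have p: "p > 1" using Q prime_gt_1_nat by blast
  show ?case
  proof (cases "n = 0")
    case False
    define A where "A k = (\<Sum>i<k. fps_const (fps_nth f i) * fps_X ^ i)" for k
    have Anth: "fps_nth (A k) i = (if i < k then fps_nth f i else 0)" for k i
      by (simp add: A_def fps_sum_nth if_distrib sum.delta cong: if_cong)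
    have Abd: "coeff_bound 1 1 (A k)" if "k \<le> n" for k
      using that less by (intro coeff_boundI) (auto simp: Anth)
    have frob: "coeff_bound 1 (1 / real p) (A k ^ p - (\<Sum>i<k. fps_const (fps_nth f i) * fps_X ^ (p * i)))"
      if "k \<le> n" for k
      using that
    proof (induction k)
      case 0
      then show ?case using p by (simp add: A_def power_0_left coeff_bound_0)
    next
      case (Suc k)
      define m where "m = fps_const (fps_nth f k) * fps_X ^ k"
      have A': "A (Suc k) = A k + m" by (simp add: A_def m_def)
      have fk: "absv (fps_nth f k) \<le> 1" using less Suc.prems by simp
      have m: "coeff_bound 1 1 m" using fk by (intro coeff_boundI) (simp add: m_def)
      have "coeff_bound 1 (1 / real p) (fps_const (fps_nth f k ^ p - fps_nth f k) * fps_X ^ (p * k))"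
        using absv_Rats_fermat[OF Q rat fk] by (intro coeff_boundI) simp
      then have 1: "coeff_bound 1 (1 / real p) (m ^ p - fps_const (fps_nth f k) * fps_X ^ (p * k))"
        by (simp add: m_def power_mult_distrib fps_const_power mult.commute[of p] algebra_simps
             flip: power_mult fps_const_sub)
      have 2: "coeff_bound 1 (1 / real p) (A (Suc k) ^ p - (A k ^ p + m ^ p))"
        unfolding A' using Suc.prems by (intro frobenius_congruence Q Abd m) simp
      have 3: "coeff_bound 1 (1 / real p) (A k ^ p - (\<Sum>i<k. fps_const (fps_nth f i) * fps_X ^ (p * i)))"
        using Suc by simp
      from coeff_bound_add[OF 2 coeff_bound_add[OF 1 3]] show ?case
        by (simp add: algebra_simps)
    qed
    have fdec: "f = A n + fps_X ^ n * fps_shift n f"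
      by (auto simp: fps_eq_iff Anth fps_X_power_mult_nth)
    obtain h where h: "f ^ p = A n ^ p + fps_X ^ n * h" "fps_nth h 0 = of_nat p * fps_nth f n"
      using power_add_monom_mult[of "A n" n "fps_shift n f" p] fdec False f0 by (auto simp: Anth)
    \<comment> \<open>\<open>e\<close> is the coefficient of \<open>X^n\<close> in
      \<open>f(X^p)\<close>, the common value of both sides modulo \<open>p\<close>.\<close>
    define e where "e = (if p dvd n then fps_nth f (n div p) else 0)"
    have comp: "fps_nth (f oo fps_X ^ p) k = (if p dvd k then fps_nth f (k div p) else 0)" for k
      using fps_compose_monom_nth[of p f 1 k] p by simp
    have "fps_nth (\<Sum>i<n. fps_const (fps_nth f i) * fps_X ^ (p * i)) n = (\<Sum>i<n. if n = p * i then fps_nth f i else 0)"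
      by (auto simp: fps_sum_nth intro!: sum.cong)
    also have "\<dots> = (\<Sum>i<n. if i = n div p \<and> p dvd n then fps_nth f i else 0)"
      using p by (intro sum.cong) auto
    also have "\<dots> = e" using False p by (cases "p dvd n") (auto simp: e_def sum.delta)
    finally have e1: "fps_nth (\<Sum>i<n. fps_const (fps_nth f i) * fps_X ^ (p * i)) n = e" .
    have "absv (fps_nth (A n ^ p) n - e) \<le> 1 / real p"
      using coeff_boundD[OF frob[OF order_refl], of n] by (simp add: e1)
    moreover have "absv (fps_nth (f ^ p) n - e) \<le> 1 / real p"
    proof -
      have "{0..n} = insert n {0..<n}" by auto
      then have "fps_nth (f ^ p) n - e = (\<Sum>i=0..<n. fps_nth (f oo fps_X ^ p) i * fps_nth g (n - i))"
        unfolding eq fps_mult_nth using g0 comp[of n] by (simp add: e_def)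
      also have "absv \<dots> \<le> 1 / real p"
      proof (rule absv_sum_le)
        fix i assume i: "i \<in> {0..<n}"
        have "i div p < n" using i by (auto intro: le_less_trans[OF div_le_dividend])
        then have "absv (fps_nth (f oo fps_X ^ p) i) * absv (fps_nth g (n - i)) \<le> 1 * (1 / real p)"
          using i less by (intro mult_mono g) (auto simp: comp)
        then show "absv (fps_nth (f oo fps_X ^ p) i * fps_nth g (n - i)) \<le> 1 / real p"
          by (simp add: absv_mult)
      qed simp
      finally show ?thesis .
    qed
    ultimately have "absv ((fps_nth (f ^ p) n - e) - (fps_nth (A n ^ p) n - e)) \<le> 1 / real p"
      by (metis absv_diff_le)
    then have "absv (of_nat p * fps_nth f n) \<le> 1 / real p"
      using h by (simp add: fps_X_power_mult_nth)
    then show ?thesis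
      using absv_of_nat_prime[OF Q] p by (simp add: absv_mult field_simps)
  qed (simp add: f0)
qed

section \<open>The Artin-Hasse series and Pulita's exponentials\<close>

definition fps_exp_integral :: "'a::field_char_0 fps \<Rightarrow> 'a fps" where
  "fps_exp_integral L = fps_exp 1 oo fps_integral0 L"

lemma log_deriv_ode_fps_exp_integral: "log_deriv_ode L (fps_exp_integral L)"
proof -
  have "log_deriv_ode 1 (fps_exp (1::'a))" by (simp add: log_deriv_ode_def)
  from log_deriv_ode_compose[OF this, of "fps_integral0 L"] show ?thesis
    by (simp add: fps_exp_integral_def fps_deriv_fps_integral)
qed

text \<open>This is \<open>\<Sum> X^(p^k - 1)\<close>, the derivative of
  \<open>\<Sum> X^(p^k) / p^k\<close>.\<close>

definition artin_hasse_log_deriv :: "nat \<Rightarrow> 'a::field_char_0 fps" where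
  "artin_hasse_log_deriv p = Abs_fps (\<lambda>n. if \<exists>k. n + 1 = p ^ k then 1 else 0)"

definition artin_hasse :: "nat \<Rightarrow> 'a::field_char_0 fps" where
  "artin_hasse p = fps_exp_integral (artin_hasse_log_deriv p)"

lemma log_deriv_ode_artin_hasse: "log_deriv_ode (artin_hasse_log_deriv p) (artin_hasse p)"
  unfolding artin_hasse_def by (rule log_deriv_ode_fps_exp_integral)

lemma artin_hasse_nth_0: "fps_nth (artin_hasse p) 0 = 1"
  using log_deriv_ode_artin_hasse log_deriv_ode_0 by blast

lemma artin_hasse_nth_1:
  shows "fps_nth (artin_hasse p :: 'a::field_char_0 fps) 1 = 1"
  using log_deriv_ode_nth[OF log_deriv_ode_artin_hasse[of p, where 'a='a], of 0]
    exI[of "\<lambda>k. Suc 0 = p ^ k" 0]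
  by (simp add: artin_hasse_log_deriv_def artin_hasse_nth_0)

lemma artin_hasse_Rats: "fps_nth (artin_hasse p :: 'a::field_char_0 fps) n \<in> \<rat>"
proof (induction n rule: less_induct)
  case (less n)
  show ?case
  proof (cases n)
    case (Suc k)
    have "fps_nth (artin_hasse p :: 'a fps) n
       = (\<Sum>i=0..k. fps_nth (artin_hasse_log_deriv p) i * fps_nth (artin_hasse p) (k - i)) / of_nat (k + 1)"
      using log_deriv_ode_nth[OF log_deriv_ode_artin_hasse[of p, where 'a='a], of k] Suc
      by (simp add: field_simps del: of_nat_Suc of_nat_add)
    also have "\<dots> \<in> \<rat>" using less Suc
      by (intro Rats_divide Rats_sum Rats_mult) (auto simp: artin_hasse_log_deriv_def)
    finally show ?thesis .
  qed (simp add: artin_hasse_nth_0)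
qed

text \<open>Multiplying \<open>\<Sum> X^(p^k) / p^k\<close> by \<open>p\<close> gives
  \<open>p X\<close> plus the same sum in \<open>X^p\<close>.\<close>

lemma artin_hasse_power:
  assumes p: "1 < p"
  shows "artin_hasse p ^ p = (artin_hasse p oo fps_X ^ p) * (fps_exp (of_nat p) :: 'a::field_char_0 fps)"
proof (rule log_deriv_ode_unique)
  let ?L = "artin_hasse_log_deriv p :: 'a fps"
  show "log_deriv_ode (of_nat p * ?L) (artin_hasse p ^ p)"
    by (rule log_deriv_ode_power[OF log_deriv_ode_artin_hasse])
  have *: "fps_nth (of_nat p * ?L) n = fps_nth ((?L oo fps_X ^ p) * fps_deriv (fps_X ^ p) + fps_const (of_nat p)) n" for n
  proof -
    have D: "(?L oo fps_X ^ p) * fps_deriv (fps_X ^ p) = fps_const (of_nat p) * (fps_X ^ (p - 1) * (?L oo fps_X ^ p))"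
      by (simp add: fps_deriv_power fps_of_nat mult_ac)
    have C: "fps_nth (?L oo fps_X ^ p) k = (if p dvd k then fps_nth ?L (k div p) else 0)" for k
      using fps_compose_monom_nth[of p ?L 1 k] p by simp
    \<comment> \<open>The case \<open>n = 0\<close> belongs to \<open>exp(p X)\<close>; the higher
      powers of \<open>p\<close> come from the substitution of \<open>X^p\<close>.\<close>
    have pow: "(\<exists>k. n + 1 = p ^ k) \<longleftrightarrow> n = 0 \<or> (p - 1 \<le> n \<and> p dvd n - (p - 1) \<and> (\<exists>k. (n - (p - 1)) div p + 1 = p ^ k))"
    proof -
      have "(\<exists>k. n + 1 = p ^ Suc k) \<longleftrightarrow> (p - 1 \<le> n \<and> p dvd n - (p - 1) \<and> (\<exists>k. (n - (p - 1)) div p + 1 = p ^ k))"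
        (is "?A = ?B")
      proof
        assume ?A
        then obtain k where k: "n + 1 = p * p ^ k" by auto
        have pk: "1 \<le> p ^ k" using p by simp
        then have "p - 1 \<le> n" using k p by (metis Suc_eq_plus1 diff_le_mono diff_Suc_1 mult.commute mult_le_mono1 nat_mult_1)
        moreover have "n - (p - 1) = p * (p ^ k - 1)"
          using k p by (simp add: right_diff_distrib')
        moreover then have "(n - (p - 1)) div p + 1 = p ^ k" using pk p by simp
        ultimately show ?B by auto
      next
        assume ?B
        then obtain k where k: "(n - (p - 1)) div p + 1 = p ^ k" "p dvd n - (p - 1)" "p - 1 \<le> n" by auto
        then obtain c where c: "n - (p - 1) = p * c" by auto
        then have "c + 1 = p ^ k" using k p by simp
        moreover have "n + 1 = p * (c + 1)" using c k(3) p by (simp add: algebra_simps)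
        ultimately show ?A by auto
      qed
      moreover have "(\<exists>k. n + 1 = p ^ k) \<longleftrightarrow> n = 0 \<or> (\<exists>k. n + 1 = p ^ Suc k)"
        by (metis add_0 add_is_1 not0_implies_Suc One_nat_def add.right_neutral power_0 add_cancel_right_left)
      ultimately show ?thesis by blast
    qed
    have L: "fps_nth ?L k = (if \<exists>j. k + 1 = p ^ j then 1 else 0)" for k
      by (simp add: artin_hasse_log_deriv_def)
    show ?thesis
      unfolding D fps_add_nth fps_mult_left_const_nth fps_of_nat[symmetric] C L fps_X_power_mult_nth
        fps_nth_fps_const pow
      using p by (simp del: One_nat_def)
  qed
  have "log_deriv_ode (fps_const (of_nat p)) (fps_exp (of_nat p) :: 'a fps)"
    by (simp add: log_deriv_ode_def)
  moreover have "fps_nth (fps_X ^ p :: 'a fps) 0 = 0" using p by simp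
  ultimately have "log_deriv_ode ((?L oo fps_X ^ p) * fps_deriv (fps_X ^ p) + fps_const (of_nat p))
      ((artin_hasse p oo fps_X ^ p) * (fps_exp (of_nat p) :: 'a fps))"
    by (intro log_deriv_ode_mult log_deriv_ode_compose log_deriv_ode_artin_hasse)
  moreover have "of_nat p * ?L = (?L oo fps_X ^ p) * fps_deriv (fps_X ^ p) + fps_const (of_nat p)"
    unfolding fps_eq_iff using * by blast
  ultimately show "log_deriv_ode (of_nat p * ?L) ((artin_hasse p oo fps_X ^ p) * (fps_exp (of_nat p) :: 'a fps))"
    by simp
qed

lemma coeff_bound_artin_hasse:
  assumes Q: "extends_Qp p TYPE('k::ultrametric_field)" "prime p"
  shows "coeff_bound 1 1 (artin_hasse p :: 'k fps)"
proof -
  have p: "1 < p" using Q prime_gt_1_nat by blast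
  have "absv (fps_nth (artin_hasse p :: 'k fps) n) \<le> 1" for n
  proof (rule dwork_integrality[OF Q artin_hasse_Rats artin_hasse_nth_0 artin_hasse_power[OF p]])
    fix n :: nat assume "1 \<le> n"
    then show "absv (fps_nth (fps_exp (of_nat p) :: 'k fps) n) \<le> 1 / real p"
      using absv_prime_power_div_fact_le[OF Q] by simp
  qed simp
  then show ?thesis by (simp add: coeff_bound_def)
qed

text \<open>For \<open>z\<^bsup>p\<^sup>s\<^sup>+\<^sup>1\<^esup> = 1\<close> this is Pulita's exponential
  \<open>exp (\<Sum>k\<le>s. (z\<^bsup>p\<^sup>k\<^esup> - 1) T\<^bsup>p\<^sup>k\<^esup> / p\<^sup>k)\<close>.\<close>

definition pulita_exp :: "nat \<Rightarrow> 'a::field_char_0 \<Rightarrow> 'a fps" where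
  "pulita_exp p z = (artin_hasse p oo (fps_const z * fps_X)) * inverse (artin_hasse p)"

definition pulita_log_deriv :: "nat \<Rightarrow> 'a::field_char_0 \<Rightarrow> 'a fps" where
  "pulita_log_deriv p z = Abs_fps (\<lambda>n. if \<exists>k. n + 1 = p ^ k then z ^ (n + 1) - 1 else 0)"

lemma log_deriv_ode_pulita_exp: "log_deriv_ode (pulita_log_deriv p z) (pulita_exp p z)"
proof -
  let ?L = "artin_hasse_log_deriv p :: 'a fps"
  have "fps_nth (?L oo (fps_const z * fps_X)) n = fps_nth ?L n * z ^ n" for n
    using fps_compose_monom_nth[of 1 ?L z n] by simp
  then have "pulita_log_deriv p z = (?L oo (fps_const z * fps_X)) * fps_deriv (fps_const z * fps_X) + - ?L"
    by (auto simp: fps_eq_iff pulita_log_deriv_def artin_hasse_log_deriv_def)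
  then show ?thesis unfolding pulita_exp_def
    using log_deriv_ode_mult[OF log_deriv_ode_compose[OF log_deriv_ode_artin_hasse, of "fps_const z * fps_X"]
        log_deriv_ode_inverse[OF log_deriv_ode_artin_hasse]] by simp
qed

lemma coeff_bound_pulita_exp:
  assumes Q: "extends_Qp p TYPE('k::ultrametric_field)" "prime p" and z: "absv (z::'k) \<le> 1"
  shows "coeff_bound 1 1 (pulita_exp p z)"
proof -
  have "coeff_bound 1 1 (artin_hasse p oo (fps_const z * fps_X ^ 1))"
    using z by (intro coeff_bound_compose_monom coeff_bound_artin_hasse Q) auto
  moreover have "coeff_bound 1 1 (inverse (artin_hasse p :: 'k fps))"
    by (intro coeff_bound_inverse coeff_bound_artin_hasse Q artin_hasse_nth_0) simp
  ultimately have "coeff_bound 1 (1 * 1) (pulita_exp p z)"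
    unfolding pulita_exp_def by (intro coeff_bound_mult) auto
  then show ?thesis by simp
qed


section \<open>Bases of quotients of spaces of power series\<close>

interpretation fps_vs: vector_space "\<lambda>c (f :: 'k::field fps). fps_const c * f"
proof
  fix a b :: 'k and x y :: "'k fps"
  show "fps_const a * (x + y) = fps_const a * x + fps_const a * y" by (rule distrib_left)
  show "fps_const (a + b) * x = fps_const a * x + fps_const b * x"
    by (simp only: fps_const_add[symmetric] distrib_right)
  show "fps_const a * (fps_const b * x) = fps_const (a * b) * x"
    by (simp only: fps_const_mult[symmetric] mult.assoc)
qed simp

definition fps_lincomb :: "nat \<Rightarrow> (nat \<Rightarrow> 'k::field) \<Rightarrow> (nat \<Rightarrow> 'k fps) \<Rightarrow> 'k fps" where
  "fps_lincomb n c b = (\<Sum>i<n. fps_const (c i) * b i)"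

definition spans_mod :: "nat \<Rightarrow> (nat \<Rightarrow> 'k::field fps) \<Rightarrow> 'k fps set \<Rightarrow> 'k fps set \<Rightarrow> bool" where
  "spans_mod n b V W \<longleftrightarrow> (\<forall>f\<in>V. \<exists>c. f - fps_lincomb n c b \<in> W)"

definition indep_mod :: "nat \<Rightarrow> (nat \<Rightarrow> 'k::field fps) \<Rightarrow> 'k fps set \<Rightarrow> bool" where
  "indep_mod n b W \<longleftrightarrow> (\<forall>c. fps_lincomb n c b \<in> W \<longrightarrow> (\<forall>i<n. c i = 0))"

lemma fps_lincomb_diff:
  "fps_lincomb n (\<lambda>i. c i - d i) b = fps_lincomb n c b - fps_lincomb n d b"
  by (simp only: fps_lincomb_def sum_subtractf left_diff_distrib fps_const_sub[symmetric])

lemma fps_lincomb_cmult: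
  "fps_lincomb n (\<lambda>i. x * c i) b = fps_const x * fps_lincomb n c b"
  by (simp only: fps_lincomb_def sum_distrib_left mult.assoc fps_const_mult[symmetric])

lemma has_quotient_dimI:
  assumes b: "\<And>i. i < n \<Longrightarrow> b i \<in> V" and W: "fps_vs.subspace W"
    and sp: "spans_mod n b V W" and ind: "indep_mod n b W"
  shows "has_quotient_dim V W n"
  unfolding has_quotient_dim_def
proof (intro exI[of _ b] conjI ballI)
  fix f assume "f \<in> V"
  then obtain c where c: "f - fps_lincomb n c b \<in> W" using sp by (auto simp: spans_mod_def)
  show "\<exists>!c. (\<forall>i\<ge>n. c i = 0) \<and> f - (\<Sum>i<n. fps_const (c i) * b i) \<in> W"
  proof (rule ex1I[of _ "\<lambda>i. if i < n then c i else 0"])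
    show "(\<forall>i\<ge>n. (if i < n then c i else 0) = 0) \<and> f - (\<Sum>i<n. fps_const (if i < n then c i else 0) * b i) \<in> W"
      using c by (simp add: fps_lincomb_def)
  next
    fix d assume d: "(\<forall>i\<ge>n. d i = 0) \<and> f - (\<Sum>i<n. fps_const (d i) * b i) \<in> W"
    then have "(f - fps_lincomb n d b) - (f - fps_lincomb n c b) \<in> W"
      by (intro fps_vs.subspace_diff[OF W _ c]) (simp add: fps_lincomb_def)
    then have "fps_lincomb n (\<lambda>i. c i - d i) b \<in> W" by (simp add: fps_lincomb_diff)
    then have "\<forall>i<n. c i - d i = 0" using ind unfolding indep_mod_def by blast
    then show "d = (\<lambda>i. if i < n then c i else 0)" using d by (auto simp: fun_eq_iff)
  qed
qed (use b in auto)

text \<open>Steinitz's inequality for \<open>V / W\<close> without forming the quotient: each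
  \<open>b' j\<close> is congruent modulo \<open>W\<close> to a combination \<open>e j\<close> of
  the \<open>b i\<close>, and a linear relation among the \<open>e j\<close> is a relation modulo
  \<open>W\<close> among the \<open>b' j\<close>.\<close>

lemma indep_mod_card_le:
  assumes W: "fps_vs.subspace W" and ind: "indep_mod m b' W" and V: "\<And>j. j < m \<Longrightarrow> b' j \<in> V"
    and sp: "spans_mod n b V W"
  shows "m \<le> n"
proof -
  have "\<forall>j. \<exists>c. j < m \<longrightarrow> b' j - fps_lincomb n c b \<in> W"
    using V sp by (auto simp: spans_mod_def)
  then obtain C where C: "\<And>j. j < m \<Longrightarrow> b' j - fps_lincomb n (C j) b \<in> W" by metis
  define e where "e j = fps_lincomb n (C j) b" for j
  have key: "\<forall>j<m. u j = 0" if "(\<Sum>j<m. fps_const (u j) * e j) = 0" for u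
  proof -
    have "(\<Sum>j<m. fps_const (u j) * (b' j - e j)) \<in> W"
      using C by (intro fps_vs.subspace_sum[OF W] fps_vs.subspace_scale[OF W]) (auto simp: e_def)
    then have "fps_lincomb m u b' \<in> W"
      using that by (simp add: fps_lincomb_def right_diff_distrib sum_subtractf)
    then show ?thesis using ind by (simp add: indep_mod_def)
  qed
  \<comment> \<open>Independence is a property of the set of the \<open>e j\<close>, so repetitions
    have to be excluded; \<open>e j = e k\<close> would be the relation with coefficients 1 and
    -1.\<close>
  have inj: "inj_on e {..<m}"
  proof (rule inj_onI, rule ccontr)
    fix j k assume jk: "j \<in> {..<m}" "k \<in> {..<m}" "e j = e k" "j \<noteq> k"
    define u where "u i = (if i = j then 1 else if i = k then -1 else 0 :: 'a)" for i
    have "(\<Sum>i<m. fps_const (u i) * e i) = (\<Sum>i<m. (if i = j then e i else 0) - (if i = k then e i else 0))"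
      using jk(4) by (intro sum.cong refl) (auto simp: u_def simp flip: fps_const_neg)
    also have "\<dots> = 0" using jk by (simp add: sum_subtractf)
    finally have "u j = 0" using key jk by blast
    then show False by (simp add: u_def)
  qed
  have "fps_vs.independent (e ` {..<m})"
  proof
    assume "fps_vs.dependent (e ` {..<m})"
    then obtain u v where u: "v \<in> e ` {..<m}" "u v \<noteq> 0" "(\<Sum>v\<in>e ` {..<m}. fps_const (u v) * v) = 0"
      by (auto simp: fps_vs.dependent_finite)
    then have "(\<Sum>j<m. fps_const (u (e j)) * e j) = 0"
      using inj by (simp add: sum.reindex)
    then show False using key[of "\<lambda>j. u (e j)"] u by auto
  qed
  moreover have "e ` {..<m} \<subseteq> fps_vs.span (b ` {..<n})"
    unfolding e_def fps_lincomb_def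
    by (intro image_subsetI fps_vs.span_sum fps_vs.span_scale fps_vs.span_base) auto
  ultimately have "card (e ` {..<m}) \<le> card (b ` {..<n})"
    using fps_vs.independent_span_bound[of "b ` {..<n}" "e ` {..<m}"] by simp
  also have "\<dots> \<le> n" using card_image_le[of "{..<n}" b] by simp
  finally show ?thesis using inj by (simp add: card_image)
qed

lemma spans_mod_drop:
  assumes W: "fps_vs.subspace W" and sp: "spans_mod (Suc n) b V W"
    and dep: "\<not> indep_mod (Suc n) b W"
  shows "\<exists>b'. (\<forall>i<n. b' i \<in> b ` {..<Suc n}) \<and> spans_mod n b' V W"
proof -
  obtain c j where c: "fps_lincomb (Suc n) c b \<in> W" "j < Suc n" "c j \<noteq> 0"
    using dep by (auto simp: indep_mod_def)
  \<comment> \<open>The vector \<open>b j\<close> is redundant modulo \<open>W\<close>; the last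
    vector moves into its place, so that the indices stay \<open>0, ..., n - 1\<close>.\<close>
  define b' where "b' i = (if i = j then b n else b i)" for i
  have "spans_mod n b' V W" unfolding spans_mod_def
  proof
    fix f assume "f \<in> V"
    then obtain d where d: "f - fps_lincomb (Suc n) d b \<in> W" using sp by (auto simp: spans_mod_def)
    define x where "x = d j / c j"
    define e where "e = (\<lambda>i. d i - x * c i)"
    have ej: "e j = 0" using c by (simp add: e_def x_def)
    have "fps_lincomb (Suc n) e b = fps_lincomb (Suc n) d b - fps_const x * fps_lincomb (Suc n) c b"
      by (simp add: e_def fps_lincomb_diff fps_lincomb_cmult)
    then have "f - fps_lincomb (Suc n) e b = (f - fps_lincomb (Suc n) d b) + fps_const x * fps_lincomb (Suc n) c b"
      by simp
    then have "f - fps_lincomb (Suc n) e b \<in> W"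
      using c d by (metis fps_vs.subspace_add[OF W] fps_vs.subspace_scale[OF W])
    moreover have "fps_lincomb (Suc n) e b = fps_lincomb n (\<lambda>i. if i = j then e n else e i) b'"
    proof (cases "j = n")
      case True
      then show ?thesis using ej by (simp add: fps_lincomb_def b'_def)
    next
      case False
      then have j: "j \<in> {..<n}" using c by simp
      have "fps_lincomb (Suc n) e b = (\<Sum>i\<in>{..<n}-{j}. fps_const (e i) * b i) + fps_const (e n) * b n"
        using sum.remove[OF _ j, of "\<lambda>i. fps_const (e i) * b i"] ej by (simp add: fps_lincomb_def)
      also have "\<dots> = fps_lincomb n (\<lambda>i. if i = j then e n else e i) b'"
        unfolding fps_lincomb_def
        by (subst sum.remove[OF _ j]) (auto simp: b'_def intro!: sum.cong)
      finally show ?thesis .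
    qed
    ultimately show "\<exists>c. f - fps_lincomb n c b' \<in> W" by metis
  qed
  then show ?thesis by (intro exI[of _ b']) (auto simp: b'_def)
qed

text \<open>Vectors are discarded or moved but never altered, so the basis inherits any property
  \<open>X\<close> of the spanning family. Later \<open>X\<close> says that the vectors are
  polynomials.\<close>

lemma spans_mod_imp_basis_mod:
  assumes W: "fps_vs.subspace W" and sp: "spans_mod n b V W" and X: "\<And>i. i < n \<Longrightarrow> b i \<in> X"
  shows "\<exists>m b'. (\<forall>i<m. b' i \<in> X) \<and> spans_mod m b' V W \<and> indep_mod m b' W"
  using sp X
proof (induction n arbitrary: b)
  case 0
  then show ?case by (intro exI[of _ 0] exI[of _ b]) (auto simp: indep_mod_def)
next
  case (Suc n)
  show ?case
  proof (cases "indep_mod (Suc n) b W")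
    case True
    then show ?thesis using Suc.prems by blast
  next
    case False
    then obtain b' where b': "\<forall>i<n. b' i \<in> b ` {..<Suc n}" "spans_mod n b' V W"
      using spans_mod_drop[OF W Suc.prems(1)] by blast
    have "b' i \<in> X" if "i < n" for i
      using b'(1) that Suc.prems(2) by fastforce
    then show ?thesis by (rule Suc.IH[OF b'(2)])
  qed
qed

lemma spans_mod_card_imp_indep_mod:
  assumes W: "fps_vs.subspace W" and sp: "spans_mod n b V W"
    and ind: "indep_mod n b' W" and V: "\<And>j. j < n \<Longrightarrow> b' j \<in> V"
  shows "indep_mod n b W"
proof (cases n)
  case (Suc k)
  show ?thesis
  proof (rule ccontr)
    assume "\<not> indep_mod n b W"
    then obtain b'' where "spans_mod k b'' V W" using spans_mod_drop[OF W] sp Suc by blast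
    then have "n \<le> k" using indep_mod_card_le[OF W ind V] by blast
    then show False using Suc by simp
  qed
qed (simp add: indep_mod_def)

lemma fps_lincomb_flatten:
  "(\<Sum>l<q. \<Sum>i<n. fps_const (c (l * n + i)) * B l i)
     = fps_lincomb (q * n) c (\<lambda>j. B (j div n) (j mod n))"
proof -
  have "(\<Sum>i<n. fps_const (c (l * n + i)) * B l i)
      = sum (\<lambda>j. fps_const (c j) * B (j div n) (j mod n)) {l * n..<l * n + n}" for l
  proof -
    have "sum (\<lambda>j. fps_const (c j) * B (j div n) (j mod n)) {l * n..<l * n + n}
        = (\<Sum>i\<in>{0..<n}. fps_const (c (i + l * n)) * B ((i + l * n) div n) ((i + l * n) mod n))"
      using sum.shift_bounds_nat_ivl[of "\<lambda>j. fps_const (c j) * B (j div n) (j mod n)" 0 "l * n" n]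
      by (simp add: add.commute)
    also have "\<dots> = (\<Sum>i<n. fps_const (c (l * n + i)) * B l i)"
      unfolding lessThan_atLeast0 by (intro sum.cong refl) (auto simp: add.commute)
    finally show ?thesis by simp
  qed
  then show ?thesis by (simp add: fps_lincomb_def sum.nat_group)
qed

text \<open>If \<open>A\<close> is injective on \<open>V\<close>, then \<open>V / A\<^sup>q V\<close> has a filtration whose \<open>q\<close> successive quotients
  are isomorphic to \<open>V / A V\<close>.\<close>

locale injective_endomorphism =
  fixes V :: "'k::field fps set" and A :: "'k fps \<Rightarrow> 'k fps"
  assumes V: "fps_vs.subspace V"
    and add: "\<And>f g. A (f + g) = A f + A g"
    and scale: "\<And>c f. A (fps_const c * f) = fps_const c * A f"
    and maps: "\<And>f. f \<in> V \<Longrightarrow> A f \<in> V"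
    and inj: "\<And>f. f \<in> V \<Longrightarrow> A f = 0 \<Longrightarrow> f = 0"
begin

lemma zero: "A 0 = 0" using scale[of 0 0] by simp

lemma diff: "A (f - g) = A f - A g"
  using add[of "f - g" g] by simp

lemma sum: "A (sum f S) = (\<Sum>i\<in>S. A (f i))"
  by (induction S rule: infinite_finite_induct) (auto simp: zero add)

lemma pow_add: "(A ^^ q) (f + g) = (A ^^ q) f + (A ^^ q) g"
  by (induction q) (auto simp: add)

lemma pow_scale: "(A ^^ q) (fps_const c * f) = fps_const c * (A ^^ q) f"
  by (induction q) (auto simp: scale)

lemma pow_zero: "(A ^^ q) 0 = 0"
  using pow_scale[of q 0 0] by simp

lemma pow_sum: "(A ^^ q) (sum f S) = (\<Sum>i\<in>S. (A ^^ q) (f i))"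
  by (induction S rule: infinite_finite_induct) (auto simp: pow_zero pow_add)

lemma pow_maps: "f \<in> V \<Longrightarrow> (A ^^ q) f \<in> V"
  by (induction q) (auto simp: maps)

lemma subspace_image: "fps_vs.subspace ((A ^^ q) ` V)"
proof (rule fps_vs.subspaceI)
  show "0 \<in> (A ^^ q) ` V" using fps_vs.subspace_0[OF V] pow_zero by force
  show "x + y \<in> (A ^^ q) ` V" if "x \<in> (A ^^ q) ` V" "y \<in> (A ^^ q) ` V" for x y
    using that fps_vs.subspace_add[OF V] by (auto simp flip: pow_add)
  show "fps_const c * x \<in> (A ^^ q) ` V" if "x \<in> (A ^^ q) ` V" for c x
    using that fps_vs.subspace_scale[OF V] by (auto simp flip: pow_scale)
qed

lemma spans_mod_pow:
  assumes "spans_mod n b V (A ` V)"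
  shows "spans_mod (q * n) (\<lambda>j. (A ^^ (j div n)) (b (j mod n))) V ((A ^^ q) ` V)"
proof -
  have *: "\<exists>c. f - (\<Sum>l<q. \<Sum>i<n. fps_const (c l i) * (A ^^ l) (b i)) \<in> (A ^^ q) ` V" if "f \<in> V" for f
  proof (induction q)
    case (Suc q)
    then obtain c g where g: "g \<in> V" "f - (\<Sum>l<q. \<Sum>i<n. fps_const (c l i) * (A ^^ l) (b i)) = (A ^^ q) g" by blast
    obtain d h where h: "h \<in> V" "g - fps_lincomb n d b = A h"
      using assms g(1) unfolding spans_mod_def by blast
    have "g = A h + fps_lincomb n d b" using h(2) by (metis diff_add_cancel)
    then have "(A ^^ q) g = (A ^^ q) (A h) + (A ^^ q) (fps_lincomb n d b)"
      by (simp only: pow_add)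
    also have "(A ^^ q) (fps_lincomb n d b) = (\<Sum>i<n. fps_const (d i) * (A ^^ q) (b i))"
      by (simp add: fps_lincomb_def pow_sum pow_scale)
    finally have "f - (\<Sum>l<Suc q. \<Sum>i<n. fps_const ((c(q := d)) l i) * (A ^^ l) (b i)) = (A ^^ Suc q) h"
      using g(2) by (simp add: funpow_swap1 algebra_simps)
    then show ?case using h(1) by blast
  qed (use that in simp)
  show ?thesis unfolding spans_mod_def
  proof
    fix f assume "f \<in> V"
    then obtain c where c: "f - (\<Sum>l<q. \<Sum>i<n. fps_const (c l i) * (A ^^ l) (b i)) \<in> (A ^^ q) ` V"
      using * by blast
    have "(\<Sum>l<q. \<Sum>i<n. fps_const (c l i) * (A ^^ l) (b i))
        = (\<Sum>l<q. \<Sum>i<n. fps_const (c ((l * n + i) div n) ((l * n + i) mod n)) * (A ^^ l) (b i))"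
      by (intro sum.cong refl) auto
    then show "\<exists>c. f - fps_lincomb (q * n) c (\<lambda>j. (A ^^ (j div n)) (b (j mod n))) \<in> (A ^^ q) ` V"
      using c fps_lincomb_flatten[of "\<lambda>j. c (j div n) (j mod n)" n "\<lambda>l i. (A ^^ l) (b i)" q] by metis
  qed
qed

text \<open>Modulo \<open>A V\<close> only the layer \<open>l = 0\<close> remains, so its
  coefficients vanish. Injectivity then cancels one \<open>A\<close> from the rest of the relation,
  and the induction goes on.\<close>

lemma indep_mod_pow:
  assumes ind: "indep_mod n b (A ` V)" and b: "\<And>i. i < n \<Longrightarrow> b i \<in> V"
  shows "indep_mod (q * n) (\<lambda>j. (A ^^ (j div n)) (b (j mod n))) ((A ^^ q) ` V)"
proof -
  have *: "\<forall>l<q. \<forall>i<n. c l i = 0"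
    if "(\<Sum>l<q. \<Sum>i<n. fps_const (c l i) * (A ^^ l) (b i)) \<in> (A ^^ q) ` V" for c
    using that
  proof (induction q arbitrary: c)
    case (Suc q)
    define R where "R = (\<Sum>l<q. \<Sum>i<n. fps_const (c (Suc l) i) * (A ^^ l) (b i))"
    have R: "R \<in> V" unfolding R_def
      using b by (intro fps_vs.subspace_sum[OF V] fps_vs.subspace_scale[OF V] pow_maps) auto
    have AR: "A R = (\<Sum>l<q. \<Sum>i<n. fps_const (c (Suc l) i) * (A ^^ Suc l) (b i))"
      by (simp add: R_def sum scale)
    have eq: "(\<Sum>l<Suc q. \<Sum>i<n. fps_const (c l i) * (A ^^ l) (b i)) = fps_lincomb n (c 0) b + A R"
      by (subst sum.lessThan_Suc_shift) (simp add: AR fps_lincomb_def)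
    obtain v where v: "v \<in> V" "fps_lincomb n (c 0) b + A R = A ((A ^^ q) v)"
      using Suc.prems unfolding eq by auto
    then have "fps_lincomb n (c 0) b = A ((A ^^ q) v - R)" by (simp add: diff algebra_simps)
    then have "fps_lincomb n (c 0) b \<in> A ` V"
      using R pow_maps[OF v(1)] fps_vs.subspace_diff[OF V] by blast
    then have c0: "\<forall>i<n. c 0 i = 0" using ind by (simp add: indep_mod_def)
    then have "A ((A ^^ q) v - R) = 0" using v(2) by (simp add: fps_lincomb_def diff)
    then have "(A ^^ q) v - R = 0" using R pow_maps[OF v(1)] fps_vs.subspace_diff[OF V] inj by blast
    then have "R \<in> (A ^^ q) ` V" using v(1) by auto
    then have "\<forall>l<q. \<forall>i<n. c (Suc l) i = 0" using Suc.IH[of "\<lambda>l. c (Suc l)"] by (simp add: R_def)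
    then show ?case using c0 by (metis less_Suc_eq_0_disj)
  qed simp
  show ?thesis unfolding indep_mod_def
  proof (intro allI impI)
    fix c j assume "fps_lincomb (q * n) c (\<lambda>j. (A ^^ (j div n)) (b (j mod n))) \<in> (A ^^ q) ` V" and j: "j < q * n"
    then have "\<forall>l<q. \<forall>i<n. c (l * n + i) = 0"
      using *[of "\<lambda>l i. c (l * n + i)"] fps_lincomb_flatten[of c n "\<lambda>l i. (A ^^ l) (b i)" q] by simp
    moreover have "n > 0" using j by (cases n) auto
    then have "j div n < q" "j mod n < n" using j by (auto simp: less_mult_imp_div_less)
    ultimately have "c (j div n * n + j mod n) = 0" by blast
    then show "c j = 0" by simp
  qed
qed

text \<open>A basis modulo the smaller space \<open>A^q V\<close> spans modulo \<open>A V\<close>,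
  which yields the finiteness of \<open>V / A V\<close>. Counting in \<open>V / A^q V\<close> in
  both directions then gives \<open>n q = M\<close>.\<close>

lemma basis_mod_of_pow_basis:
  assumes sp: "spans_mod M e V ((A ^^ q) ` V)" and ind: "indep_mod M e ((A ^^ q) ` V)"
    and e: "\<And>i. i < M \<Longrightarrow> e i \<in> V \<inter> X" and q: "0 < q"
  shows "\<exists>n b. n * q = M \<and> (\<forall>i<n. b i \<in> V \<inter> X) \<and> spans_mod n b V (A ` V) \<and> indep_mod n b (A ` V)"
proof -
  have W: "fps_vs.subspace (A ` V)" using subspace_image[of 1] by simp
  have "(A ^^ q) f \<in> A ` V" if "f \<in> V" for f
    using q that by (cases q) (auto simp: pow_maps)
  then have "(A ^^ q) ` V \<subseteq> A ` V" by blast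
  then have "spans_mod M e V (A ` V)" using sp unfolding spans_mod_def by (meson subsetD)
  then obtain n b where nb: "\<forall>i<n. b i \<in> V \<inter> X" "spans_mod n b V (A ` V)" "indep_mod n b (A ` V)"
    using spans_mod_imp_basis_mod[OF W, of M e V "V \<inter> X"] e by blast
  have b: "(A ^^ (j div n)) (b (j mod n)) \<in> V" if "j < q * n" for j
  proof -
    have "n > 0" using that by (cases n) auto
    then show ?thesis using nb(1) by (auto intro: pow_maps)
  qed
  have "q * n \<le> M"
    by (rule indep_mod_card_le[OF subspace_image indep_mod_pow[OF nb(3)] b sp]) (use nb in auto)
  moreover have "M \<le> q * n"
    by (rule indep_mod_card_le[OF subspace_image ind _ spans_mod_pow[OF nb(2)]]) (use e in auto)
  ultimately have "n * q = M" by (simp add: mult.commute)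
  then show ?thesis using nb by blast
qed

end


section \<open>Small perturbations of multiplication by a monomial\<close>

text \<open>In an ultrametric space the distance to the limit is bounded by the largest remaining
  step, so no factor \<open>1 / (1 - \<theta>)\<close> appears.\<close>

lemma ultrametric_geometric_limit:
  fixes x :: "nat \<Rightarrow> 'k::ultrametric_field"
  assumes step: "\<And>k. absv (x (Suc k) - x k) \<le> C * \<theta> ^ k" and \<theta>: "0 \<le> \<theta>" "\<theta> < 1"
  shows "\<exists>y. \<forall>k. absv (y - x k) \<le> C * \<theta> ^ k"
proof -
  have C: "0 \<le> C" using order_trans[OF absv_nonneg step[of 0]] by simp
  have tail: "absv (x (k + m) - x k) \<le> C * \<theta> ^ k" for k m
  proof (induction m)
    case (Suc m)
    have "C * \<theta> ^ (k + m) \<le> C * \<theta> ^ k" using C \<theta> by (intro mult_left_mono power_decreasing) auto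
    then have "absv (x (Suc (k + m)) - x (k + m)) \<le> C * \<theta> ^ k" using step[of "k + m"] by simp
    from absv_add_le[OF this Suc] show ?case by simp
  qed (use C \<theta> in simp)
  have null: "(\<lambda>k. C * \<theta> ^ k) \<longlonglongrightarrow> 0"
    using \<theta> by (intro tendsto_mult_right_zero LIMSEQ_realpow_zero)
  have "Cauchy x"
  proof (rule metric_CauchyI)
    fix e :: real assume e: "0 < e"
    then obtain K where K: "C * \<theta> ^ K < e"
      using order_tendstoD(2)[OF null e] by (auto simp: eventually_sequentially)
    have *: "absv (x m - x K) < e" if "m \<ge> K" for m
      using tail[of K "m - K"] that K by simp
    have "dist (x m) (x n) < e" if "m \<ge> K" "n \<ge> K" for m n
      using absv_diff[of "x m - x K" "x n - x K"] *[OF that(1)] *[OF that(2)] by (simp add: dist_absv)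
    then show "\<exists>M. \<forall>m\<ge>M. \<forall>n\<ge>M. dist (x m) (x n) < e" by blast
  qed
  then obtain y where y: "x \<longlonglongrightarrow> y" using Cauchy_convergent convergent_def by blast
  have "absv (y - x k) \<le> C * \<theta> ^ k" for k
  proof (rule ccontr)
    assume "\<not> ?thesis"
    then have lt: "C * \<theta> ^ k < absv (y - x k)" by simp
    then have "0 < absv (y - x k)" using C \<theta> by (meson le_less_trans mult_nonneg_nonneg zero_le_power)
    then obtain M where M: "\<And>m. m \<ge> M \<Longrightarrow> dist (x m) y < absv (y - x k)"
      using metric_LIMSEQ_D[OF y] by blast
    have "absv (y - x (k + M)) < absv (y - x k)"
      using M[of "k + M"] by (simp add: dist_commute flip: dist_absv)
    moreover have "absv (x (k + M) - x k) < absv (y - x k)" using tail[of k M] lt by simp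
    ultimately show False
      using absv_ultrametric[of "y - x (k + M)" "x (k + M) - x k"] by simp
  qed
  then show ?thesis by blast
qed

text \<open>The bounded functions on the open disc of radius \<open>r\<close>. A uniform bound on
  coefficients survives coefficientwise limits, as the successive approximation below
  requires.\<close>

definition bounded_fps :: "real \<Rightarrow> 'k::ultrametric_field fps set" where
  "bounded_fps r = {f. \<exists>C. coeff_bound r C f}"

lemma bounded_fpsI: "coeff_bound r C f \<Longrightarrow> f \<in> bounded_fps r"
  by (auto simp: bounded_fps_def)

lemma subspace_bounded_fps:
  assumes r: "0 \<le> r"
  shows "fps_vs.subspace (bounded_fps r :: 'k::ultrametric_field fps set)"
proof (rule fps_vs.subspaceI)
  show "x + y \<in> bounded_fps r" if xy: "x \<in> bounded_fps r" "y \<in> bounded_fps r" for x y :: "'k fps"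
  proof -
    obtain C C' where "coeff_bound r C x" "coeff_bound r C' y" using xy by (auto simp: bounded_fps_def)
    then have "coeff_bound r (max C C') (x + y)" using r by (intro coeff_bound_add) (auto intro: coeff_bound_mono)
    then show ?thesis by (rule bounded_fpsI)
  qed
qed (use coeff_bound_0[of 0 r] in \<open>auto simp: bounded_fps_def intro: coeff_bound_const_mult\<close>)

lemma bounded_fps_mono: "0 \<le> r' \<Longrightarrow> r' \<le> r \<Longrightarrow> bounded_fps r \<subseteq> bounded_fps r'"
  by (auto simp: bounded_fps_def intro: coeff_bound_mono_radius)

lemma bounded_fps_mult: "f \<in> bounded_fps r \<Longrightarrow> g \<in> bounded_fps r \<Longrightarrow> 0 < r \<Longrightarrow> f * g \<in> bounded_fps r"
  by (auto simp: bounded_fps_def intro: coeff_bound_mult)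

lemma bounded_fps_deriv:
  assumes "f \<in> bounded_fps r" "0 < r"
  shows "fps_deriv f \<in> bounded_fps r"
proof -
  obtain C where "coeff_bound r C f" using assms by (auto simp: bounded_fps_def)
  then have "coeff_bound r (C / r ^ 1) (fps_deriv f)"
    by (rule coeff_bound_hasse_deriv[where c = "\<lambda>n. n + 1"]) (use assms in auto)
  then show ?thesis by (rule bounded_fpsI)
qed

lemma bounded_fps_finite:
  assumes "\<And>n. n \<ge> N \<Longrightarrow> fps_nth f n = 0" "0 \<le> r"
  shows "f \<in> bounded_fps r"
proof (rule bounded_fpsI, rule coeff_boundI)
  fix n
  show "absv (fps_nth f n) * r ^ n \<le> (\<Sum>k<N. absv (fps_nth f k) * r ^ k)"
  proof (cases "n < N")
    case True
    then show ?thesis using assms(2) by (intro member_le_sum) auto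
  qed (use assms in \<open>auto intro: sum_nonneg\<close>)
qed

lemma bounded_fps_of_poly: "0 \<le> r \<Longrightarrow> fps_of_poly p \<in> bounded_fps r"
  by (rule bounded_fps_finite[of "Suc (degree p)"]) (auto simp: coeff_eq_0)

text \<open>Multiplication by \<open>c T^M\<close> scales the Gauss norm exactly by
  \<open>absv c * r ^ M\<close>, so \<open>near\<close> says that the relative error is at most
  \<open>\<theta> < 1\<close>.\<close>

locale monomial_perturbation =
  fixes E :: "'k::ultrametric_field fps \<Rightarrow> 'k fps" and r \<theta> :: real and c :: 'k and M :: nat
  assumes r: "0 < r" and c: "c \<noteq> 0" and \<theta>: "0 \<le> \<theta>" "\<theta> < 1"
    and diff: "\<And>f g. E (f - g) = E f - E g"
    and near: "\<And>C f. coeff_bound r C f \<Longrightarrow>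
      coeff_bound r (\<theta> * (absv c * r ^ M) * C) (E f - fps_const c * (fps_X ^ M * f))"
begin

lemma monom_nth: "fps_nth (fps_const c * (fps_X ^ M * f)) (n + M) = c * fps_nth f n"
  by (simp add: fps_X_power_mult_nth)

text \<open>In degrees at least \<open>M\<close>, \<open>E f = 0\<close> and \<open>near\<close>
  bound \<open>c T^M f\<close>, hence all of \<open>f\<close>: its norm shrinks by
  \<open>\<theta>\<close> again and again. This yields both injectivity of \<open>E\<close> and
  independence of \<open>1, ..., T^(M-1)\<close> modulo its image.\<close>

lemma contraction_zero:
  assumes "coeff_bound r C f" and "\<And>n. n \<ge> M \<Longrightarrow> fps_nth (E f) n = 0"
  shows "f = 0"
proof -
  have step: "coeff_bound r (\<theta> * C) f" if "coeff_bound r C f" for C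
  proof (rule coeff_boundI)
    fix n
    have "absv (fps_nth (E f - fps_const c * (fps_X ^ M * f)) (n + M)) * r ^ (n + M) \<le> \<theta> * (absv c * r ^ M) * C"
      by (rule coeff_boundD[OF near[OF that]])
    then have "absv (c * fps_nth f n) * r ^ (n + M) \<le> \<theta> * (absv c * r ^ M) * C"
      using assms(2)[of "n + M"] by (simp only: fps_sub_nth monom_nth) simp
    then have "(absv c * r ^ M) * (absv (fps_nth f n) * r ^ n) \<le> (absv c * r ^ M) * (\<theta> * C)"
      by (simp add: absv_mult power_add mult_ac)
    then show "absv (fps_nth f n) * r ^ n \<le> \<theta> * C"
      using absv_pos[OF c] r by (simp add: mult_le_cancel_left)
  qed
  have pow: "coeff_bound r (\<theta> ^ k * C) f" for k
  proof (induction k)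
    case (Suc k)
    from step[OF Suc] show ?case by (simp add: mult.assoc)
  qed (use assms in simp)
  have "fps_nth f n = 0" for n
  proof -
    have "absv (fps_nth f n) * r ^ n \<le> \<theta> ^ k * C" for k by (rule coeff_boundD[OF pow])
    moreover have "(\<lambda>k. \<theta> ^ k * C) \<longlonglongrightarrow> 0"
      using \<theta> by (intro tendsto_mult_left_zero LIMSEQ_realpow_zero)
    ultimately have "absv (fps_nth f n) * r ^ n \<le> 0"
      by (meson LIMSEQ_le_const)
    then have "absv (fps_nth f n) \<le> 0" using r mult_le_cancel_right_pos[of "r ^ n" _ 0] by simp
    then show ?thesis by (metis absv_eq_0 absv_nonneg antisym)
  qed
  then show ?thesis by (simp add: fps_eq_iff)
qed

text \<open>A Neumann series: approximate preimages are obtained by dividing by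
  \<open>c T^M\<close>, and each remainder is smaller than the previous one by the factor
  \<open>\<theta>\<close>.\<close>

lemma ex_preimage_upto_poly:
  assumes g: "g \<in> bounded_fps r"
  shows "\<exists>f\<in>bounded_fps r. \<forall>n\<ge>M. fps_nth (g - E f) n = 0"
proof -
  define a where "a = absv c * r ^ M"
  have a: "0 < a" using absv_pos[OF c] r by (simp add: a_def)
  \<comment> \<open>Division by \<open>c T^M\<close>, with the coefficients of degree below
    \<open>M\<close> thrown away; these form the polynomial part left out in the conclusion.\<close>
  define S where "S h = fps_const (1 / c) * fps_shift M h" for h
  define U where "U h = fps_const c * (fps_X ^ M * S h) - E (S h)" for h
  obtain C where C: "coeff_bound r C g" using g by (auto simp: bounded_fps_def)
  have S: "coeff_bound r (D / a) (S h)" if "coeff_bound r D h" for D h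
  proof (rule coeff_boundI)
    fix n
    have "absv (fps_nth h (n + M)) * r ^ (n + M) / a \<le> D / a"
      using a by (intro divide_right_mono coeff_boundD[OF that]) auto
    then show "absv (fps_nth (S h) n) * r ^ n \<le> D / a"
      using r c by (simp add: S_def a_def absv_mult absv_divide power_add)
  qed
  have U: "coeff_bound r (\<theta> * D) (U h)" if "coeff_bound r D h" for D h
    using coeff_bound_uminus[OF near[OF S[OF that]]] a by (simp add: U_def flip: a_def)
  have Unth: "fps_nth (h - E (S h)) n = fps_nth (U h) n" if "n \<ge> M" for h n
    using that c by (simp add: U_def S_def fps_X_power_mult_nth)
  define gs where "gs k = (U ^^ k) g" for k
  have gs: "coeff_bound r (C * \<theta> ^ k) (gs k)" for k
  proof (induction k)
    case (Suc k)
    from U[OF Suc] show ?case by (simp add: gs_def mult_ac)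
  qed (use C in \<open>simp add: gs_def\<close>)
  define F where "F k = (\<Sum>j<k. S (gs j))" for k
  have E0: "E 0 = 0" using diff[of 0 0] by simp
  have add: "E (f + h) = E f + E h" for f h
    using diff[of "f + h" h] by simp
  have rem: "fps_nth (g - E (F k)) n = fps_nth (gs k) n" if "n \<ge> M" for k n
  proof (induction k)
    case (Suc k)
    have "fps_nth (g - E (F (Suc k))) n = fps_nth (g - E (F k)) n - fps_nth (E (S (gs k))) n"
      by (simp add: F_def add)
    also have "\<dots> = fps_nth (gs k - E (S (gs k))) n" unfolding Suc by simp
    also have "\<dots> = fps_nth (gs (Suc k)) n" unfolding Unth[OF that] by (simp add: gs_def)
    finally show ?case .
  qed (simp add: F_def gs_def E0)
  have "\<exists>y. \<forall>k. absv (y - fps_nth (F k) n) \<le> C / a / r ^ n * \<theta> ^ k" for n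
  proof (rule ultrametric_geometric_limit[OF _ \<theta>])
    fix k
    have "absv (fps_nth (S (gs k)) n) * r ^ n \<le> C * \<theta> ^ k / a" by (rule coeff_boundD[OF S[OF gs]])
    then show "absv (fps_nth (F (Suc k)) n - fps_nth (F k) n) \<le> C / a / r ^ n * \<theta> ^ k"
      using r a by (simp add: F_def field_simps)
  qed
  then obtain y where y: "\<And>n k. absv (y n - fps_nth (F k) n) \<le> C / a / r ^ n * \<theta> ^ k" by metis
  define f where "f = Abs_fps y"
  have f: "coeff_bound r (C / a * \<theta> ^ k) (f - F k)" for k
  proof (rule coeff_boundI)
    fix n show "absv (fps_nth (f - F k) n) * r ^ n \<le> C / a * \<theta> ^ k"
      using mult_right_mono[OF y[of n k], of "r ^ n"] r by (simp add: f_def mult_ac)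
  qed
  have "fps_nth (g - E f) n = 0" if n: "n \<ge> M" for n
  proof -
    \<comment> \<open>In degrees at least \<open>M\<close>, \<open>g - E f\<close> equals
      \<open>gs k - E (f - F k)\<close> for every \<open>k\<close>, and both parts tend to 0. The
      bound on \<open>E (f - F k)\<close> comes from \<open>near\<close>, which thus supplies the
      continuity of \<open>E\<close>.\<close>
    have *: "absv (fps_nth (g - E f) n) * r ^ n \<le> C * \<theta> ^ k" for k
    proof -
      have nn: "0 \<le> C * \<theta> ^ k" using coeff_bound_nonneg[OF gs] .
      have b1: "coeff_bound r (C * \<theta> ^ k) (E (f - F k) - fps_const c * (fps_X ^ M * (f - F k)))"
        using near[OF f[of k]]
      proof (rule coeff_bound_mono)
        have "\<theta> * (C * \<theta> ^ k) \<le> 1 * (C * \<theta> ^ k)" using \<theta> nn by (intro mult_right_mono) auto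
        then show "\<theta> * (absv c * r ^ M) * (C / a * \<theta> ^ k) \<le> C * \<theta> ^ k" using a by (simp add: mult_ac flip: a_def)
      qed
      have "coeff_bound r (r ^ M) (fps_X ^ M :: 'k fps)" using r by (intro coeff_boundI) auto
      from coeff_bound_const_mult[OF coeff_bound_mult[OF this f[of k] r], of c]
      have b2: "coeff_bound r (C * \<theta> ^ k) (fps_const c * (fps_X ^ M * (f - F k)))"
        using c r by (simp add: mult_ac a_def)
      have "coeff_bound r (C * \<theta> ^ k) (E (f - F k))"
        using coeff_bound_add[OF b1 b2] r by simp
      then have "coeff_bound r (C * \<theta> ^ k) (gs k - E (f - F k))"
        using gs r by (intro coeff_bound_diff) auto
      from coeff_boundD[OF this, of n]
      have "absv (fps_nth (g - E (F k)) n - fps_nth (E (f - F k)) n) * r ^ n \<le> C * \<theta> ^ k"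
        by (simp add: rem[OF n, symmetric])
      then show ?thesis by (simp add: diff)
    qed
    have "(\<lambda>k. C * \<theta> ^ k) \<longlonglongrightarrow> 0"
      using \<theta> by (intro tendsto_mult_right_zero LIMSEQ_realpow_zero)
    then have "absv (fps_nth (g - E f) n) * r ^ n \<le> 0"
      using * by (meson LIMSEQ_le_const)
    then have "absv (fps_nth (g - E f) n) \<le> 0" using r mult_le_cancel_right_pos[of "r ^ n" _ 0] by simp
    then show ?thesis by (metis absv_eq_0 absv_nonneg antisym)
  qed
  moreover have "f \<in> bounded_fps r"
    using f[of 0] by (auto intro: bounded_fpsI simp: F_def)
  ultimately show ?thesis by blast
qed

end

text \<open>If a divided power \<open>A\<^sup>q / u\<close> is close to multiplication by \<open>c T\<^sup>M\<close>, the polynomials of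
  degree less than \<open>M\<close> are a complement of \<open>A\<^sup>q V\<close>, whence \<open>dim V / A V = M / q\<close>.\<close>

lemma monomial_perturbation_index:
  fixes A E :: "'k::ultrametric_field fps \<Rightarrow> 'k fps"
  assumes pert: "monomial_perturbation E r \<theta> c M"
    and add: "\<And>f g. A (f + g) = A f + A g" and scale: "\<And>c f. A (fps_const c * f) = fps_const c * A f"
    and maps: "\<And>f. f \<in> bounded_fps r \<Longrightarrow> A f \<in> bounded_fps r"
    and pow: "\<And>f. (A ^^ q) f = fps_const u * E f" and u: "u \<noteq> 0" and q: "0 < q"
  shows "(\<forall>f\<in>bounded_fps r. A f = 0 \<longrightarrow> f = 0) \<and>
    (\<exists>n b. n * q = M \<and> (\<forall>i<n. \<exists>N. \<forall>k\<ge>N. fps_nth (b i) k = 0) \<and>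
       spans_mod n b (bounded_fps r) (A ` bounded_fps r) \<and> indep_mod n b (A ` bounded_fps r))"
proof -
  interpret monomial_perturbation E r \<theta> c M by (rule pert)
  let ?V = "bounded_fps r :: 'k fps set"
  have A0: "A 0 = 0" using scale[of 0 0] by simp
  have E: "E f = fps_const (1 / u) * (A ^^ q) f" for f
    using u by (simp add: pow flip: mult.assoc)
  have inj: "f = 0" if f: "f \<in> ?V" "A f = 0" for f
  proof -
    obtain C where C: "coeff_bound r C f" using f by (auto simp: bounded_fps_def)
    have "(A ^^ k) f = 0" if "0 < k" for k
      using that
    proof (induction k)
      case (Suc k)
      then show ?case using f A0 by (cases k) auto
    qed simp
    then have "E f = 0" using E q by simp
    then show ?thesis using contraction_zero[OF C] by simp
  qed
  interpret injective_endomorphism ?V A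
    by unfold_locales (use r add scale maps inj subspace_bounded_fps[of r] in auto)
  let ?X = "{f :: 'k fps. \<exists>N. \<forall>k\<ge>N. fps_nth f k = 0}"
  have lin: "fps_nth (fps_lincomb M d (\<lambda>i. fps_X ^ i)) n = (if n < M then d n else 0)" for d n
  proof -
    have "fps_nth (fps_lincomb M d (\<lambda>i. fps_X ^ i)) n = (\<Sum>i<M. if i = n then d i else 0)"
      unfolding fps_lincomb_def fps_sum_nth by (rule sum.cong) auto
    then show ?thesis by simp
  qed
  have sp: "spans_mod M (\<lambda>i. fps_X ^ i) ?V ((A ^^ q) ` ?V)" unfolding spans_mod_def
  proof
    fix g assume "g \<in> ?V"
    then obtain f where f: "f \<in> ?V" "\<forall>n\<ge>M. fps_nth (g - E f) n = 0"
      using ex_preimage_upto_poly by blast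
    have "g - fps_lincomb M (\<lambda>n. fps_nth (g - E f) n) (\<lambda>i. fps_X ^ i) = E f"
      using f(2) by (auto simp: fps_eq_iff lin)
    moreover have "E f = (A ^^ q) (fps_const (1 / u) * f)" by (simp add: E pow_scale)
    moreover have "fps_const (1 / u) * f \<in> ?V" by (rule fps_vs.subspace_scale[OF V f(1)])
    ultimately show "\<exists>d. g - fps_lincomb M d (\<lambda>i. fps_X ^ i) \<in> (A ^^ q) ` ?V" by (metis imageI)
  qed
  have ind: "indep_mod M (\<lambda>i. fps_X ^ i) ((A ^^ q) ` ?V)" unfolding indep_mod_def
  proof (intro allI impI)
    fix d i assume "fps_lincomb M d (\<lambda>i. fps_X ^ i) \<in> (A ^^ q) ` ?V" and i: "i < M"
    then obtain f where f: "f \<in> ?V" "fps_lincomb M d (\<lambda>i. fps_X ^ i) = fps_const u * E f"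
      using pow by auto
    then obtain C where C: "coeff_bound r C f" by (auto simp: bounded_fps_def)
    have "fps_nth (E f) n = 0" if "n \<ge> M" for n
      using arg_cong[OF f(2), of "\<lambda>h. fps_nth h n"] lin[of d n] that u by simp
    then have "f = 0" using contraction_zero[OF C] by blast
    moreover have "E 0 = 0" using monomial_perturbation.diff[OF pert, of 0 0] by simp
    ultimately have "fps_lincomb M d (\<lambda>i. fps_X ^ i) = 0" using f by simp
    then show "d i = 0" using lin[of d i] i by simp
  qed
  have e: "fps_X ^ i \<in> ?V \<inter> ?X" for i
    using r bounded_fps_finite[of "Suc i" "fps_X ^ i" r] by (auto intro!: exI[of _ "Suc i"])
  obtain n b where "n * q = M" "\<forall>i<n. b i \<in> ?V \<inter> ?X" "spans_mod n b ?V (A ` ?V)" "indep_mod n b (A ` ?V)"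
    using basis_mod_of_pow_basis[OF sp ind e q] by blast
  then show ?thesis using inj by blast
qed


section \<open>The index on overconvergent series\<close>

lemma bounded_of_conv_radius:
  fixes g :: "nat \<Rightarrow> real"
  assumes "ereal r < conv_radius g" "0 \<le> r"
  shows "\<exists>C. \<forall>n. g n * r ^ n \<le> C"
proof -
  have "summable (\<lambda>n. g n * r ^ n)" using assms by (intro summable_in_conv_radius) auto
  then have "(\<lambda>n. g n * r ^ n) \<longlonglongrightarrow> 0" by (rule summable_LIMSEQ_zero)
  then have "Bseq (\<lambda>n. g n * r ^ n)" by (intro convergent_imp_Bseq convergentI)
  then obtain K where "\<And>n. norm (g n * r ^ n) \<le> K" by (meson BseqE)
  then show ?thesis by (metis abs_le_D1 real_norm_def)
qed

lemma bounded_fps_of_ultra_radius: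
  assumes "ereal r < ultra_radius f" "0 \<le> r"
  shows "f \<in> bounded_fps r"
  using bounded_of_conv_radius[of r "\<lambda>n. absv (fps_nth f n)"] assms
  by (auto simp: ultra_radius_def bounded_fps_def coeff_bound_def)

lemma overconvergent_iff: "f \<in> overconvergent \<longleftrightarrow> (\<exists>r>1. f \<in> bounded_fps r)"
proof
  assume "f \<in> overconvergent"
  then have "1 < ultra_radius f" by (simp add: overconvergent_def)
  then obtain r where "1 < ereal r" "ereal r < ultra_radius f" by (meson ereal_dense3 less_trans ereal_dense2)
  then show "\<exists>r>1. f \<in> bounded_fps r" by (intro exI[of _ r]) (auto intro: bounded_fps_of_ultra_radius)
next
  assume "\<exists>r>1. f \<in> bounded_fps r"
  then obtain r C where r: "1 < r" and C: "coeff_bound r C f" by (auto simp: bounded_fps_def)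
  \<comment> \<open>Boundedness at \<open>r\<close> gives summability only strictly inside, hence
    the intermediate radius.\<close>
  define s where "s = (1 + r) / 2"
  have s: "1 < s" "s < r" using r by (auto simp: s_def)
  have "summable (\<lambda>n. absv (fps_nth f n) * s ^ n)"
  proof (rule summable_comparison_test')
    show "summable (\<lambda>n. C * (s / r) ^ n)" using s by (intro summable_mult summable_geometric) auto
    fix n
    have "absv (fps_nth f n) * s ^ n = absv (fps_nth f n) * r ^ n * (s / r) ^ n"
      using r by (simp add: power_divide)
    also have "\<dots> \<le> C * (s / r) ^ n"
      using s by (intro mult_right_mono coeff_boundD[OF C]) auto
    finally show "norm (absv (fps_nth f n) * s ^ n) \<le> C * (s / r) ^ n" using s by simp
  qed
  then have "ereal (norm s) \<le> conv_radius (\<lambda>n. absv (fps_nth f n))" by (rule conv_radius_geI)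
  then have "ereal s \<le> ultra_radius f" using s by (simp add: ultra_radius_def)
  moreover have "1 < ereal s" using s by simp
  ultimately have "1 < ultra_radius f" by (rule less_le_trans[rotated])
  then show "f \<in> overconvergent" by (simp add: overconvergent_def)
qed

lemma overconvergent_mult:
  assumes "f \<in> overconvergent" "g \<in> overconvergent"
  shows "f * g \<in> overconvergent"
proof -
  obtain r s where "1 < r" "1 < s" "f \<in> bounded_fps r" "g \<in> bounded_fps s"
    using assms by (auto simp: overconvergent_iff)
  then have "f * g \<in> bounded_fps (min r s)"
    using bounded_fps_mono[of "min r s" r] bounded_fps_mono[of "min r s" s]
    by (intro bounded_fps_mult) auto
  then show ?thesis unfolding overconvergent_iff using \<open>1 < r\<close> \<open>1 < s\<close> by (intro exI[of _ "min r s"]) auto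
qed

lemma subspace_overconvergent: "fps_vs.subspace (overconvergent :: 'k::ultrametric_field fps set)"
proof (rule fps_vs.subspaceI)
  show "0 \<in> (overconvergent :: 'k fps set)"
    unfolding overconvergent_iff by (intro exI[of _ 2]) (auto intro: bounded_fps_finite)
  show "x + y \<in> overconvergent" if xy: "x \<in> overconvergent" "y \<in> overconvergent" for x y :: "'k fps"
  proof -
    obtain r s where rs: "1 < r" "1 < s" "x \<in> bounded_fps r" "y \<in> bounded_fps s"
      using xy by (auto simp: overconvergent_iff)
    then have "x + y \<in> bounded_fps (min r s)"
      using bounded_fps_mono[of "min r s" r] bounded_fps_mono[of "min r s" s]
      by (intro fps_vs.subspace_add[OF subspace_bounded_fps]) auto
    then show ?thesis unfolding overconvergent_iff using rs by (intro exI[of _ "min r s"]) auto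
  qed
  show "fps_const c * x \<in> overconvergent" if x: "x \<in> overconvergent" for c and x :: "'k fps"
  proof -
    obtain r where r: "1 < r" "x \<in> bounded_fps r" using x by (auto simp: overconvergent_iff)
    then have "fps_const c * x \<in> bounded_fps r"
      by (intro fps_vs.subspace_scale[OF subspace_bounded_fps]) auto
    then show ?thesis unfolding overconvergent_iff using r(1) by blast
  qed
qed

lemma diff_op_add: "diff_op L (f + g) = diff_op L f + diff_op L g"
  by (simp add: diff_op_def algebra_simps)

lemma diff_op_scale: "diff_op L (fps_const c * f) = fps_const c * diff_op L f"
  by (simp add: diff_op_def right_diff_distrib mult.left_commute)

lemma diff_op_bounded: "f \<in> bounded_fps r \<Longrightarrow> 0 < r \<Longrightarrow> diff_op L f \<in> bounded_fps r"
  unfolding diff_op_def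
  by (intro fps_vs.subspace_diff[OF subspace_bounded_fps] bounded_fps_deriv bounded_fps_mult bounded_fps_of_poly) auto

lemma subspace_image_diff_op:
  assumes "fps_vs.subspace V"
  shows "fps_vs.subspace (diff_op L ` V)"
proof (rule fps_vs.subspaceI)
  have "diff_op L 0 = 0" using diff_op_scale[of L 0 0] by simp
  then show "0 \<in> diff_op L ` V" using fps_vs.subspace_0[OF assms] by force
qed (use assms in \<open>auto simp: fps_vs.subspace_add fps_vs.subspace_scale simp flip: diff_op_add diff_op_scale\<close>)

lemma spans_mod_trans:
  assumes W: "fps_vs.subspace W" and sp: "spans_mod n b' V W"
    and b: "\<And>i. i < n \<Longrightarrow> \<exists>c. b' i - fps_lincomb m c b \<in> W"
  shows "spans_mod m b V W"
  unfolding spans_mod_def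
proof
  fix f assume "f \<in> V"
  then obtain c where c: "f - fps_lincomb n c b' \<in> W" using sp by (auto simp: spans_mod_def)
  have "\<forall>i. \<exists>c. i < n \<longrightarrow> b' i - fps_lincomb m c b \<in> W" using b by blast
  then obtain e where e: "\<And>i. i < n \<Longrightarrow> b' i - fps_lincomb m (e i) b \<in> W" by metis
  have "(\<Sum>i<n. fps_const (c i) * (b' i - fps_lincomb m (e i) b)) \<in> W"
    using e by (intro fps_vs.subspace_sum[OF W] fps_vs.subspace_scale[OF W]) auto
  with c have "(f - fps_lincomb n c b') + (\<Sum>i<n. fps_const (c i) * (b' i - fps_lincomb m (e i) b)) \<in> W"
    by (rule fps_vs.subspace_add[OF W])
  moreover have "(\<Sum>i<n. fps_const (c i) * fps_lincomb m (e i) b) = fps_lincomb m (\<lambda>j. \<Sum>i<n. c i * e i j) b"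
  proof -
    have "fps_const (\<Sum>i<n. c i * e i j) = (\<Sum>i<n. fps_const (c i) * fps_const (e i j))" for j
      by (simp add: fps_eq_iff fps_sum_nth sum.delta)
    then have "fps_lincomb m (\<lambda>j. \<Sum>i<n. c i * e i j) b = (\<Sum>j<m. \<Sum>i<n. fps_const (c i) * (fps_const (e i j) * b j))"
      unfolding fps_lincomb_def by (simp only: sum_distrib_right mult.assoc)
    also have "\<dots> = (\<Sum>i<n. fps_const (c i) * fps_lincomb m (e i) b)"
      unfolding fps_lincomb_def by (subst sum.swap) (simp only: sum_distrib_left)
    finally show ?thesis by simp
  qed
  ultimately have "f - fps_lincomb m (\<lambda>j. \<Sum>i<n. c i * e i j) b \<in> W"
    by (simp add: right_diff_distrib sum_subtractf fps_lincomb_def)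
  then show "\<exists>c. f - fps_lincomb m c b \<in> W" by blast
qed

text \<open>The transition maps between the spaces \<open>B\<^sub>r / D B\<^sub>r\<close> are onto, because polynomials represent
  all classes; so they are isomorphisms as soon as the dimension does not depend on \<open>r\<close>.\<close>

lemma has_index_of_constant_dimension:
  fixes L :: "'k::ultrametric_field poly"
  assumes R: "1 < R"
    and inj: "\<And>r f. 1 < r \<Longrightarrow> r \<le> R \<Longrightarrow> f \<in> bounded_fps r \<Longrightarrow> diff_op L f = 0 \<Longrightarrow> f = 0"
    and basis: "\<And>r. 1 < r \<Longrightarrow> r \<le> R \<Longrightarrow> \<exists>b. (\<forall>i<n. \<exists>N. \<forall>k\<ge>N. fps_nth (b i) k = 0) \<and>
       spans_mod n b (bounded_fps r) (diff_op L ` bounded_fps r) \<and> indep_mod n b (diff_op L ` bounded_fps r)"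
  shows "has_index L (- real n)"
proof -
  let ?B = "\<lambda>r. bounded_fps r :: 'k fps set"
  have H0: "{f \<in> overconvergent. diff_op L f = 0} = {0}"
  proof -
    have "f = 0" if f: "f \<in> overconvergent" "diff_op L f = 0" for f
    proof -
      obtain r where r: "1 < r" "f \<in> ?B r" using f by (auto simp: overconvergent_iff)
      then have "f \<in> ?B (min r R)" using bounded_fps_mono[of "min r R" r] R by auto
      then show ?thesis using inj[of "min r R" f] f R r by simp
    qed
    moreover have "diff_op L 0 = 0" using diff_op_scale[of L 0 0] by simp
    ultimately show ?thesis using fps_vs.subspace_0[OF subspace_overconvergent] by auto
  qed
  have "has_quotient_dim {0} {0 :: 'k fps} 0"
    by (rule has_quotient_dimI[where b = "\<lambda>_. 0"])
      (auto simp: spans_mod_def indep_mod_def fps_lincomb_def fps_vs.subspace_def)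
  moreover obtain b where b: "\<forall>i<n. \<exists>N. \<forall>k\<ge>N. fps_nth (b i) k = 0"
    "spans_mod n b (?B R) (diff_op L ` ?B R)" using basis[of R] R by blast
  have poly_bounded: "g \<in> ?B r" if g: "\<exists>N. \<forall>k\<ge>N. fps_nth g k = 0" and r: "1 < r" for g r
  proof -
    obtain N where "\<And>k. k \<ge> N \<Longrightarrow> fps_nth g k = 0" using g by blast
    then show ?thesis using r by (intro bounded_fps_finite) auto
  qed
  \<comment> \<open>The family \<open>b\<close> chosen at \<open>R\<close> serves all smaller radii:
    the polynomials \<open>b' i\<close> lie in the space at \<open>R\<close>, so \<open>b\<close>
    spans there as well, and having the right cardinality it is independent.\<close>
  have b_r: "spans_mod n b (?B r) (diff_op L ` ?B r) \<and> indep_mod n b (diff_op L ` ?B r)"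
    if r: "1 < r" "r \<le> R" for r
  proof
    obtain b' where b': "\<forall>i<n. \<exists>N. \<forall>k\<ge>N. fps_nth (b' i) k = 0"
       "spans_mod n b' (?B r) (diff_op L ` ?B r)" "indep_mod n b' (diff_op L ` ?B r)"
      using basis[OF r] by blast
    have W: "fps_vs.subspace (diff_op L ` ?B r)"
      using r by (intro subspace_image_diff_op subspace_bounded_fps) auto
    have sub: "diff_op L ` ?B R \<subseteq> diff_op L ` ?B r" using bounded_fps_mono[of r R] r by auto
    show sp: "spans_mod n b (?B r) (diff_op L ` ?B r)"
    proof (rule spans_mod_trans[OF W b'(2)])
      fix i assume "i < n"
      then have "b' i \<in> ?B R" using b'(1) poly_bounded R by blast
      then show "\<exists>c. b' i - fps_lincomb n c b \<in> diff_op L ` ?B r"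
        using b(2) sub unfolding spans_mod_def by blast
    qed
    show "indep_mod n b (diff_op L ` ?B r)"
      by (rule spans_mod_card_imp_indep_mod[OF W sp b'(3)]) (use b'(1) poly_bounded r in blast)
  qed
  have "has_quotient_dim overconvergent (diff_op L ` overconvergent) n"
  proof (rule has_quotient_dimI)
    show "b i \<in> overconvergent" if "i < n" for i
      unfolding overconvergent_iff using b(1) poly_bounded R that by blast
    show "fps_vs.subspace (diff_op L ` overconvergent)"
      by (intro subspace_image_diff_op subspace_overconvergent)
    show "spans_mod n b overconvergent (diff_op L ` overconvergent)" unfolding spans_mod_def
    proof
      fix f :: "'k fps" assume "f \<in> overconvergent"
      then obtain r where r: "1 < r" "f \<in> ?B r" by (auto simp: overconvergent_iff)
      have m: "1 < min r R" "min r R \<le> R" using r R by auto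
      have "f \<in> ?B (min r R)" using bounded_fps_mono[of "min r R" r] R r by auto
      then obtain c where "f - fps_lincomb n c b \<in> diff_op L ` ?B (min r R)"
        using b_r[OF m] unfolding spans_mod_def by blast
      moreover have "?B (min r R) \<subseteq> overconvergent" using m(1) by (metis overconvergent_iff subsetI)
      ultimately show "\<exists>c. f - fps_lincomb n c b \<in> diff_op L ` overconvergent" by blast
    qed
    show "indep_mod n b (diff_op L ` overconvergent)" unfolding indep_mod_def
    proof (rule allI, rule impI)
      fix c assume "fps_lincomb n c b \<in> diff_op L ` overconvergent"
      then obtain g where g: "g \<in> overconvergent" "fps_lincomb n c b = diff_op L g" by blast
      then obtain r where r: "1 < r" "g \<in> ?B r" by (auto simp: overconvergent_iff)
      have m: "1 < min r R" "min r R \<le> R" using r R by auto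
      have "g \<in> ?B (min r R)" using bounded_fps_mono[of "min r R" r] R r by auto
      then have "fps_lincomb n c b \<in> diff_op L ` ?B (min r R)" using g(2) by blast
      then show "\<forall>i<n. c i = 0" using b_r[OF m] unfolding indep_mod_def by blast
    qed
  qed
  ultimately show ?thesis unfolding has_index_def H0 by (intro exI[of _ 0] exI[of _ n]) auto
qed

lemma diff_op_conjugate:
  fixes e :: "'k::field fps"
  assumes "log_deriv_ode (fps_of_poly L) e"
  shows "diff_op L f = e * fps_deriv (f * inverse e)"
proof -
  have e: "fps_nth e 0 = 1" "e * inverse e = 1"
    using assms by (auto simp: log_deriv_ode_def inverse_mult_eq_1')
  have "fps_deriv (inverse e) = - fps_of_poly L * inverse e"
    using log_deriv_ode_inverse[OF assms] by (simp add: log_deriv_ode_def)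
  then have "e * fps_deriv (f * inverse e) = (e * inverse e) * (fps_deriv f - fps_of_poly L * f)"
    by (simp add: algebra_simps)
  then show ?thesis by (simp add: e diff_op_def)
qed

text \<open>Integration divides by \<open>n\<close>, and \<open>1 / |n|\<close> is a power of
  \<open>p\<close> dividing \<open>n\<close>, hence at most \<open>n\<close>. The linear loss is
  absorbed by passing from \<open>r\<close> to a smaller radius that is still above 1.\<close>

lemma fps_integral_overconvergent:
  fixes f :: "'k::ultrametric_field fps"
  assumes Q: "extends_Qp p TYPE('k)" "prime p" and f: "f \<in> overconvergent"
  shows "fps_integral0 f \<in> overconvergent"
proof -
  obtain r C where r: "1 < r" and C: "coeff_bound r C f"
    using f by (auto simp: overconvergent_iff bounded_fps_def)
  define s where "s = (1 + r) / 2"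
  have s: "1 < s" "s < r" using r by (auto simp: s_def)
  have C0: "0 \<le> C" using C by (rule coeff_bound_nonneg)
  have "norm (s / r) < 1" using s by simp
  then have "Bseq (\<lambda>n. of_nat n * (s / r) ^ n)"
    by (intro convergent_imp_Bseq convergentI[OF powser_times_n_limit_0])
  then obtain K where K: "\<And>n. norm (of_nat n * (s / r) ^ n) \<le> K" by (meson BseqE)
  have inv: "absv (inverse (of_nat n :: 'k)) \<le> real n" if n: "0 < n" for n
  proof -
    have "absv (of_int (int n) :: 'k) = 1 / real p ^ multiplicity (int p) (int n)"
      using Q(1) n unfolding extends_Qp_def by (metis of_nat_0_eq_iff less_irrefl)
    then have "absv (inverse (of_nat n :: 'k)) = real (p ^ multiplicity (int p) (int n))"
      by (simp add: absv_inverse)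
    also have "int p ^ multiplicity (int p) (int n) dvd int n" by (rule multiplicity_dvd)
    then have "p ^ multiplicity (int p) (int n) dvd n" by (metis of_nat_power of_nat_dvd_iff)
    then have "p ^ multiplicity (int p) (int n) \<le> n" using n by (rule dvd_imp_le)
    then have "real (p ^ multiplicity (int p) (int n)) \<le> real n" by (rule of_nat_mono)
    finally show ?thesis .
  qed
  have "coeff_bound s (K * r * C) (fps_integral0 f)"
  proof (rule coeff_boundI)
    fix n
    show "absv (fps_nth (fps_integral0 f) n) * s ^ n \<le> K * r * C"
    proof (cases n)
      case 0
      have "0 \<le> K" using order_trans[OF norm_ge_zero K] .
      then show ?thesis using 0 C0 r by simp
    next
      case (Suc k)
      have "absv (fps_nth (fps_integral0 f) n) * s ^ n
         = absv (inverse (of_nat n :: 'k)) * (absv (fps_nth f k) * r ^ k) * (r * (s / r) ^ n)"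
        using r Suc by (simp add: absv_mult power_divide del: of_nat_Suc)
      also have "\<dots> \<le> real n * C * (r * (s / r) ^ n)"
        using Suc r s C0 by (intro mult_right_mono mult_mono inv coeff_boundD[OF C]) auto
      also have "\<dots> = (real n * (s / r) ^ n) * (r * C)" by simp
      also have "\<dots> \<le> K * (r * C)"
        using K[of n] r s C0 by (intro mult_right_mono) auto
      finally show ?thesis by (simp add: mult.assoc)
    qed
  qed
  then show ?thesis using s by (auto simp: overconvergent_iff intro: bounded_fpsI)
qed

text \<open>Multiplication by \<open>e\<close> is an automorphism of the overconvergent series that
  carries \<open>d/dT\<close> to \<open>diff_op L\<close>; the kernel of \<open>d/dT\<close> is the
  constants and every overconvergent series has an overconvergent primitive.\<close>

lemma has_index_of_overconvergent_solution:
  fixes L :: "'k::ultrametric_field poly"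
  assumes Q: "extends_Qp p TYPE('k)" "prime p" and ode: "log_deriv_ode (fps_of_poly L) e"
    and e: "e \<in> overconvergent" "inverse e \<in> overconvergent"
  shows "has_index L 1"
proof -
  have e1: "fps_nth e 0 = 1" "inverse e * e = 1" "e * inverse e = 1"
    using ode by (auto simp: log_deriv_ode_def inverse_mult_eq_1 inverse_mult_eq_1')
  note conj = diff_op_conjugate[OF ode]
  have "has_quotient_dim {f \<in> overconvergent. diff_op L f = 0} {0} 1"
  proof (rule has_quotient_dimI[where b = "\<lambda>_. e"])
    have "diff_op L e = e * fps_deriv 1" by (simp only: conj e1(3))
    then show "e \<in> {f \<in> overconvergent. diff_op L f = 0}" using e by simp
    show "spans_mod 1 (\<lambda>_. e) {f \<in> overconvergent. diff_op L f = 0} {0}" unfolding spans_mod_def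
    proof
      fix f assume "f \<in> {f \<in> overconvergent. diff_op L f = 0}"
      then have "e * fps_deriv (f * inverse e) = 0" by (simp add: conj)
      moreover have "e \<noteq> 0" using e1 by auto
      ultimately have "fps_deriv (f * inverse e) = 0" by simp
      then obtain c where c: "f * inverse e = fps_const c" by (simp only: fps_deriv_eq_0_iff)
      have "f = f * inverse e * e" by (simp add: e1 mult.assoc)
      then have "f - fps_lincomb 1 (\<lambda>_. c) (\<lambda>_. e) = 0" unfolding c by (simp add: fps_lincomb_def)
      then show "\<exists>c. f - fps_lincomb 1 c (\<lambda>_. e) \<in> {0}" by blast
    qed
    show "indep_mod 1 (\<lambda>_. e) {0}" unfolding indep_mod_def
    proof (intro allI impI)
      fix c i assume "fps_lincomb 1 c (\<lambda>_. e) \<in> {0}" and i: "i < (1::nat)"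
      then have "fps_const (c 0) * e = 0" by (simp only: fps_lincomb_def) simp
      from arg_cong[OF this, of "\<lambda>h. fps_nth h 0"] show "c i = 0" using e1(1) i by simp
    qed
  qed (auto simp: fps_vs.subspace_def)
  moreover have "has_quotient_dim overconvergent (diff_op L ` overconvergent) 0"
  proof (rule has_quotient_dimI[where b = "\<lambda>_. 0"])
    show "spans_mod 0 (\<lambda>_. 0) overconvergent (diff_op L ` overconvergent)" unfolding spans_mod_def
    proof
      fix f :: "'k fps" assume f: "f \<in> overconvergent"
      define g where "g = e * fps_integral0 (f * inverse e)"
      have "g \<in> overconvergent" unfolding g_def
        using e f by (intro overconvergent_mult fps_integral_overconvergent[OF Q])
      moreover have "diff_op L g = e * fps_deriv ((e * inverse e) * fps_integral0 (f * inverse e))"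
        unfolding conj g_def by (simp only: mult_ac)
      then have "diff_op L g = e * (f * inverse e)"
        unfolding e1 by (simp add: fps_deriv_fps_integral)
      then have "diff_op L g = (e * inverse e) * f" by (simp only: mult_ac)
      then have "f = diff_op L g" unfolding e1 by simp
      ultimately have "f \<in> diff_op L ` overconvergent" by blast
      then show "\<exists>c. f - fps_lincomb 0 c (\<lambda>_. 0) \<in> diff_op L ` overconvergent"
        by (simp add: fps_lincomb_def)
    qed
  qed (auto simp: indep_mod_def intro: subspace_image_diff_op subspace_overconvergent)
  ultimately show ?thesis unfolding has_index_def by force
qed


section \<open>Taylor shifts\<close>

text \<open>This makes the uniqueness of solutions available for series in \<open>X\<close> over the
  series in \<open>T\<close>.\<close>

instance fps :: (ring_char_0) ring_char_0 ..

text \<open>\<open>taylor f\<close> is \<open>f(T + X)\<close> as a series in \<open>X\<close> over the series in \<open>T\<close>; its coefficients are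
  the divided derivatives of \<open>f\<close>.\<close>

definition taylor :: "'a::comm_ring_1 fps \<Rightarrow> 'a fps fps" where
  "taylor f = Abs_fps (\<lambda>n. Abs_fps (\<lambda>a. of_nat ((a + n) choose n) * fps_nth f (a + n)))"

lemma taylor_nth: "fps_nth (fps_nth (taylor f) n) a = of_nat ((a + n) choose n) * fps_nth f (a + n)"
  by (simp add: taylor_def)

lemma taylor_nth_0: "fps_nth (taylor f) 0 = f"
  by (simp add: fps_eq_iff taylor_nth)

lemma taylor_add: "taylor (f + g) = taylor f + taylor g"
  by (simp add: fps_eq_iff taylor_nth distrib_left)

lemma taylor_uminus: "taylor (- f) = - taylor f"
  by (simp add: fps_eq_iff taylor_nth)

lemma taylor_const: "taylor (fps_const c) = fps_const (fps_const c)"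
  by (auto simp: fps_eq_iff taylor_nth)

lemma fps_deriv_taylor: "fps_deriv (taylor f) = taylor (fps_deriv f)"
proof -
  have "fps_nth (fps_nth (fps_deriv (taylor f)) n) a = fps_nth (fps_nth (taylor (fps_deriv f)) n) a" for n a
  proof -
    have "of_nat (Suc n * (Suc (a + n) choose Suc n)) = (of_nat (Suc (a + n) * ((a + n) choose n)) :: 'a)"
      by (simp only: Suc_times_binomial)
    then have "of_nat (Suc n) * (of_nat (Suc (a + n) choose Suc n) * fps_nth f (Suc (a + n)))
       = of_nat ((a + n) choose n) * (of_nat (Suc (a + n)) * fps_nth f (Suc (a + n)))"
      unfolding of_nat_mult by (metis mult.assoc mult.commute)
    moreover have "fps_nth (of_nat (Suc n) * g) a = of_nat (Suc n) * fps_nth g a" for g :: "'a fps"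
      unfolding fps_of_nat[symmetric] by (rule fps_mult_left_const_nth)
    ultimately show ?thesis
      by (simp add: taylor_nth fps_deriv_nth del: of_nat_Suc of_nat_add binomial_Suc_Suc)
  qed
  then show ?thesis by (simp add: fps_eq_iff)
qed

text \<open>Whole families are compared at once, because the derivative of \<open>F x\<close> is
  expressed through \<open>F\<close> at other arguments, such as a derivative of
  \<open>x\<close>.\<close>

lemma fps_eq_of_deriv_step:
  fixes F G :: "'b \<Rightarrow> 'a::{idom,ring_char_0} fps"
  assumes 0: "\<And>x. fps_nth (F x) 0 = fps_nth (G x) 0"
    and step: "\<And>x n. (\<And>y k. k \<le> n \<Longrightarrow> fps_nth (F y) k = fps_nth (G y) k) \<Longrightarrow>
       fps_nth (fps_deriv (F x)) n = fps_nth (fps_deriv (G x)) n"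
  shows "F x = G x"
proof -
  have "fps_nth (F x) n = fps_nth (G x) n" for n
  proof (induction n arbitrary: x rule: less_induct)
    case (less n)
    show ?case
    proof (cases n)
      case (Suc k)
      have "fps_nth (fps_deriv (F x)) k = fps_nth (fps_deriv (G x)) k"
        using less Suc by (intro step) auto
      then show ?thesis using Suc by (simp del: of_nat_Suc)
    qed (simp add: 0)
  qed
  then show ?thesis by (simp add: fps_eq_iff)
qed

lemma taylor_mult:
  fixes f g :: "'k::field_char_0 fps"
  shows "taylor (f * g) = taylor f * taylor g"
proof -
  define F where "F x = taylor (fst x * snd x)" for x :: "'k fps \<times> 'k fps"
  define G where "G x = taylor (fst x) * taylor (snd x)" for x :: "'k fps \<times> 'k fps"
  have "F (f, g) = G (f, g)"
  proof (rule fps_eq_of_deriv_step[of F G])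
    fix x n assume IH: "\<And>y k. k \<le> n \<Longrightarrow> fps_nth (F y) k = fps_nth (G y) k"
    have "fps_deriv (F x) = F (fst x, fps_deriv (snd x)) + F (fps_deriv (fst x), snd x)"
      by (simp add: F_def fps_deriv_taylor taylor_add)
    moreover have "fps_deriv (G x) = G (fst x, fps_deriv (snd x)) + G (fps_deriv (fst x), snd x)"
      by (simp add: G_def fps_deriv_taylor)
    ultimately show "fps_nth (fps_deriv (F x)) n = fps_nth (fps_deriv (G x)) n" using IH by simp
  qed (simp add: F_def G_def taylor_nth_0)
  then show ?thesis by (simp add: F_def G_def)
qed

definition fps_map_compose :: "'k::field_char_0 fps \<Rightarrow> 'k fps fps \<Rightarrow> 'k fps fps" where
  "fps_map_compose m F = Abs_fps (\<lambda>n. fps_nth F n oo m)"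

lemma fps_map_compose_mult:
  "fps_nth m 0 = 0 \<Longrightarrow> fps_map_compose m (F * G) = fps_map_compose m F * fps_map_compose m G"
  by (rule fps_ext) (simp add: fps_map_compose_def fps_mult_nth
      fps_compose_sum_distrib fps_compose_mult_distrib)

lemma fps_deriv_fps_map_compose:
  "fps_nth m 0 = 0 \<Longrightarrow> fps_deriv (fps_map_compose m F) = fps_map_compose m (fps_deriv F)"
proof -
  assume m: "fps_nth m 0 = 0"
  have "of_nat k * (g oo m) = (of_nat k * g) oo m" for k and g :: "'a fps"
    using m fps_compose_mult_distrib[OF m, of "fps_const (of_nat k)" g] by (simp add: fps_of_nat)
  then show ?thesis by (simp add: fps_eq_iff[of "fps_deriv _"] fps_map_compose_def del: of_nat_Suc of_nat_add)
qed

lemma fps_map_compose_const: "fps_map_compose m (fps_const g) = fps_const (g oo m)"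
  by (auto simp: fps_map_compose_def fps_eq_iff[of _ "fps_const _"])

text \<open>The substitution \<open>Y = m(T)\<close>, \<open>Z = m(T + X) - m(T)\<close>.\<close>

definition taylor_subst :: "'k::field_char_0 fps \<Rightarrow> 'k fps fps \<Rightarrow> 'k fps fps" where
  "taylor_subst m F = fps_map_compose m F oo (taylor m - fps_const m)"

lemma taylor_diff_nth_0: "fps_nth (taylor m - fps_const m) 0 = 0"
  by (simp add: taylor_nth_0)

lemma taylor_subst_mult:
  "fps_nth m 0 = 0 \<Longrightarrow> taylor_subst m (F * G) = taylor_subst m F * taylor_subst m G"
  by (simp only: taylor_subst_def fps_map_compose_mult fps_compose_mult_distrib taylor_diff_nth_0)

lemma taylor_subst_const: "taylor_subst m (fps_const g) = fps_const (g oo m)"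
  by (simp add: taylor_subst_def fps_map_compose_const)

text \<open>By the chain rule the \<open>X\<close>-derivative of either side is the same expression
  for \<open>f'\<close>, times \<open>m'(T + X)\<close>.\<close>

lemma taylor_compose:
  fixes f :: "'k::field_char_0 fps"
  assumes m: "fps_nth m 0 = 0"
  shows "taylor (f oo m) = taylor_subst m (taylor f)"
proof (rule fps_eq_of_deriv_step[of "\<lambda>f. taylor (f oo m)" "\<lambda>f. taylor_subst m (taylor f)"])
  fix g show "fps_nth (taylor (g oo m)) 0 = fps_nth (taylor_subst m (taylor g)) 0"
    by (simp add: taylor_subst_def fps_map_compose_def taylor_nth_0)
next
  fix g n assume IH: "\<And>y k. k \<le> n \<Longrightarrow> fps_nth (taylor (y oo m)) k = fps_nth (taylor_subst m (taylor y)) k"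
  have "fps_deriv (taylor (g oo m)) = taylor (fps_deriv g oo m) * taylor (fps_deriv m)"
    by (simp add: fps_deriv_taylor fps_compose_deriv[OF m] taylor_mult)
  moreover have "fps_deriv (taylor_subst m (taylor g)) = taylor_subst m (taylor (fps_deriv g)) * taylor (fps_deriv m)"
    unfolding taylor_subst_def fps_compose_deriv[OF taylor_diff_nth_0] fps_deriv_fps_map_compose[OF m] fps_deriv_taylor
    by (simp add: fps_deriv_taylor)
  ultimately show "fps_nth (fps_deriv (taylor (g oo m))) n = fps_nth (fps_deriv (taylor_subst m (taylor g))) n"
    using IH by (simp add: fps_mult_nth)
qed


section \<open>The twisted Taylor series\<close>

text \<open>\<open>taylor_twist e = e(T) / e(T + X)\<close>, whose coefficients are the divided powers of the
  differential operator applied to 1.\<close>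

definition taylor_twist :: "'k::field_char_0 fps \<Rightarrow> 'k fps fps" where
  "taylor_twist e = fps_const e * taylor (inverse e)"

lemma taylor_twist_1: "taylor_twist 1 = 1"
  using taylor_const[of 1] by (simp add: taylor_twist_def)

lemma taylor_twist_mult: "taylor_twist (e * f) = taylor_twist e * taylor_twist f"
  by (simp only: taylor_twist_def fps_inverse_mult taylor_mult fps_const_mult[symmetric] mult_ac)

lemma taylor_twist_prod: "finite A \<Longrightarrow> taylor_twist (prod f A) = (\<Prod>i\<in>A. taylor_twist (f i))"
  by (induction A rule: finite_induct) (simp_all add: taylor_twist_1 taylor_twist_mult)

lemma taylor_twist_compose:
  assumes "fps_nth e 0 = 1" "fps_nth m 0 = 0"
  shows "taylor_twist (e oo m) = taylor_subst m (taylor_twist e)"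
  using assms by (simp add: taylor_twist_def taylor_subst_mult taylor_subst_const taylor_compose fps_inverse_compose[symmetric])

lemma log_deriv_ode_taylor_twist:
  assumes "log_deriv_ode L e"
  shows "log_deriv_ode (- taylor L) (taylor_twist e)"
proof -
  have "fps_deriv (inverse e) = - L * inverse e"
    using log_deriv_ode_inverse[OF assms] by (simp add: log_deriv_ode_def)
  then have "fps_deriv (taylor_twist e) = - taylor L * taylor_twist e"
    by (simp add: taylor_twist_def fps_deriv_taylor taylor_mult taylor_uminus mult_ac)
  moreover have "fps_nth (taylor_twist e) 0 = 1"
    using assms by (simp add: taylor_twist_def taylor_nth_0 log_deriv_ode_def inverse_mult_eq_1')
  ultimately show ?thesis by (simp add: log_deriv_ode_def)
qed

lemma fps_deriv_pow_taylor:
  fixes g :: "'k::field_char_0 fps"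
  shows "(fps_deriv ^^ q) g = fps_const (fact q) * fps_nth (taylor g) q"
proof (induction q arbitrary: g)
  case (Suc q)
  have "fps_nth (taylor (fps_deriv g)) q = of_nat (Suc q) * fps_nth (taylor g) (Suc q)"
    by (simp flip: fps_deriv_taylor)
  then show ?case
    using Suc[of "fps_deriv g"] unfolding funpow_Suc_right comp_def fact_Suc
    by (simp add: mult_ac fps_of_nat[symmetric] del: of_nat_Suc)
qed (simp add: taylor_nth_0)

lemma diff_op_pow:
  assumes "log_deriv_ode (fps_of_poly L) e"
  shows "(diff_op L ^^ q) f = fps_const (fact q) * fps_nth (taylor_twist e * taylor f) q"
proof -
  have e: "fps_nth e 0 = 1" "inverse e * e = 1" "e * inverse e = 1"
    using assms by (auto simp: log_deriv_ode_def inverse_mult_eq_1 inverse_mult_eq_1')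
  have D: "diff_op L (e * g) = e * fps_deriv g" for g
  proof -
    have "e * g * inverse e = (e * inverse e) * g" by (simp only: mult_ac)
    then have "e * g * inverse e = g" unfolding e by simp
    then show ?thesis by (simp only: diff_op_conjugate[OF assms])
  qed
  have "(diff_op L ^^ q) (e * g) = e * (fps_deriv ^^ q) g" for g
    by (induction q) (auto simp: D)
  from this[of "inverse e * f"] have "(diff_op L ^^ q) f = e * (fps_deriv ^^ q) (inverse e * f)"
    using e by (simp flip: mult.assoc)
  also have "\<dots> = fps_const (fact q) * (e * fps_nth (taylor (inverse e) * taylor f) q)"
    by (simp add: fps_deriv_pow_taylor taylor_mult mult_ac)
  also have "e * fps_nth (taylor (inverse e) * taylor f) q = fps_nth (taylor_twist e * taylor f) q"
    by (simp add: taylor_twist_def mult.assoc)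
  finally show ?thesis .
qed

lemma coeff_bound_taylor_nth:
  fixes f :: "'k::ultrametric_field fps"
  assumes "coeff_bound r C f" "0 < r"
  shows "coeff_bound r (C / r ^ n) (fps_nth (taylor f) n)"
  by (rule coeff_bound_hasse_deriv[OF assms, where c = "\<lambda>a. (a + n) choose n"]) (simp add: taylor_nth)

lemma coeff_bound2_taylor_twist:
  fixes e :: "'k::ultrametric_field fps"
  assumes e: "coeff_bound 1 1 e" "fps_nth e 0 = 1"
  shows "coeff_bound2 1 1 1 (taylor_twist e)"
  unfolding coeff_bound2_def taylor_twist_def fps_mult_left_const_nth
proof
  fix n
  have "coeff_bound 1 (1 * (1 / 1 ^ n)) (e * fps_nth (taylor (inverse e)) n)"
    by (intro coeff_bound_mult e coeff_bound_taylor_nth coeff_bound_inverse) auto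
  then show "coeff_bound 1 (1 / 1 ^ n) (e * fps_nth (taylor (inverse e)) n)" by simp
qed

text \<open>A slope condition: a monomial \<open>T^a X^n\<close> that occurs has total degree at
  most \<open>(d/c) n\<close>. It limits how fast a twist can grow with \<open>|T|\<close> for a
  given power of \<open>X\<close>.\<close>

definition support_bound :: "nat \<Rightarrow> nat \<Rightarrow> 'a::zero fps fps \<Rightarrow> bool" where
  "support_bound c d F \<longleftrightarrow> (\<forall>n a. fps_nth (fps_nth F n) a \<noteq> 0 \<longrightarrow> c * (a + n) \<le> d * n)"

text \<open>The condition is additive in the pair \<open>(a + n, n)\<close> and so passes to
  products, hence from a logarithm to its exponential. The shift by 1 in \<open>M\<close> is the
  integration of \<open>X^n\<close> to \<open>X^(n+1)\<close>.\<close>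

lemma support_bound_of_log_deriv:
  fixes F :: "'k::field_char_0 fps fps"
  assumes ode: "log_deriv_ode M F"
    and M: "\<And>n a. fps_nth (fps_nth M n) a \<noteq> 0 \<Longrightarrow> c * (a + n + 1) \<le> d * (n + 1)"
  shows "support_bound c d F"
proof -
  have "c * (a + n) \<le> d * n" if "fps_nth (fps_nth F n) a \<noteq> 0" for n a
    using that
  proof (induction n arbitrary: a rule: less_induct)
    case (less n)
    show ?case
    proof (cases n)
      case 0
      then have "fps_nth (1 :: 'k fps) a \<noteq> 0" using less.prems log_deriv_ode_0[OF ode] by simp
      then show ?thesis using 0 by (simp split: if_splits)
    next
      case (Suc k)
      have "fps_nth (of_nat (k + 1) * fps_nth F (k + 1)) a
         = (\<Sum>j=0..k. \<Sum>b=0..a. fps_nth (fps_nth M j) b * fps_nth (fps_nth F (k - j)) (a - b))"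
        unfolding log_deriv_ode_nth[OF ode] by (simp add: fps_sum_nth fps_mult_nth)
      moreover have "fps_nth (of_nat (k + 1) * fps_nth F (k + 1)) a \<noteq> 0"
        using less.prems Suc unfolding fps_of_nat[symmetric] fps_mult_left_const_nth
        by (simp del: of_nat_Suc of_nat_add)
      ultimately have "(\<Sum>j=0..k. \<Sum>b=0..a. fps_nth (fps_nth M j) b * fps_nth (fps_nth F (k - j)) (a - b)) \<noteq> 0"
        by simp
      then obtain j where j: "j \<in> {0..k}"
        and "(\<Sum>b=0..a. fps_nth (fps_nth M j) b * fps_nth (fps_nth F (k - j)) (a - b)) \<noteq> 0"
        by (rule sum.not_neutral_contains_not_neutral)
      from this(2) obtain b where b: "b \<in> {0..a}" and
        "fps_nth (fps_nth M j) b * fps_nth (fps_nth F (k - j)) (a - b) \<noteq> 0"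
        by (rule sum.not_neutral_contains_not_neutral)
      then have nz: "fps_nth (fps_nth M j) b \<noteq> 0" "fps_nth (fps_nth F (k - j)) (a - b) \<noteq> 0" by auto
      have "c * ((a - b) + (k - j)) \<le> d * (k - j)"
        by (rule less.IH[OF _ nz(2)]) (use Suc in simp)
      then have "c * (b + j + 1) + c * ((a - b) + (k - j)) \<le> d * (j + 1) + d * (k - j)"
        by (rule add_mono[OF M[OF nz(1)]])
      moreover have "(j + 1) + (k - j) = n" "(b + j + 1) + ((a - b) + (k - j)) = a + n"
        using j b Suc by auto
      ultimately show ?thesis by (metis distrib_left)
    qed
  qed
  then show ?thesis by (simp add: support_bound_def)
qed

lemma coeff_bound2_sum_compose:
  assumes "\<And>n. n \<le> k \<Longrightarrow> coeff_bound r (C / s ^ k) (fps_nth F n * fps_nth (Z ^ n) k)" "0 \<le> C" "0 < s" "0 < r"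
  shows "coeff_bound r (C / s ^ k) (fps_nth (F oo Z) k)"
  unfolding fps_compose_nth using assms by (intro coeff_bound_sum) auto

text \<open>With \<open>y = |\<lambda> T\<^sup>i|\<close> and \<open>|(T + X)\<^sup>i / T\<^sup>i - 1| \<le> w\<close>, a term \<open>Y\<^sup>a Z\<^sup>n\<close> is at most
  \<open>y\<^bsup>a+n\<^esup> w\<^sup>n\<close>.\<close>

lemma coeff_bound2_taylor_subst:
  fixes F :: "'k::ultrametric_field fps fps"
  assumes F: "coeff_bound2 1 1 1 F" and supp: "support_bound c d F" and c: "0 < c"
    and i: "0 < i" and l: "l \<noteq> 0" and r: "0 < r" "0 < s"
    and y: "y = absv l * r ^ i" and w: "0 < w" "max 1 y ^ d * w ^ c \<le> 1"
    and Z: "coeff_bound2 r s (y * w) (taylor (fps_const l * fps_X ^ i) - fps_const (fps_const l * fps_X ^ i))"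
  shows "coeff_bound2 r s 1 (taylor_subst (fps_const l * fps_X ^ i) F)"
  unfolding coeff_bound2_def taylor_subst_def
proof (rule allI, rule coeff_bound2_sum_compose)
  fix k n :: nat
  let ?m = "fps_const l * fps_X ^ i"
  let ?Z = "taylor ?m - fps_const ?m"
  have y0: "0 < y" using absv_pos[OF l] r by (simp add: y)
  have yw: "0 < y * w" using y0 w by simp
  \<comment> \<open>The slope condition bounds \<open>c (a + n)\<close> rather than
    \<open>a + n\<close>, so the inequality is checked after raising it to the power
    \<open>c\<close>.\<close>
  have key: "y ^ (a + n) * w ^ n \<le> 1" if a: "c * (a + n) \<le> d * n" for a
  proof (rule ccontr)
    assume "\<not> ?thesis"
    then have "1 < (y ^ (a + n) * w ^ n) ^ c" using c by (intro one_less_power) auto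
    also have "\<dots> = y ^ (c * (a + n)) * (w ^ c) ^ n"
      by (simp add: power_mult_distrib mult.commute flip: power_mult)
    also have "y ^ (c * (a + n)) \<le> max 1 y ^ (c * (a + n))" using y0 by (intro power_mono) auto
    also have "\<dots> \<le> max 1 y ^ (d * n)" using a by (intro power_increasing) auto
    also have "max 1 y ^ (d * n) * (w ^ c) ^ n = (max 1 y ^ d * w ^ c) ^ n"
      by (simp add: power_mult power_mult_distrib)
    also have "\<dots> \<le> 1" using w by (intro power_le_one) auto
    finally show False using w by simp
  qed
  have "coeff_bound r (1 / (y * w) ^ n) (fps_nth F n oo ?m)"
  proof (rule coeff_boundI)
    fix b
    show "absv (fps_nth (fps_nth F n oo ?m) b) * r ^ b \<le> 1 / (y * w) ^ n"
    proof (cases "i dvd b \<and> fps_nth (fps_nth F n) (b div i) \<noteq> 0")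
      case True
      then obtain a where a: "b = i * a" by auto
      then have nz: "fps_nth (fps_nth F n) a \<noteq> 0" using True i by simp
      have "c * (a + n) \<le> d * n" using supp nz by (simp add: support_bound_def)
      from key[OF this] have ya: "y ^ a * (y * w) ^ n \<le> 1" by (simp add: power_add power_mult_distrib mult_ac)
      have "absv (fps_nth (fps_nth F n) a) \<le> 1"
        using F by (simp add: coeff_bound2_def coeff_bound_def)
      then have "absv (fps_nth (fps_nth F n) a) * y ^ a \<le> 1 * y ^ a" using y0 by (intro mult_right_mono) auto
      also have "\<dots> \<le> 1 / (y * w) ^ n" using ya yw by (simp add: pos_le_divide_eq)
      finally have "absv (fps_nth (fps_nth F n) a) * y ^ a \<le> 1 / (y * w) ^ n" .
      moreover have "fps_nth (fps_nth F n oo ?m) b = fps_nth (fps_nth F n) a * l ^ a"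
        using a i by (simp add: fps_compose_monom_nth)
      moreover have "r ^ b = (r ^ i) ^ a" by (simp add: a power_mult)
      ultimately show ?thesis by (simp add: absv_mult absv_power y power_mult_distrib mult.assoc)
    qed (use yw i in \<open>auto simp: fps_compose_monom_nth\<close>)
  qed
  moreover have "coeff_bound r ((y * w) ^ n / s ^ k) (fps_nth (?Z ^ n) k)"
    using coeff_bound2_power[OF Z r, of n] by (simp add: coeff_bound2_def)
  ultimately have "coeff_bound r (1 / (y * w) ^ n * ((y * w) ^ n / s ^ k)) ((fps_nth F n oo ?m) * fps_nth (?Z ^ n) k)"
    by (intro coeff_bound_mult r)
  then show "coeff_bound r (1 / s ^ k) (fps_nth (fps_map_compose ?m F) n * fps_nth (?Z ^ n) k)"
    using yw w y0 by (simp add: fps_map_compose_def)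
qed (use r in auto)

text \<open>This is \<open>exp(X)\<close> over the ring of series in \<open>T\<close>; since that
  ring is not a field, \<open>1 / n!\<close> is taken in the ground field.\<close>

definition exp_series :: "'k::field_char_0 fps fps" where
  "exp_series = Abs_fps (\<lambda>n. fps_const (1 / fact n))"

lemma log_deriv_ode_exp_series: "log_deriv_ode 1 (exp_series :: 'k::field_char_0 fps fps)"
proof -
  have "of_nat (Suc n) * fps_const (1 / fact (Suc n)) = (fps_const (1 / fact n) :: 'k fps)" for n
    unfolding fps_of_nat[symmetric] fps_const_mult fact_Suc by (simp add: field_simps del: of_nat_Suc)
  then show ?thesis
    by (simp add: log_deriv_ode_def exp_series_def fps_eq_iff[of "fps_deriv _"] del: of_nat_Suc fact_Suc of_nat_add)
qed

lemma log_deriv_ode_exp_series_compose: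
  "fps_nth u 0 = 0 \<Longrightarrow> log_deriv_ode (fps_deriv u) (exp_series oo u)"
  using log_deriv_ode_compose[OF log_deriv_ode_exp_series, of u] by simp

lemma exp_series_compose_add:
  assumes "fps_nth u 0 = 0" "fps_nth v 0 = 0"
  shows "exp_series oo (u + v) = (exp_series oo u) * (exp_series oo v)"
proof (rule log_deriv_ode_unique)
  show "log_deriv_ode (fps_deriv u + fps_deriv v) (exp_series oo (u + v))"
    using log_deriv_ode_exp_series_compose[of "u + v"] assms by simp
  show "log_deriv_ode (fps_deriv u + fps_deriv v) ((exp_series oo u) * (exp_series oo v))"
    using assms by (intro log_deriv_ode_mult log_deriv_ode_exp_series_compose)
qed

lemma taylor_subst_exp_series:
  assumes m: "fps_nth m 0 = 0"
  shows "taylor_subst m (exp_series oo (fps_const g * fps_X))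
       = exp_series oo (fps_const (g oo m) * (taylor m - fps_const m))"
proof -
  have "fps_map_compose m (exp_series oo (fps_const g * fps_X)) = exp_series oo (fps_const (g oo m) * fps_X)"
    by (rule fps_ext) (simp add: fps_map_compose_def exp_series_def fps_compose_linear
        fps_compose_mult_distrib[OF m] fps_compose_power[OF m])
  then show ?thesis
    unfolding taylor_subst_def
    using fps_compose_assoc[OF taylor_diff_nth_0, of "fps_const (g oo m) * fps_X" exp_series m]
    by (simp add: fps_compose_mult_distrib[OF taylor_diff_nth_0] taylor_nth_0)
qed

text \<open>The scalar \<open>w\<close> absorbs the denominators \<open>n!\<close>. It will be
  \<open>\<zeta> - 1\<close> for a root of unity \<open>\<zeta>\<close> of order \<open>p\<close>,
  where Legendre's formula gives the hypothesis.\<close>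

lemma coeff_bound2_exp_series_compose:
  fixes v :: "'k::ultrametric_field fps fps"
  assumes v: "fps_nth v 0 = 0" "coeff_bound2 r s 1 v" and r: "0 < r" "0 < s"
    and w: "\<And>n. absv (w ^ n / fact n) \<le> 1"
  shows "coeff_bound2 r s 1 (exp_series oo (fps_const (fps_const w) * v))"
  unfolding coeff_bound2_def
proof (rule allI, rule coeff_bound2_sum_compose)
  fix k n :: nat
  have "fps_nth exp_series n * fps_nth ((fps_const (fps_const w) * v) ^ n) k = fps_const (w ^ n / fact n) * fps_nth (v ^ n) k"
    by (simp add: exp_series_def power_mult_distrib flip: mult.assoc)
  moreover have "coeff_bound r (absv (w ^ n / fact n) * (1 ^ n / s ^ k)) (fps_const (w ^ n / fact n) * fps_nth (v ^ n) k)"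
    using coeff_bound2_power[OF v(2) r, of n] by (intro coeff_bound_const_mult) (simp add: coeff_bound2_def)
  moreover have "absv (w ^ n / fact n) * (1 ^ n / s ^ k) \<le> 1 / s ^ k"
    using w[of n] r by (simp add: divide_right_mono)
  ultimately show "coeff_bound r (1 / s ^ k) (fps_nth exp_series n * fps_nth ((fps_const (fps_const w) * v) ^ n) k)"
    by (metis coeff_bound_mono)
qed (use r in auto)


section \<open>Binomial coefficients and powers of primes\<close>

text \<open>From \<open>l binom(n, l) = n binom(n - 1, l - 1)\<close> with \<open>n = m p^j\<close>,
  the valuation of the binomial coefficient is at least \<open>j\<close> minus that of
  \<open>l\<close>. So modulo \<open>p\<close> only powers of \<open>X^(p^j)\<close> occur in
  \<open>(T + X)^n\<close>.\<close>

lemma absv_binomial_le: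
  assumes Q: "extends_Qp p TYPE('k::ultrametric_field)" "prime p" and l: "0 < l" "\<not> p ^ j dvd l"
  shows "absv (of_nat ((m * p ^ j) choose l) :: 'k) \<le> 1 / real p"
proof -
  have p: "1 < p" using Q prime_gt_1_nat by blast
  define v where "v = multiplicity p l"
  obtain l' where l': "l = p ^ v * l'" "\<not> p dvd l'"
    using multiplicity_decompose'[of l p] l p unfolding v_def by (metis neq0_conv less_irrefl nat_dvd_1_iff_1)
  have "v < j"
  proof (rule ccontr)
    assume "\<not> v < j"
    then have "p ^ j dvd p ^ v" by (intro le_imp_power_dvd) simp
    then show False using l l' by (metis dvd_mult2)
  qed
  have "l * ((m * p ^ j) choose l) = m * p ^ j * ((m * p ^ j - 1) choose (l - 1))"
    using l by (intro times_binomial_minus1_eq) auto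
  then have "absv (of_nat l :: 'k) * absv (of_nat ((m * p ^ j) choose l) :: 'k)
      = absv (of_nat m :: 'k) * absv (of_nat (p ^ j) :: 'k) * absv (of_nat ((m * p ^ j - 1) choose (l - 1)) :: 'k)"
    by (metis absv_mult of_nat_mult)
  also have "\<dots> \<le> 1 * absv (of_nat (p ^ j) :: 'k) * 1"
    by (intro mult_mono absv_of_nat_le_1) auto
  finally have "absv (of_nat l :: 'k) * absv (of_nat ((m * p ^ j) choose l) :: 'k) \<le> 1 / real p ^ j"
    using absv_of_nat_prime_power[OF Q] by simp
  moreover have "absv (of_nat l :: 'k) = 1 / real p ^ v"
    using absv_of_nat_prime_power[OF Q, of v] absv_of_nat_not_dvd[OF Q(1) l'(2)]
    unfolding l'(1) of_nat_mult absv_mult by simp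
  ultimately have "absv (of_nat ((m * p ^ j) choose l) :: 'k) \<le> real p ^ v / real p ^ j"
    using p by (simp add: field_simps)
  also have "real p ^ v / real p ^ j = 1 / real p ^ (j - v)"
    using \<open>v < j\<close> p by (simp add: power_diff)
  also have "\<dots> \<le> 1 / real p ^ 1"
    using p \<open>v < j\<close> by (intro divide_left_mono power_increasing) auto
  finally show ?thesis by simp
qed

text \<open>The first power of \<open>X\<close> that survives in \<open>(T + X)^(m p^j)\<close>
  modulo \<open>p\<close> has a unit coefficient; this determines the exact size of the dominant
  term. Pascal's rule, with \<open>absv_binomial_le\<close>, shows that all
  \<open>binom(m p^j - 1, k)\<close> with \<open>k < p^j\<close> are units.\<close>

lemma absv_binomial_prime_power:
  assumes Q: "extends_Qp p TYPE('k::ultrametric_field)" "prime p" and m: "\<not> p dvd m"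
  shows "absv (of_nat ((m * p ^ j) choose (p ^ j)) :: 'k) = 1"
proof -
  have p: "1 < p" using Q prime_gt_1_nat by blast
  have m0: "0 < m" using m by (cases m) auto
  have "absv (of_nat ((m * p ^ j - 1) choose k) :: 'k) = 1" if "k < p ^ j" for k
    using that
  proof (induction k)
    case (Suc k)
    define a where "a = (of_nat ((m * p ^ j - 1) choose k) :: 'k)"
    define b where "b = (of_nat ((m * p ^ j) choose Suc k) :: 'k)"
    have a: "absv a = 1" using Suc by (simp add: a_def)
    have "\<not> p ^ j dvd Suc k" using Suc.prems by (simp add: nat_dvd_not_less)
    then have "absv b \<le> 1 / real p" unfolding b_def by (intro absv_binomial_le Q) auto
    also have "\<dots> < 1" using p by simp
    finally have b: "absv b < absv (- a)" using a by simp
    have "Suc (m * p ^ j - 1) = m * p ^ j" using m0 p by simp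
    then have "(m * p ^ j) choose Suc k = ((m * p ^ j - 1) choose k) + ((m * p ^ j - 1) choose Suc k)"
      by (metis binomial_Suc_Suc)
    then have "of_nat ((m * p ^ j - 1) choose Suc k) = - a + b" by (simp add: a_def b_def)
    then show ?case using absv_add_dominant[OF b] a by simp
  qed simp
  then have one: "absv (of_nat ((m * p ^ j - 1) choose (p ^ j - 1)) :: 'k) = 1" using p by simp
  have "p ^ j * ((m * p ^ j) choose p ^ j) = p ^ j * (m * ((m * p ^ j - 1) choose (p ^ j - 1)))"
    using p times_binomial_minus1_eq[of "p ^ j" "m * p ^ j"] by simp
  then have "(m * p ^ j) choose p ^ j = m * ((m * p ^ j - 1) choose (p ^ j - 1))"
    using p by (metis mult_left_cancel power_not_zero less_nat_zero_code)
  then show ?thesis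
    using one absv_of_nat_not_dvd[OF Q(1) m] by (simp add: absv_mult)
qed


section \<open>Bounds for the twists of the basic exponentials\<close>

lemma taylor_monom_nth:
  assumes "n \<le> i"
  shows "fps_nth (taylor (fps_const l * fps_X ^ i)) n
       = fps_const (of_nat (i choose n) * l) * fps_X ^ (i - n)"
  using assms by (auto simp: fps_eq_iff taylor_nth)

lemma taylor_monom_nth_eq_0:
  "i < n \<Longrightarrow> fps_nth (taylor (fps_const l * fps_X ^ i)) n = 0"
  by (auto simp: fps_eq_iff taylor_nth)

lemma coeff_bound_monom:
  assumes "0 \<le> r" "absv c * r ^ k \<le> C"
  shows "coeff_bound r C (fps_const c * fps_X ^ k)"
proof -
  have "0 \<le> C" using assms by (meson absv_nonneg mult_nonneg_nonneg order_trans zero_le_power)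
  then show ?thesis using assms by (intro coeff_boundI) auto
qed

text \<open>Here \<open>u\<close> stands for \<open>|X / T|\<close>, and \<open>w\<close> bounds the
  terms of \<open>(T + X)^i / T^i - 1 = \<Sum> binom(i, n) (X / T)^n\<close>.\<close>

lemma coeff_bound2_taylor_monom_diff:
  fixes l :: "'k::ultrametric_field"
  assumes r: "0 < r" "0 < u" and y: "y = absv l * r ^ i" and w: "0 \<le> w"
    and bin: "\<And>n. 1 \<le> n \<Longrightarrow> n \<le> i \<Longrightarrow> absv (of_nat (i choose n) :: 'k) * u ^ n \<le> w"
  shows "coeff_bound2 r (r * u) (y * w) (taylor (fps_const l * fps_X ^ i) - fps_const (fps_const l * fps_X ^ i))"
  unfolding coeff_bound2_def
proof
  fix n
  have yw: "0 \<le> y * w" using w y r by simp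
  let ?F = "taylor (fps_const l * fps_X ^ i) - fps_const (fps_const l * fps_X ^ i)"
  show "coeff_bound r (y * w / (r * u) ^ n) (fps_nth ?F n)"
  proof (cases "1 \<le> n \<and> n \<le> i")
    case True
    then have F: "fps_nth ?F n = fps_const (of_nat (i choose n) * l) * fps_X ^ (i - n)"
      by (simp add: taylor_monom_nth)
    have "absv (of_nat (i choose n) * l) * r ^ (i - n) * (r * u) ^ n
       = absv l * (r ^ (i - n) * r ^ n) * (absv (of_nat (i choose n) :: 'k) * u ^ n)"
      by (simp add: absv_mult power_mult_distrib)
    also have "r ^ (i - n) * r ^ n = r ^ i" using True by (simp flip: power_add)
    also have "absv l * r ^ i * (absv (of_nat (i choose n) :: 'k) * u ^ n) \<le> absv l * r ^ i * w"
      using True bin r by (intro mult_left_mono) auto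
    finally have "absv (of_nat (i choose n) * l) * r ^ (i - n) \<le> y * w / (r * u) ^ n"
      using r y by (simp add: pos_le_divide_eq)
    then show ?thesis unfolding F using r by (intro coeff_bound_monom) auto
  next
    case False
    then have "fps_nth ?F n = 0"
      by (cases "n = 0") (auto simp: taylor_nth_0 taylor_monom_nth_eq_0)
    then show ?thesis using yw r by (simp add: coeff_bound_0)
  qed
qed

context
  fixes p s :: nat and z :: "'k::ultrametric_field"
  assumes Q: "extends_Qp p TYPE('k)" "prime p" and z: "z ^ (p ^ (s + 1)) = 1"
begin

lemma p_gt_1: "1 < p" using Q prime_gt_1_nat by blast

lemma pulita_log_deriv_nth_nonzero:
  assumes "fps_nth (pulita_log_deriv p z) b \<noteq> 0"
  shows "\<exists>k\<le>s. b + 1 = p ^ k"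
proof -
  obtain k where k: "b + 1 = p ^ k" and nz: "z ^ (p ^ k) \<noteq> 1"
    using assms by (auto simp: pulita_log_deriv_def split: if_splits)
  have "k \<le> s"
  proof (rule ccontr)
    assume "\<not> k \<le> s"
    then have "k = (s + 1) + (k - (s + 1))" by simp
    then have "p ^ k = p ^ (s + 1) * p ^ (k - (s + 1))" by (metis power_add)
    then have "z ^ (p ^ k) = 1" using z by (simp only: power_mult power_one)
    then show False using nz by simp
  qed
  then show ?thesis using k by blast
qed

lemma coeff_bound_pulita_exp': "coeff_bound 1 1 (pulita_exp p z)"
  using absv_root_of_unity[OF z] p_gt_1 by (intro coeff_bound_pulita_exp Q) auto

lemma pulita_exp_nth_0: "fps_nth (pulita_exp p z) 0 = 1"
  using log_deriv_ode_0[OF log_deriv_ode_pulita_exp] .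

lemma support_bound_twist_pulita_exp: "support_bound 1 (p ^ s) (taylor_twist (pulita_exp p z))"
proof (rule support_bound_of_log_deriv[OF log_deriv_ode_taylor_twist[OF log_deriv_ode_pulita_exp]])
  fix n a assume "fps_nth (fps_nth (- taylor (pulita_log_deriv p z)) n) a \<noteq> 0"
  then have "fps_nth (pulita_log_deriv p z) (a + n) \<noteq> 0" by (auto simp: taylor_nth)
  then obtain k where "k \<le> s" "a + n + 1 = p ^ k" using pulita_log_deriv_nth_nonzero by blast
  then have "a + n + 1 \<le> p ^ s" using p_gt_1 by (simp add: power_increasing)
  then show "1 * (a + n + 1) \<le> p ^ s * (n + 1)" by (simp add: trans_le_add1)
qed

text \<open>\<open>T\<^bsup>p\<^sup>s\<^esup>\<close> has the extremal slope among the terms of the logarithm. Its linear part in \<open>X\<close>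
  is split off; the remaining factor has at most half the slope.\<close>

lemma support_bound_twist_pulita_exp_reduced:
  "support_bound 2 (p ^ s) (taylor_twist (pulita_exp p z) *
     (exp_series oo (fps_const (fps_const (z ^ p ^ s - 1) * fps_X ^ (p ^ s - 1)) * fps_X)))"
proof (rule support_bound_of_log_deriv)
  let ?g = "fps_const (z ^ p ^ s - 1) * fps_X ^ (p ^ s - 1) :: 'k fps"
  let ?L = "pulita_log_deriv p z"
  have "log_deriv_ode (fps_const ?g) (exp_series oo (fps_const ?g * fps_X))"
    using log_deriv_ode_exp_series_compose[of "fps_const ?g * fps_X"] by simp
  then show "log_deriv_ode (- taylor ?L + fps_const ?g)
      (taylor_twist (pulita_exp p z) * (exp_series oo (fps_const ?g * fps_X)))"
    by (intro log_deriv_ode_mult log_deriv_ode_taylor_twist log_deriv_ode_pulita_exp)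
  fix n a assume nz: "fps_nth (fps_nth (- taylor ?L + fps_const ?g) n) a \<noteq> 0"
  show "2 * (a + n + 1) \<le> p ^ s * (n + 1)"
  \<comment> \<open>For \<open>n = 0\<close> the extremal term cancels, and the others have exponent
    at most \<open>p^(s-1)\<close>, which is at most half of \<open>p^s\<close>; for
    \<open>n > 0\<close> the factor \<open>n + 1 >= 2\<close> suffices.\<close>
  proof (cases "n = 0")
    case True
    have nz: "- fps_nth ?L a + (if a = p ^ s - 1 then z ^ p ^ s - 1 else 0) \<noteq> 0"
      using nz True by (auto simp: taylor_nth)
    have ps: "Suc (p ^ s - 1) = p ^ s" using p_gt_1 by simp
    have "a \<noteq> p ^ s - 1"
    proof
      assume "a = p ^ s - 1"
      then have "fps_nth ?L a = z ^ p ^ s - 1" using ps unfolding pulita_log_deriv_def by auto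
      then show False using nz \<open>a = p ^ s - 1\<close> by simp
    qed
    then have "fps_nth ?L a \<noteq> 0" using nz by simp
    then obtain k where k: "k \<le> s" "a + 1 = p ^ k" using pulita_log_deriv_nth_nonzero by blast
    have "k \<noteq> s" using k \<open>a \<noteq> p ^ s - 1\<close> by auto
    then have "p ^ Suc k \<le> p ^ s"
      using k p_gt_1 by (intro power_increasing) auto
    moreover have "2 * p ^ k \<le> p ^ Suc k" using p_gt_1 by simp
    ultimately have "2 * p ^ k \<le> p ^ s" by (meson order_trans)
    then show ?thesis using k True by simp
  next
    case False
    then have "fps_nth ?L (a + n) \<noteq> 0" using nz by (auto simp: taylor_nth)
    then obtain k where k: "k \<le> s" "a + n + 1 = p ^ k" using pulita_log_deriv_nth_nonzero by blast
    then have "a + n + 1 \<le> p ^ s" using p_gt_1 by (simp add: power_increasing)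
    then have "2 * (a + n + 1) \<le> (n + 1) * p ^ s" using False by (intro mult_mono) auto
    then show ?thesis by (simp add: mult.commute)
  qed
qed

context
  fixes l :: 'k and i :: nat and r u y w :: real
  assumes i: "0 < i" and l: "l \<noteq> 0" and ru: "0 < r" "0 < u" and y: "y = absv l * r ^ i" and w: "0 < w"
    and bin: "\<And>n. 1 \<le> n \<Longrightarrow> n \<le> i \<Longrightarrow> absv (of_nat (i choose n) :: 'k) * u ^ n \<le> w"
begin

lemma Z_bound:
  "coeff_bound2 r (r * u) (y * w) (taylor (fps_const l * fps_X ^ i) - fps_const (fps_const l * fps_X ^ i))"
  using ru y w bin by (intro coeff_bound2_taylor_monom_diff) auto

lemma monom_nth_0: "fps_nth (fps_const l * fps_X ^ i) 0 = 0"
  using i by simp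

lemma coeff_bound2_twist_minor:
  assumes "max 1 y ^ (p ^ s) * w \<le> 1"
  shows "coeff_bound2 r (r * u) 1 (taylor_twist (pulita_exp p z oo (fps_const l * fps_X ^ i)))"
  unfolding taylor_twist_compose[OF pulita_exp_nth_0 monom_nth_0]
  by (rule coeff_bound2_taylor_subst[OF coeff_bound2_taylor_twist[OF coeff_bound_pulita_exp' pulita_exp_nth_0]
      support_bound_twist_pulita_exp _ i l _ _ y w _ Z_bound]) (use assms ru in auto)

text \<open>The twist of \<open>pulita_exp p z\<close> is \<open>F exp(-g X)\<close>, where
  \<open>F\<close> has half the slope and therefore needs only \<open>half\<close>, with
  \<open>w^2\<close> in place of \<open>w\<close>. Substituting \<open>l T^i\<close> turns the
  exponential into \<open>exp(pi V)\<close>, where \<open>V\<close> has the terms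
  \<open>- binom(i, n) l^(p^s) T^(i p^s - n) X^n\<close>. By \<open>rest\<close> all of them except
  \<open>n = P\<close> are bounded by 1 and go into \<open>H\<close>.\<close>

lemma twist_major_factorization:
  assumes half: "max 1 y ^ (p ^ s) * w ^ 2 \<le> 1"
    and P: "0 < P" "P \<le> i"
    and rest: "\<And>n. 1 \<le> n \<Longrightarrow> n \<le> i \<Longrightarrow> n \<noteq> P \<Longrightarrow> y ^ (p ^ s) * (absv (of_nat (i choose n) :: 'k) * u ^ n) \<le> 1"
    and fact: "\<And>n. absv ((z ^ p ^ s - 1) ^ n / fact n) \<le> 1"
  shows "\<exists>H. taylor_twist (pulita_exp p z oo (fps_const l * fps_X ^ i)) =
      (exp_series oo (fps_const (fps_const (- (of_nat (i choose P) * l ^ (p ^ s) * (z ^ p ^ s - 1)))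
          * fps_X ^ (i * p ^ s - P)) * fps_X ^ P)) * H
      \<and> coeff_bound2 r (r * u) 1 H \<and> fps_nth H 0 = 1"
proof -
  let ?m = "fps_const l * fps_X ^ i"
  let ?Z = "taylor ?m - fps_const ?m"
  define pi where "pi = z ^ p ^ s - 1"
  define g where "g = fps_const pi * fps_X ^ (p ^ s - 1)"
  define F where "F = taylor_twist (pulita_exp p z) * (exp_series oo (fps_const g * fps_X))"
  have s0: "0 < r * u" using ru by simp
  have ps: "0 < p ^ s" using p_gt_1 by simp
  have "coeff_bound2 1 1 1 (exp_series oo (fps_const (fps_const pi) * (fps_const (fps_X ^ (p ^ s - 1)) * fps_X)))"
  proof (rule coeff_bound2_exp_series_compose)
    show "coeff_bound2 1 1 1 (fps_const (fps_X ^ (p ^ s - 1)) * fps_X :: 'k fps fps)"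
      by (auto simp: coeff_bound2_def intro!: coeff_boundI)
  qed (use fact in \<open>auto simp: pi_def\<close>)
  moreover have "fps_const (fps_const pi) * (fps_const (fps_X ^ (p ^ s - 1)) * fps_X) = fps_const g * fps_X"
    by (simp add: g_def mult.assoc flip: fps_const_mult)
  ultimately have E: "coeff_bound2 1 1 1 (exp_series oo (fps_const g * fps_X))" by (simp only:)
  have "coeff_bound2 1 1 (1 * 1) F" unfolding F_def
    by (intro coeff_bound2_mult E coeff_bound2_taylor_twist coeff_bound_pulita_exp' pulita_exp_nth_0) auto
  then have F1: "coeff_bound2 1 1 1 F" by simp
  have F2: "support_bound 2 (p ^ s) F"
    unfolding F_def g_def pi_def by (rule support_bound_twist_pulita_exp_reduced)
  have H1: "coeff_bound2 r (r * u) 1 (taylor_subst ?m F)"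
    by (rule coeff_bound2_taylor_subst[OF F1 F2 _ i l _ _ y w _ Z_bound]) (use half ru in auto)
  have inv: "(exp_series oo (fps_const g * fps_X)) * (exp_series oo (fps_const (- g) * fps_X)) = 1"
  proof -
    have "fps_const g * fps_X + fps_const (- g) * fps_X = 0" by (simp flip: fps_const_neg)
    then have "exp_series oo (fps_const g * fps_X + fps_const (- g) * fps_X) = 1"
      by (simp only: fps_compose_0_right) (simp add: exp_series_def)
    moreover have "fps_nth (fps_const h * fps_X) 0 = 0" for h :: "'k fps" by simp
    ultimately show ?thesis using exp_series_compose_add by metis
  qed
  have "taylor_twist (pulita_exp p z) = F * (exp_series oo (fps_const (- g) * fps_X))"
    unfolding F_def mult.assoc inv by simp
  then have T: "taylor_twist (pulita_exp p z oo ?m) = taylor_subst ?m F * (exp_series oo (fps_const ((- g) oo ?m) * ?Z))"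
    by (simp only: taylor_twist_compose[OF pulita_exp_nth_0 monom_nth_0] taylor_subst_mult[OF monom_nth_0]
        taylor_subst_exp_series[OF monom_nth_0])
  define V where "V = fps_const (- (?m ^ (p ^ s - 1))) * ?Z"
  have gm: "(- g) oo ?m = fps_const pi * (- (?m ^ (p ^ s - 1)))"
    by (simp add: g_def fps_compose_uminus fps_compose_mult_distrib[OF monom_nth_0]
        fps_compose_power[OF monom_nth_0, symmetric] fps_X_fps_compose_startby0[OF monom_nth_0])
  have V: "fps_const ((- g) oo ?m) * ?Z = fps_const (fps_const pi) * V"
    unfolding gm V_def by (simp only: mult.assoc fps_const_mult[symmetric])
  have V0: "fps_nth V 0 = 0" unfolding V_def by (simp add: taylor_nth_0)
  have Vn: "fps_nth V n = fps_const (- (of_nat (i choose n) * l ^ (p ^ s))) * fps_X ^ (i * p ^ s - n)"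
    if n: "1 \<le> n" "n \<le> i" for n
  proof -
    have "fps_nth V n = - (?m ^ (p ^ s - 1)) * (fps_const (of_nat (i choose n) * l) * fps_X ^ (i - n))"
      using n unfolding V_def by (simp add: taylor_monom_nth)
    also have "?m ^ (p ^ s - 1) = fps_const (l ^ (p ^ s - 1)) * fps_X ^ (i * (p ^ s - 1))"
      by (simp add: power_mult_distrib power_mult)
    also have "- (fps_const (l ^ (p ^ s - 1)) * fps_X ^ (i * (p ^ s - 1))) * (fps_const (of_nat (i choose n) * l) * fps_X ^ (i - n))
       = - (fps_const (l ^ (p ^ s - 1)) * fps_const (of_nat (i choose n) * l)) * (fps_X ^ (i * (p ^ s - 1)) * fps_X ^ (i - n))"
      by (simp only: mult_minus_left mult_minus_right mult_ac)
    also have "fps_X ^ (i * (p ^ s - 1)) * fps_X ^ (i - n) = (fps_X ^ (i * p ^ s - n) :: 'k fps)"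
      using n ps by (cases "p ^ s") (auto simp flip: power_add)
    also have "fps_const (l ^ (p ^ s - 1)) * fps_const (of_nat (i choose n) * l) = fps_const (of_nat (i choose n) * l ^ (p ^ s))"
      using ps by (cases "p ^ s") (auto simp: mult_ac)
    finally show ?thesis by (simp flip: fps_const_neg)
  qed
  have Vn': "fps_nth V n = 0" if "i < n" for n
    using that unfolding V_def by (simp add: taylor_monom_nth_eq_0)
  \<comment> \<open>\<open>V1\<close> is the one term that is allowed to exceed 1 on the chosen
    disc; it becomes the dominant exponential.\<close>
  define V1 where "V1 = fps_const (fps_nth V P) * fps_X ^ P"
  define V2 where "V2 = V - V1"
  have V2n: "fps_nth V2 n = (if n = P then 0 else fps_nth V n)" for n
    by (simp add: V2_def V1_def)
  have "coeff_bound2 r (r * u) 1 V2" unfolding coeff_bound2_def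
  proof
    fix n
    show "coeff_bound r (1 / (r * u) ^ n) (fps_nth V2 n)"
    proof (cases "1 \<le> n \<and> n \<le> i \<and> n \<noteq> P")
      case True
      then have "absv (- (of_nat (i choose n) * l ^ (p ^ s))) * r ^ (i * p ^ s - n) * (r * u) ^ n
         = absv l ^ (p ^ s) * (r ^ (i * p ^ s - n) * r ^ n) * (absv (of_nat (i choose n) :: 'k) * u ^ n)"
        by (simp add: absv_mult absv_power power_mult_distrib)
      also have "r ^ (i * p ^ s - n) * r ^ n = r ^ (i * p ^ s)"
      proof -
        have "n \<le> i * p ^ s" using True ps by (metis mult_le_mono2 mult.right_neutral order_trans Suc_leI One_nat_def)
        then show ?thesis by (simp flip: power_add)
      qed
      also have "absv l ^ (p ^ s) * r ^ (i * p ^ s) = y ^ (p ^ s)"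
        by (simp add: y power_mult_distrib power_mult)
      also have "y ^ (p ^ s) * (absv (of_nat (i choose n) :: 'k) * u ^ n) \<le> 1" using rest True by blast
      finally have "absv (- (of_nat (i choose n) * l ^ (p ^ s))) * r ^ (i * p ^ s - n) \<le> 1 / (r * u) ^ n"
        using s0 by (simp add: pos_le_divide_eq)
      from coeff_bound_monom[OF less_imp_le[OF ru(1)] this]
      have "coeff_bound r (1 / (r * u) ^ n) (fps_nth V n)" using True by (simp only: Vn)
      then show ?thesis using True by (simp add: V2n)
    next
      case False
      then have "fps_nth V2 n = 0" using V0 Vn' by (cases "n = 0") (auto simp: V2n)
      then show ?thesis using s0 by (simp add: coeff_bound_0)
    qed
  qed
  then have H2: "coeff_bound2 r (r * u) 1 (exp_series oo (fps_const (fps_const pi) * V2))"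
    using P V0 fact s0 ru by (intro coeff_bound2_exp_series_compose) (auto simp: V2n pi_def)
  define H where "H = (exp_series oo (fps_const (fps_const pi) * V2)) * taylor_subst ?m F"
  have "coeff_bound2 r (r * u) (1 * 1) H" unfolding H_def
    by (intro coeff_bound2_mult H1 H2 ru s0)
  moreover have "fps_nth H 0 = 1"
    by (simp add: H_def exp_series_def taylor_subst_def fps_map_compose_def F_def taylor_twist_def
        taylor_nth_0 pulita_exp_nth_0 inverse_mult_eq_1')
  moreover have "taylor_twist (pulita_exp p z oo ?m) = (exp_series oo (fps_const (fps_const pi) * V1)) * H"
  proof -
    have "fps_const (fps_const pi) * V = fps_const (fps_const pi) * V1 + fps_const (fps_const pi) * V2"
      by (simp add: V2_def algebra_simps)
    then have "exp_series oo (fps_const (fps_const pi) * V)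
       = (exp_series oo (fps_const (fps_const pi) * V1)) * (exp_series oo (fps_const (fps_const pi) * V2))"
      using exp_series_compose_add[of "fps_const (fps_const pi) * V1" "fps_const (fps_const pi) * V2"] P V0
      by (simp add: V1_def V2n)
    then show ?thesis unfolding T V H_def by (simp only: mult_ac)
  qed
  moreover have "fps_const (fps_const pi) * V1 = fps_const (fps_const (- (of_nat (i choose P) * l ^ (p ^ s) * pi))
          * fps_X ^ (i * p ^ s - P)) * fps_X ^ P"
  proof -
    have "pi * (- (of_nat (i choose P) * l ^ (p ^ s))) = - (of_nat (i choose P) * l ^ (p ^ s) * pi)"
      by simp
    then have "fps_const pi * (fps_const (- (of_nat (i choose P) * l ^ (p ^ s))) * fps_X ^ (i * p ^ s - P))
      = fps_const (- (of_nat (i choose P) * l ^ (p ^ s) * pi)) * fps_X ^ (i * p ^ s - P)"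
      by (simp only: mult.assoc[symmetric] fps_const_mult)
    moreover have "fps_nth V P = fps_const (- (of_nat (i choose P) * l ^ (p ^ s))) * fps_X ^ (i * p ^ s - P)"
      using P by (intro Vn) auto
    ultimately show ?thesis unfolding V1_def
      by (simp only: mult.assoc[symmetric] fps_const_mult)
  qed
  ultimately show ?thesis unfolding pi_def by (intro exI[of _ H]) auto
qed

end

end


section \<open>The dominant term of a divided power\<close>

lemma taylor_diff: "taylor (f - g) = taylor f - taylor g"
  using taylor_add[of f "- g"] by (simp add: taylor_uminus)

text \<open>By the condition on \<open>c\<close> the exponential has radius of convergence
  \<open>|X| = r / t^K\<close>, while \<open>H\<close> is bounded up to \<open>r / t^(K-1)\<close>.
  In coefficient \<open>q\<close> of the product of the exponential, \<open>H\<close> and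
  \<open>taylor f\<close>, the term taking all of \<open>X^q\<close> from the exponential is
  multiplication by a monomial; every other term is smaller by a factor \<open>t\<close>, so
  \<open>\<theta> = 1/t\<close>.\<close>

lemma monomial_perturbation_of_dominant_exp:
  fixes c w :: "'k::ultrametric_field" and H :: "'k fps fps"
  assumes Q: "extends_Qp p TYPE('k)" "prime p"
    and w: "absv w ^ (p - 1) = 1 / real p"
    and r: "0 < r" and t: "1 < t" and K: "1 \<le> K" and N: "1 \<le> N"
    and c: "absv c * r ^ (p ^ j * (N - 1)) = absv w * (t ^ K / r) ^ p ^ j"
    and H: "coeff_bound2 r (r / t ^ (K - 1)) 1 H" and H0: "fps_nth H 0 = 1"
    and F: "F = (exp_series oo (fps_const (fps_const c * fps_X ^ (p ^ j * (N - 1))) * fps_X ^ p ^ j)) * H"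
  shows "\<exists>q \<theta> b. 0 < q \<and> monomial_perturbation (\<lambda>f. fps_nth (F * taylor f) q) r \<theta> b ((N - 1) * q)"
proof -
  define P where "P = p ^ j"
  have p: "1 < p" using Q prime_gt_1_nat by blast
  have P: "0 < P" using p by (simp add: P_def)
  have w0: "0 < absv w"
  proof (rule ccontr)
    assume "\<not> ?thesis"
    then have "absv w = 0" using absv_nonneg[of w] by linarith
    then show False using w p by (simp add: power_0_left)
  qed
  define x where "x = t ^ K / r"
  have x: "0 < x" using t r by (simp add: x_def)
  \<comment> \<open>Terms taking nothing from the exponential lack the factor
    \<open>|w| < 1\<close>, so \<open>q\<close> must satisfy \<open>|w| t^(q-1) >= 1\<close>. The
    exponent \<open>h\<close> below ensures this through \<open>h < p^h\<close>, and
    \<open>h >= j\<close> makes \<open>q\<close> a multiple of \<open>P\<close>.\<close>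
  obtain n0 where n0: "1 / absv w < t ^ n0" using real_arch_pow[OF t] by blast
  define h where "h = max j (n0 + 1)"
  define q where "q = p ^ h"
  define \<nu> where "\<nu> = p ^ (h - j)"
  have q\<nu>: "q = P * \<nu>" by (simp add: q_def \<nu>_def P_def h_def flip: power_add)
  have q0: "0 < q" using p by (simp add: q_def)
  have "h < q" unfolding q_def using p by (intro power_gt_expt) auto
  then have "n0 \<le> q - 1" unfolding h_def by linarith
  then have "t ^ n0 \<le> t ^ (q - 1)" using t by (intro power_increasing) auto
  then have "absv w * t ^ n0 \<le> absv w * t ^ (q - 1)" using w0 by (intro mult_left_mono) auto
  moreover have "1 < absv w * t ^ n0" using n0 w0 by (simp add: field_simps)
  ultimately have qw: "1 \<le> absv w * t ^ (q - 1)" by linarith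
  define g where "g k = fps_nth (exp_series oo (fps_const (fps_const c * fps_X ^ (P * (N - 1))) * fps_X ^ P)) k" for k
  have g: "g k = (if P dvd k then fps_const (c ^ (k div P) / fact (k div P)) * fps_X ^ (P * (N - 1) * (k div P)) else 0)" for k
    using P unfolding g_def fps_compose_monom_nth[OF P]
    by (simp add: exp_series_def power_mult_distrib fps_const_power power_mult[symmetric] flip: mult.assoc)
  have cnorm: "absv (c ^ n / fact n) * r ^ (P * (N - 1) * n) = absv w ^ n / absv (fact n :: 'k) * x ^ (P * n)" for n
  proof -
    have "absv (c ^ n / fact n) * r ^ (P * (N - 1) * n) = (absv c * r ^ (P * (N - 1))) ^ n / absv (fact n :: 'k)"
      by (simp add: absv_divide absv_power power_mult_distrib power_mult)
    also have "\<dots> = absv w ^ n / absv (fact n :: 'k) * x ^ (P * n)"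
      using c by (simp add: P_def x_def power_mult_distrib power_mult)
    finally show ?thesis .
  qed
  have factpos: "0 < absv (fact n :: 'k)" for n by (intro absv_pos) simp
  \<comment> \<open>Legendre's inequality gives this bound for all \<open>k >= 1\<close>; at
    \<open>k = q\<close> it is attained, because \<open>\<nu>\<close> is a power of
    \<open>p\<close>.\<close>
  have gb: "coeff_bound r (absv w * x ^ k) (g k)" if "1 \<le> k" for k
  proof (cases "P dvd k")
    case True
    then obtain n where n: "k = P * n" by auto
    have n1: "1 \<le> n" using n that by (cases n) auto
    have "absv w ^ n / absv (fact n :: 'k) * x ^ (P * n) \<le> absv w * x ^ (P * n)"
      using power_le_absv_fact[OF Q _ w n1] factpos[of n] x by (intro mult_right_mono) (auto simp: pos_divide_le_eq)
    then have "coeff_bound r (absv w * x ^ k) (fps_const (c ^ n / fact n) * fps_X ^ (P * (N - 1) * n))"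
      using r unfolding cnorm[symmetric] n by (intro coeff_bound_monom) auto
    moreover have "g k = fps_const (c ^ n / fact n) * fps_X ^ (P * (N - 1) * n)"
      unfolding g using n P by simp
    ultimately show ?thesis by simp
  qed (use w0 x in \<open>simp add: g coeff_bound_0\<close>)
  have g0: "g 0 = 1" by (simp add: g)
  define b where "b = c ^ \<nu> / fact \<nu>"
  have gq: "g q = fps_const b * fps_X ^ ((N - 1) * q)"
    unfolding g using P by (simp add: q\<nu> b_def mult_ac)
  have bnorm: "absv b * r ^ ((N - 1) * q) = absv w * x ^ q"
  proof -
    have "absv b * r ^ ((N - 1) * q) = absv w ^ \<nu> / absv (fact \<nu> :: 'k) * x ^ q"
      using cnorm[of \<nu>] by (simp add: b_def q\<nu> mult_ac)
    also have "absv w ^ \<nu> = absv w * absv (fact \<nu> :: 'k)"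
      unfolding \<nu>_def by (rule power_eq_absv_fact_prime_power[OF Q w])
    finally show ?thesis using factpos[of \<nu>] by simp
  qed
  have b0: "b \<noteq> 0"
  proof
    assume "b = 0"
    then have "absv w * x ^ q = 0" using bnorm by simp
    then show False using w0 x by simp
  qed
  define x' where "x' = t ^ (K - 1) / r"
  have x'0: "0 < x'" using t r by (simp add: x'_def)
  have Hb: "coeff_bound r (x' ^ n) (fps_nth H n)" for n
    using H unfolding coeff_bound2_def by (simp add: x'_def power_divide)
  have tx: "x = t * x'" using K t by (cases K) (auto simp: x_def x'_def)
  \<comment> \<open>Here \<open>k\<close> is the order in \<open>X\<close> taken from the
    exponential, \<open>n - k\<close> that taken from \<open>H\<close>, and the remaining order
    \<open>q - n\<close> falls on \<open>f\<close>.\<close>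
  have small: "(if k = 0 then 1 else absv w * x ^ k) * x' ^ (n - k) * (1 / r ^ (q - n)) \<le> 1 / t * (absv w * x ^ q)"
    if kn: "k \<le> n" "n \<le> q" "(n, k) \<noteq> (q, q)" for n k
  proof -
    have rq: "x' ^ n * (1 / r ^ (q - n)) = t ^ ((K - 1) * n) / r ^ q"
    proof -
      have "r ^ q = r ^ n * r ^ (q - n)" using kn by (simp flip: power_add)
      then show ?thesis by (simp add: x'_def power_divide power_mult)
    qed
    have xk: "x ^ k * x' ^ (n - k) = t ^ k * x' ^ n"
    proof -
      have "x' ^ k * x' ^ (n - k) = x' ^ n" using kn by (simp flip: power_add)
      then show ?thesis by (simp add: tx power_mult_distrib mult.assoc)
    qed
    have xq: "1 / t * (absv w * x ^ q) = absv w * t ^ (q - 1) * (t ^ ((K - 1) * q) / r ^ q)"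
    proof -
      have "t * t ^ (q - 1) = t ^ q" using q0 by (cases q) auto
      then have "x ^ q = t * t ^ (q - 1) * x' ^ q" by (simp add: tx power_mult_distrib)
      moreover have "x' ^ q = t ^ ((K - 1) * q) / r ^ q" by (simp add: x'_def power_divide power_mult)
      ultimately show ?thesis using t by simp
    qed
    have Kn: "t ^ ((K - 1) * n) / r ^ q \<le> t ^ ((K - 1) * q) / r ^ q"
      using t kn r by (intro divide_right_mono power_increasing mult_left_mono) auto
    show ?thesis
    proof (cases "k = 0")
      case True
      have "x' ^ n * (1 / r ^ (q - n)) \<le> t ^ ((K - 1) * q) / r ^ q" unfolding rq by (rule Kn)
      also have "\<dots> \<le> absv w * t ^ (q - 1) * (t ^ ((K - 1) * q) / r ^ q)"
        using qw t r mult_right_mono[OF qw, of "t ^ ((K - 1) * q) / r ^ q"] by simp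
      finally show ?thesis using True xq by simp
    next
      case False
      have "t ^ k * (t ^ ((K - 1) * n) / r ^ q) \<le> t ^ (q - 1) * (t ^ ((K - 1) * q) / r ^ q)"
      proof (cases "k = q")
        case True
        then show ?thesis using kn by auto
      next
        case False
        then have "t ^ k \<le> t ^ (q - 1)" using kn t by (intro power_increasing) auto
        then show ?thesis using Kn t r by (intro mult_mono) auto
      qed
      then have "absv w * (t ^ k * (t ^ ((K - 1) * n) / r ^ q)) \<le> absv w * (t ^ (q - 1) * (t ^ ((K - 1) * q) / r ^ q))"
        using w0 by (intro mult_left_mono) auto
      moreover have "(absv w * x ^ k) * x' ^ (n - k) * (1 / r ^ (q - n)) = absv w * (t ^ k * (t ^ ((K - 1) * n) / r ^ q))"
      proof -
        have "(absv w * x ^ k) * x' ^ (n - k) * (1 / r ^ (q - n)) = absv w * ((x ^ k * x' ^ (n - k)) * (1 / r ^ (q - n)))"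
          by (simp only: mult.assoc)
        then show ?thesis unfolding xk rq[symmetric] by (simp only: mult.assoc)
      qed
      ultimately show ?thesis using False xq by (simp add: mult.assoc)
    qed
  qed
  have "monomial_perturbation (\<lambda>f. fps_nth (F * taylor f) q) r (1 / t) b ((N - 1) * q)"
  proof
    show "0 < r" "b \<noteq> 0" "0 \<le> 1 / t" "1 / t < 1" using r b0 t by auto
    show "fps_nth (F * taylor (f - h)) q = fps_nth (F * taylor f) q - fps_nth (F * taylor h) q" for f h
      by (simp add: taylor_diff right_diff_distrib)
    fix C and f :: "'k fps" assume f: "coeff_bound r C f"
    have C: "0 \<le> C" using f by (rule coeff_bound_nonneg)
    define T where "T n k = g k * fps_nth H (n - k) * fps_nth (taylor f) (q - n)" for n k
    have "fps_nth F n = (\<Sum>k=0..n. g k * fps_nth H (n - k))" for n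
      unfolding F fps_mult_nth g_def P_def by simp
    then have "fps_nth (F * taylor f) q = (\<Sum>n=0..q. \<Sum>k=0..n. T n k)"
      by (simp add: fps_mult_nth T_def sum_distrib_right)
    also have "{0..q} = insert q {0..<q}" by auto
    finally have "fps_nth (F * taylor f) q - fps_const b * (fps_X ^ ((N - 1) * q) * f)
        = (\<Sum>n=0..<q. \<Sum>k=0..n. T n k) + ((\<Sum>k=0..q. T q k) - T q q)"
      by (simp add: T_def gq H0 taylor_nth_0 mult.assoc)
    also have "(\<Sum>k=0..q. T q k) - T q q = (\<Sum>k=0..<q. T q k)"
      by (simp add: atLeast0AtMost atLeast0LessThan lessThan_Suc_atMost[symmetric])
    finally have eq: "fps_nth (F * taylor f) q - fps_const b * (fps_X ^ ((N - 1) * q) * f)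
        = (\<Sum>n=0..<q. \<Sum>k=0..n. T n k) + (\<Sum>k=0..<q. T q k)" .
    let ?C = "1 / t * (absv b * r ^ ((N - 1) * q)) * C"
    have TC: "coeff_bound r ?C (T n k)" if kn: "k \<le> n" "n \<le> q" "(n, k) \<noteq> (q, q)" for n k
    proof -
      have "coeff_bound r (if k = 0 then 1 else absv w * x ^ k) (g k)"
        using gb[of k] g0 coeff_bound_1[of r] by auto
      then have "coeff_bound r ((if k = 0 then 1 else absv w * x ^ k) * x' ^ (n - k) * (C / r ^ (q - n))) (T n k)"
        unfolding T_def by (intro coeff_bound_mult Hb coeff_bound_taylor_nth f r)
      moreover have "(if k = 0 then 1 else absv w * x ^ k) * x' ^ (n - k) * (C / r ^ (q - n)) \<le> ?C"
        using mult_right_mono[OF small[OF kn] C] unfolding bnorm by simp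
      ultimately show ?thesis by (rule coeff_bound_mono)
    qed
    have C0: "0 \<le> ?C" using C t r by simp
    show "coeff_bound r ?C (fps_nth (F * taylor f) q - fps_const b * (fps_X ^ ((N - 1) * q) * f))"
      unfolding eq using r C0 by (intro coeff_bound_add coeff_bound_sum TC) auto
  qed
  then show ?thesis using q0 by blast
qed


section \<open>Products of basic exponentials\<close>

lemma fps_prod_nth_0_eq_1:
  fixes f :: "'b \<Rightarrow> 'a::comm_ring_1 fps"
  shows "(\<And>i. i \<in> A \<Longrightarrow> fps_nth (f i) 0 = 1) \<Longrightarrow> fps_nth (prod f A) 0 = 1"
  by (induction A rule: infinite_finite_induct) auto

lemma eventually_power_less:
  fixes x y :: real
  assumes "x < y"
  shows "eventually (\<lambda>t. x * t ^ k < y) (at_right 1)"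
proof -
  have "((\<lambda>t. x * t ^ k) \<longlongrightarrow> x * 1 ^ k) (at_right 1)" by (intro tendsto_intros)
  then show ?thesis using assms by (intro order_tendstoD) auto
qed

text \<open>Norms become powers of \<open>t\<close>, so most estimates compare integer exponents.
  Write \<open>N_i = m i * p ^ s i\<close>, so that \<open>i p^(s i) = p^(j i) N_i\<close>. For
  critical \<open>i\<close> the term in \<open>X^(p^(j i))\<close> has norm \<open>t\<close> to the
  power \<open>p^(j i) (B N_i - N B + 1)\<close>. This is at most 1 when \<open>N_i < N\<close>, and
  equals \<open>t^P > 1\<close> for \<open>i0\<close>. By \<open>inj\<close> the maximum
  \<open>N\<close> is attained only once among the critical indices.\<close>

lemma perturbation_of_pulita_product:
  fixes \<zeta> :: "'k::ultrametric_field" and l :: "nat \<Rightarrow> 'k" and z :: "nat \<Rightarrow> 'k" and m j s :: "nat \<Rightarrow> nat"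
  assumes Q: "extends_Qp p TYPE('k)" "prime p"
    and I: "finite I" "\<And>i. i \<in> I \<Longrightarrow> l i \<noteq> 0" "\<And>i. i \<in> I \<Longrightarrow> 0 < i"
    and m: "\<And>i. i \<in> I \<Longrightarrow> i = m i * p ^ j i" "\<And>i. i \<in> I \<Longrightarrow> \<not> p dvd m i"
    and sD: "\<And>i. i \<in> I \<Longrightarrow> i * p ^ s i \<le> D"
    and inj: "inj_on (\<lambda>i. m i * p ^ s i) I"
    and z: "\<And>i. i \<in> I \<Longrightarrow> z i ^ p ^ s i = \<zeta>" and \<zeta>: "\<zeta> ^ p = 1" "\<zeta> \<noteq> 1"
    and r0: "0 < r0" "\<And>i. i \<in> I \<Longrightarrow> absv (l i) * r0 ^ i \<le> 1"
    and i0: "i0 \<in> I" "absv (l i0) * r0 ^ i0 = 1"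
      "\<And>i. i \<in> I \<Longrightarrow> absv (l i) * r0 ^ i = 1 \<Longrightarrow> m i * p ^ s i \<le> m i0 * p ^ s i0"
    and e: "e = (\<Prod>i\<in>I. pulita_exp p (z i) oo (fps_const (l i) * fps_X ^ i))"
  shows "\<exists>R>r0. \<forall>r. r0 < r \<and> r \<le> R \<longrightarrow> (\<exists>q \<theta> b. 0 < q \<and>
     monomial_perturbation (\<lambda>f. fps_nth (taylor_twist e * taylor f) q) r \<theta> b ((m i0 * p ^ s i0 - 1) * q))"
proof -
  have p: "1 < p" using Q prime_gt_1_nat by blast
  \<comment> \<open>With \<open>|T| = r\<^sub>0 t\<^sup>B\<close>, the dominant factor has radius of convergence \<open>|X/T| = t\<^bsup>-NB\<^esup>\<close>. The
    radius \<open>|X/T| = t\<^bsup>-(NB-1)\<^esup>\<close> used below is a little larger; \<open>B > D\<close> leaves room for all others.\<close>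
  define B where "B = D + 1"
  define N where "N = m i0 * p ^ s i0"
  have "0 < m i0" using m(2)[OF i0(1)] by (cases "m i0") auto
  then have N: "1 \<le> N" using p by (simp add: N_def Suc_le_eq)
  have D: "1 \<le> D" using sD[OF i0(1)] I(3)[OF i0(1)] p by (metis One_nat_def Suc_leI less_le_trans nat_0_less_mult_iff zero_less_power prime_gt_0_nat[OF Q(2)])
  have B: "2 \<le> B" using D by (simp add: B_def)
  define J where "J = {i \<in> I. absv (l i) * r0 ^ i < 1}"
  \<comment> \<open>Noncritical factors satisfy a strict inequality at \<open>r0\<close> that
    persists for \<open>t\<close> near 1. The bound \<open>t^(B D) < p\<close> makes the gain
    \<open>1/p\<close> from binomial coefficients outweigh \<open>y i ^ p ^ s i\<close> at critical
    indices.\<close>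
  have "eventually (\<lambda>t. \<forall>i\<in>J. absv (l i) * r0 ^ i * t ^ (B * i) < 1) (at_right 1)"
    using I(1) by (intro eventually_ball_finite ballI eventually_power_less) (auto simp: J_def)
  moreover have "eventually (\<lambda>t. 1 * t ^ (B * D) < real p) (at_right 1)"
    using p by (intro eventually_power_less) auto
  ultimately have "eventually (\<lambda>t. (\<forall>i\<in>J. absv (l i) * r0 ^ i * t ^ (B * i) < 1) \<and> t ^ (B * D) < real p) (at_right 1)"
    by eventually_elim auto
  then obtain t1 where t1: "1 < t1" and near: "\<And>t. 1 < t \<Longrightarrow> t < t1 \<Longrightarrow>
      (\<forall>i\<in>J. absv (l i) * r0 ^ i * t ^ (B * i) < 1) \<and> t ^ (B * D) < real p"
    unfolding eventually_at_right_field by auto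
  define t2 where "t2 = (1 + t1) / 2"
  have t2: "1 < t2" "t2 < t1" using t1 by (auto simp: t2_def)
  have B0: "0 < B" using B by simp
  show ?thesis
  proof (intro exI[of _ "r0 * t2 ^ B"] conjI allI impI)
    show "r0 < r0 * t2 ^ B" using r0(1) t2 B by (simp add: one_less_power)
  next
    fix r assume r: "r0 < r \<and> r \<le> r0 * t2 ^ B"
    define t where "t = root B (r / r0)"
    have tB: "t ^ B = r / r0" unfolding t_def using r r0(1) B0 by (intro real_root_pow_pos2) auto
    have t: "1 < t" unfolding t_def using r r0(1) B0 by simp
    have "t \<le> t2"
    proof (rule ccontr)
      assume "\<not> t \<le> t2"
      then have "t2 ^ B < t ^ B" using t2 B0 by (intro power_strict_mono) auto
      then show False using tB r r0(1) by (simp add: field_simps)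
    qed
    then have "t < t1" using t2 by simp
    note near_t = near[OF t this]
    have rt: "r = r0 * t ^ B" using tB r0(1) by simp
    have rpos: "0 < r" using r r0(1) by simp
    define E where "E = N * B - 1"
    have NB: "2 \<le> N * B" using N B by (metis mult_le_mono nat_mult_1 one_le_numeral)
    define u where "u = 1 / t ^ E"
    have u: "0 < u" "u \<le> 1" using t by (auto simp: u_def)
    define y where "y i = absv (l i) * r ^ i" for i
    \<comment> \<open>The first entry bounds the terms whose index is a multiple of
      \<open>p^(j i)\<close>, the second those whose binomial coefficient is divisible by
      \<open>p\<close>.\<close>
    define w where "w i = max (u ^ p ^ j i) (u / real p)" for i
    have w: "0 < w i" "w i \<le> 1" for i
      using u p by (auto simp: w_def intro: power_le_one simp: less_max_iff_disj divide_le_eq)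
    have y: "y i = absv (l i) * r0 ^ i * t ^ (B * i)" for i
      by (simp add: y_def rt power_mult_distrib power_mult)
    have bin: "absv (of_nat (i choose n) :: 'k) * u ^ n \<le> w i" if i: "i \<in> I" and n: "1 \<le> n" "n \<le> i" for i n
    proof (cases "p ^ j i dvd n")
      case True
      then have "p ^ j i \<le> n" using n by (intro dvd_imp_le) auto
      then have "u ^ n \<le> u ^ p ^ j i" using u by (intro power_decreasing) auto
      then have "absv (of_nat (i choose n) :: 'k) * u ^ n \<le> 1 * u ^ p ^ j i"
        using u by (intro mult_mono absv_of_nat_le_1) auto
      then show ?thesis by (simp add: w_def)
    next
      case False
      have "u ^ n \<le> u ^ 1" using n u by (intro power_decreasing) auto
      moreover have "absv (of_nat (i choose n) :: 'k) \<le> 1 / real p"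
        using absv_binomial_le[OF Q _ False, of "m i"] n m(1)[OF i] by simp
      ultimately have "absv (of_nat (i choose n) :: 'k) * u ^ n \<le> 1 / real p * u ^ 1"
        using u by (intro mult_mono) auto
      then show ?thesis by (simp add: w_def)
    qed
    have crit: "y i = t ^ (B * i)" if "i \<in> I" "i \<notin> J" for i
      using that r0(2)[of i] by (simp add: J_def y)
    have iN: "i * p ^ s i = p ^ j i * (m i * p ^ s i)" if "i \<in> I" for i
      using m(1)[OF that] by (metis mult.assoc mult.commute)
    have ypow: "y i ^ p ^ s i = t ^ (B * (i * p ^ s i))" if "i \<in> I" "i \<notin> J" for i
      using crit[OF that] by (simp add: mult.assoc flip: power_mult)
    have ysmall: "y i ^ p ^ s i \<le> real p" if "i \<in> I" "i \<notin> J" for i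
    proof -
      have "t ^ (B * (i * p ^ s i)) \<le> t ^ (B * D)"
        using t sD[OF that(1)] by (intro power_increasing mult_left_mono) auto
      then show ?thesis using near_t ypow[OF that] by simp
    qed
    have y1: "1 \<le> y i" if "i \<in> I" "i \<notin> J" for i using crit[OF that] t by simp
    have tE: "t ^ a * u ^ b \<le> 1" if "a \<le> E * b" for a b
    proof -
      have "t ^ a \<le> t ^ (E * b)" using that t by (intro power_increasing) auto
      then show ?thesis using t by (simp add: u_def power_divide power_mult)
    qed
    have i0J: "i0 \<notin> J" using i0 by (simp add: J_def)
    have z1: "z i ^ p ^ (s i + 1) = 1" if "i \<in> I" for i
      using z[OF that] \<zeta>(1) by (simp add: power_mult mult.commute[of p])
    have minor: "max 1 (y i) ^ p ^ s i * w i \<le> 1" if i: "i \<in> I" "i \<noteq> i0" for i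
    proof (cases "i \<in> J")
      case True
      then have "y i \<le> 1" using near_t by (auto simp: y less_imp_le)
      then show ?thesis using w by simp
    next
      case False
      have "m i * p ^ s i \<noteq> N" using inj i i0(1) by (auto simp: N_def inj_on_def)
      moreover have "m i * p ^ s i \<le> N"
        unfolding N_def using i0(3)[OF i(1)] r0(2)[OF i(1)] False i(1) by (simp add: J_def)
      ultimately have "m i * p ^ s i + 1 \<le> N" by simp
      then have "B * (m i * p ^ s i + 1) \<le> B * N" by (intro mult_left_mono) auto
      then have "B * (m i * p ^ s i) \<le> E" using B by (simp add: E_def mult.commute[of N] algebra_simps)
      then have "B * (m i * p ^ s i) * p ^ j i \<le> E * p ^ j i" by (rule mult_le_mono1)
      then have "B * (i * p ^ s i) \<le> E * p ^ j i" unfolding iN[OF i(1)] by (simp only: mult_ac)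
      then have "y i ^ p ^ s i * u ^ p ^ j i \<le> 1" unfolding ypow[OF i(1) False] by (rule tE)
      moreover have "y i ^ p ^ s i * (u / real p) \<le> 1"
      proof -
        have "y i ^ p ^ s i * u \<le> real p * 1" using ysmall[OF i(1) False] u y1[OF i(1) False] by (intro mult_mono) auto
        then show ?thesis using p by (simp add: field_simps)
      qed
      ultimately have "y i ^ p ^ s i * w i \<le> 1" unfolding w_def by (auto simp: max_def)
      then show ?thesis using y1[OF i(1) False] by (simp add: max_def)
    qed
    have others: "coeff_bound2 r (r * u) 1 (taylor_twist (pulita_exp p (z i) oo (fps_const (l i) * fps_X ^ i)))"
      if i: "i \<in> I" "i \<noteq> i0" for i
      using coeff_bound2_twist_minor[OF Q z1[OF i(1)] I(3)[OF i(1)] I(2)[OF i(1)] rpos u(1) y_def w(1) bin[OF i(1)] minor[OF i]] .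
    define P where "P = p ^ j i0"
    have P: "0 < P" "P \<le> i0" using p m(1)[OF i0(1)] \<open>0 < m i0\<close> by (auto simp: P_def) (metis le_square mult.commute mult_le_mono2 nat_le_linear One_nat_def Suc_leI mult_1)
    have i0N: "i0 * p ^ s i0 = P * N" using iN[OF i0(1)] by (simp add: P_def N_def)
    have "i0 \<le> D" using sD[OF i0(1)] p by (metis One_nat_def Suc_leI le_trans mult.right_neutral mult_le_mono2 zero_less_power prime_gt_0_nat[OF Q(2)])
    \<comment> \<open>Squaring \<open>w\<close> doubles the exponent of \<open>u\<close>;
      \<open>N B P \<le> 2 P (N B - 1)\<close> holds because \<open>N B >= 2\<close>.\<close>
    have half: "max 1 (y i0) ^ p ^ s i0 * w i0 ^ 2 \<le> 1"
    proof -
      have "2 * P \<le> N * B * P" using NB by (rule mult_le_mono1)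
      moreover have "N * B * (2 * P) = N * B * P + N * B * P" by simp
      moreover have "E * (2 * P) = N * B * (2 * P) - 2 * P" by (simp add: E_def diff_mult_distrib)
      ultimately have "N * B * P \<le> E * (2 * P)" by linarith
      then have "B * (i0 * p ^ s i0) \<le> E * (2 * P)" unfolding i0N by (simp add: mult_ac)
      then have "y i0 ^ p ^ s i0 * u ^ (2 * P) \<le> 1" unfolding ypow[OF i0(1) i0J] by (rule tE)
      then have "y i0 ^ p ^ s i0 * (u ^ P) ^ 2 \<le> 1" by (simp add: mult.commute flip: power_mult)
      moreover have "y i0 ^ p ^ s i0 * (u / real p) ^ 2 \<le> 1"
      proof -
        have "(u / real p) ^ 2 \<le> (u / real p) ^ 1" using u p by (intro power_decreasing) (auto simp: divide_le_eq)
        moreover have "u / real p \<le> 1 / real p" using u by (intro divide_right_mono) auto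
        ultimately have "(u / real p) ^ 2 \<le> 1 / real p" by simp
        then have "y i0 ^ p ^ s i0 * (u / real p) ^ 2 \<le> real p * (1 / real p)"
          using ysmall[OF i0(1) i0J] u y1[OF i0(1) i0J] p by (intro mult_mono) auto
        then show ?thesis using p by simp
      qed
      ultimately have "y i0 ^ p ^ s i0 * w i0 ^ 2 \<le> 1" unfolding w_def P_def by (auto simp: max_def)
      then show ?thesis using y1[OF i0(1) i0J] by (simp add: max_def)
    qed
    have rest: "y i0 ^ p ^ s i0 * (absv (of_nat (i0 choose n) :: 'k) * u ^ n) \<le> 1" if n: "1 \<le> n" "n \<le> i0" "n \<noteq> P" for n
    proof (cases "P dvd n")
      case True
      then have "P + 1 \<le> n" using n dvd_imp_le[OF True] by auto
      then have "E * (P + 1) \<le> E * n" by (rule mult_le_mono2)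
      \<comment> \<open>The choice \<open>B = D + 1\<close> is made for this: since
        \<open>P \<le> i0 \<le> D\<close>, even the multiples of \<open>P\<close> next after
        \<open>P\<close> itself stay below the dominant term.\<close>
      moreover have "P + 1 \<le> N * B"
      proof -
        have "P + 1 \<le> B" using P(2) \<open>i0 \<le> D\<close> by (simp add: B_def)
        also have "B \<le> N * B" using N by simp
        finally show ?thesis .
      qed
      then have "N * B * P \<le> E * (P + 1)" by (simp add: E_def diff_mult_distrib algebra_simps)
      ultimately have "B * (i0 * p ^ s i0) \<le> E * n" unfolding i0N by (simp add: mult_ac)
      then have "y i0 ^ p ^ s i0 * u ^ n \<le> 1" unfolding ypow[OF i0(1) i0J] by (rule tE)
      moreover have "absv (of_nat (i0 choose n) :: 'k) * u ^ n \<le> 1 * u ^ n"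
        using u by (intro mult_right_mono absv_of_nat_le_1) auto
      ultimately show ?thesis using y1[OF i0(1) i0J]
        by (smt (verit) mult_left_mono zero_le_power)
    next
      case False
      have "absv (of_nat (i0 choose n) :: 'k) \<le> 1 / real p"
        using absv_binomial_le[OF Q _ False[unfolded P_def], of "m i0"] n m(1)[OF i0(1)] by simp
      then have "absv (of_nat (i0 choose n) :: 'k) * u ^ n \<le> 1 / real p * 1"
        using u by (intro mult_mono power_le_one) auto
      then have "y i0 ^ p ^ s i0 * (absv (of_nat (i0 choose n) :: 'k) * u ^ n) \<le> real p * (1 / real p * 1)"
        using u by (intro mult_mono[OF ysmall[OF i0(1) i0J]]) auto
      then show ?thesis using p by simp
    qed
    define \<pi> where "\<pi> = \<zeta> - 1"
    have \<pi>: "absv \<pi> ^ (p - 1) = 1 / real p" unfolding \<pi>_def by (rule absv_root_of_unity_minus_1[OF Q \<zeta>])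
    have \<pi>1: "absv \<pi> \<le> 1"
      using absv_diff[of \<zeta> 1] absv_root_of_unity[OF \<zeta>(1)] p by (simp add: \<pi>_def)
    have fact: "absv (\<pi> ^ n / fact n) \<le> 1" for n
    proof (cases "n = 0")
      case False
      have "absv \<pi> ^ n \<le> absv \<pi> * absv (fact n :: 'k)"
        using power_le_absv_fact[OF Q _ \<pi>, of n] False by simp
      also have "\<dots> \<le> 1 * absv (fact n :: 'k)" using \<pi>1 by (intro mult_right_mono) auto
      finally show ?thesis using absv_pos[of "fact n :: 'k"] by (simp add: absv_divide absv_power)
    qed simp
    have z\<pi>: "z i0 ^ p ^ s i0 - 1 = \<pi>" using z[OF i0(1)] by (simp add: \<pi>_def)
    define c where "c = - (of_nat (i0 choose P) * l i0 ^ p ^ s i0 * \<pi>)"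
    obtain H0 where H0: "taylor_twist (pulita_exp p (z i0) oo (fps_const (l i0) * fps_X ^ i0)) =
        (exp_series oo (fps_const (fps_const c * fps_X ^ (i0 * p ^ s i0 - P)) * fps_X ^ P)) * H0"
      "coeff_bound2 r (r * u) 1 H0" "fps_nth H0 0 = 1"
      using twist_major_factorization[OF Q z1[OF i0(1)] I(3)[OF i0(1)] I(2)[OF i0(1)] rpos u(1) y_def w(1) bin[OF i0(1)]
          half P rest] fact unfolding z\<pi> c_def by blast
    define H where "H = H0 * (\<Prod>i\<in>I - {i0}. taylor_twist (pulita_exp p (z i) oo (fps_const (l i) * fps_X ^ i)))"
    have ru: "0 < r * u" using rpos u by simp
    have "coeff_bound2 r (r * u) (1 * 1) H" unfolding H_def
      using I(1) others by (intro coeff_bound2_mult H0 coeff_bound2_prod rpos ru) auto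
    then have H: "coeff_bound2 r (r / t ^ (N * B - 1)) 1 H" by (simp add: u_def E_def)
    have twist0: "fps_nth (taylor_twist f) 0 = 1" if "fps_nth f 0 = 1" for f :: "'k fps"
      using that by (simp add: taylor_twist_def taylor_nth_0 inverse_mult_eq_1')
    have "fps_nth (pulita_exp p (z i) oo (fps_const (l i) * fps_X ^ i)) 0 = 1" for i
      using log_deriv_ode_0[OF log_deriv_ode_pulita_exp] by simp
    then have "fps_nth (\<Prod>i\<in>I - {i0}. taylor_twist (pulita_exp p (z i) oo (fps_const (l i) * fps_X ^ i))) 0 = 1"
      by (intro fps_prod_nth_0_eq_1 twist0)
    then have Hnth: "fps_nth H 0 = 1" using H0(3) by (simp add: H_def)
    have eH: "taylor_twist e = (exp_series oo (fps_const (fps_const c * fps_X ^ (P * (N - 1))) * fps_X ^ P)) * H"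
    proof -
      have "taylor_twist e = taylor_twist (pulita_exp p (z i0) oo (fps_const (l i0) * fps_X ^ i0)) *
         (\<Prod>i\<in>I - {i0}. taylor_twist (pulita_exp p (z i) oo (fps_const (l i) * fps_X ^ i)))"
        unfolding e taylor_twist_prod[OF I(1)] by (rule prod.remove[OF I(1) i0(1)])
      moreover have "i0 * p ^ s i0 - P = P * (N - 1)" unfolding i0N by (simp add: diff_mult_distrib2)
      ultimately show ?thesis unfolding H0(1) H_def by (simp add: mult.assoc)
    qed
    have cn: "absv c * r ^ (P * (N - 1)) = absv \<pi> * (t ^ (N * B) / r) ^ P"
    proof -
      have "absv (of_nat (i0 choose P) :: 'k) = 1"
        using absv_binomial_prime_power[OF Q m(2)[OF i0(1)], of "j i0"] m(1)[OF i0(1)] by (simp add: P_def)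
      then have 1: "absv c * r ^ (P * (N - 1)) = absv \<pi> * (absv (l i0) ^ p ^ s i0 * r ^ (P * (N - 1)))"
        by (simp add: c_def absv_mult absv_power)
      have "r ^ (P * (N - 1)) = r ^ (P * N) / r ^ P"
        using N rpos by (simp add: diff_mult_distrib2 power_diff)
      then have "absv (l i0) ^ p ^ s i0 * r ^ (P * (N - 1)) = y i0 ^ p ^ s i0 / r ^ P"
        by (simp add: y_def power_mult_distrib flip: i0N power_mult)
      also have "\<dots> = (t ^ (N * B) / r) ^ P"
        unfolding ypow[OF i0(1) i0J] i0N by (simp add: power_divide mult_ac flip: power_mult)
      finally show ?thesis unfolding 1 by simp
    qed
    show "\<exists>q \<theta> b. 0 < q \<and> monomial_perturbation (\<lambda>f. fps_nth (taylor_twist e * taylor f) q) r \<theta> b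
        ((m i0 * p ^ s i0 - 1) * q)"
      using monomial_perturbation_of_dominant_exp[OF Q \<pi> rpos t order_trans[OF one_le_numeral NB] N
          cn[unfolded P_def] H Hnth eH[unfolded P_def]]
      unfolding N_def .
  qed
qed


section \<open>The logarithmic indices\<close>

lemma log_idx_bounds:
  assumes p: "1 < p" and i: "1 \<le> i" "i \<le> D"
  shows "i * p ^ log_idx p D i \<le> D" "D < i * p ^ (log_idx p D i + 1)"
proof -
  define x where "x = real D / real i"
  define d where "d = log_idx p D i"
  have x: "1 \<le> x" using i by (simp add: x_def)
  have "0 \<le> log (real p) x" using x p by simp
  then have d: "real d = of_int \<lfloor>log (real p) x\<rfloor>" unfolding d_def log_idx_def x_def[symmetric] by simp
  have "real d \<le> log (real p) x" "log (real p) x < real (d + 1)" using d by linarith+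
  then have "real p powr real d \<le> x" "x < real p powr real (d + 1)"
    using p x by (simp_all add: le_log_iff log_less_iff)
  then have "real p ^ d \<le> x" "x < real p ^ (d + 1)" using p by (simp_all only: powr_realpow)
  then have "real i * real p ^ d \<le> real D" "real D < real i * real p ^ (d + 1)"
    using i by (simp_all add: x_def field_simps)
  then show "i * p ^ log_idx p D i \<le> D" "D < i * p ^ (log_idx p D i + 1)"
    unfolding d_def by (metis of_nat_le_iff of_nat_mult of_nat_power, metis of_nat_less_iff of_nat_mult of_nat_power)
qed

lemma log_idx_eqI:
  assumes p: "1 < p" and i: "1 \<le> i" and k: "i * p ^ k \<le> D" "D < i * p ^ (k + 1)"
  shows "log_idx p D i = k"
proof -
  have "1 \<le> p ^ k" using p by simp
  then have "i \<le> D" using k(1) by (metis le_trans mult.right_neutral mult_le_mono2)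
  note b = log_idx_bounds[OF p i this]
  have "i * p ^ log_idx p D i < i * p ^ (k + 1)" "i * p ^ k < i * p ^ (log_idx p D i + 1)"
    using b k by linarith+
  then have "p ^ log_idx p D i < p ^ (k + 1)" "p ^ k < p ^ (log_idx p D i + 1)" by simp_all
  then have "log_idx p D i < k + 1" "k < log_idx p D i + 1" using p power_less_imp_less_exp by blast+
  then show ?thesis by simp
qed

lemma log_idx_mult:
  assumes p: "1 < p" and i: "1 \<le> i" "i * p ^ k \<le> D"
  shows "k \<le> log_idx p D i" "log_idx p D (i * p ^ k) = log_idx p D i - k"
proof -
  have "1 \<le> p ^ k" using p by simp
  then have "i \<le> D" using i(2) by (metis le_trans mult.right_neutral mult_le_mono2)
  note b = log_idx_bounds[OF p i(1) this]
  have "i * p ^ k < i * p ^ (log_idx p D i + 1)" using b i(2) by linarith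
  then have "p ^ k < p ^ (log_idx p D i + 1)" by simp
  then have "k < log_idx p D i + 1" using p power_less_imp_less_exp by blast
  then show k: "k \<le> log_idx p D i" by simp
  then have eq: "log_idx p D i = k + (log_idx p D i - k)" by simp
  have c: "i * p ^ k * p ^ (log_idx p D i - k) = i * p ^ log_idx p D i"
    by (subst (2) eq) (simp only: power_add mult.assoc)
  have c': "i * p ^ k * p ^ (log_idx p D i - k + 1) = i * p ^ (log_idx p D i + 1)"
    by (simp only: power_add[of p _ 1] mult.assoc[symmetric] c)
  show "log_idx p D (i * p ^ k) = log_idx p D i - k"
  proof (rule log_idx_eqI[OF p])
    show "1 \<le> i * p ^ k" using i(1) p by (simp add: Suc_le_eq)
  qed (unfold c c', rule b(1), rule b(2))
qed

lemma log_idx_div: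
  assumes p: "1 < p" and n: "1 \<le> n" "n \<le> D" and k: "p ^ k dvd n"
  shows "log_idx p D n = log_idx p D (n div p ^ k) - k" "k \<le> log_idx p D (n div p ^ k)"
proof -
  have "n = (n div p ^ k) * p ^ k" "1 \<le> n div p ^ k"
    using n k p by (auto simp: Suc_le_eq div_greater_zero_iff dvd_imp_le)
  then show "log_idx p D n = log_idx p D (n div p ^ k) - k" "k \<le> log_idx p D (n div p ^ k)"
    using log_idx_mult[OF p, of "n div p ^ k" k D] n by auto
qed

lemma log_idx_le_1:
  assumes p: "1 < p" and n: "1 \<le> n" "n \<le> D"
  shows "log_idx p D n \<le> log_idx p D 1"
proof -
  have "1 * p ^ log_idx p D n \<le> n * p ^ log_idx p D n" using n by simp
  also have "\<dots> \<le> D" by (rule log_idx_bounds[OF p n])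
  finally show ?thesis using log_idx_mult(1)[OF p, of 1] by simp
qed


section \<open>Factorization into basic exponentials\<close>

text \<open>The vector with ghost components
  \<open>g n = \<Sum>\<^sub>k (witt_coord p g (n / p\<^sup>k))\<^bsup>p\<^sup>k\<^esup> / p\<^sup>k\<close>.\<close>

function witt_coord :: "nat \<Rightarrow> (nat \<Rightarrow> 'a::field_char_0) \<Rightarrow> nat \<Rightarrow> 'a" where
  "witt_coord p g n = g n - (\<Sum>k\<in>{k. 1 \<le> k \<and> k \<le> n \<and> p ^ k dvd n \<and> 0 < n \<and> 1 < p}.
      witt_coord p g (n div p ^ k) ^ (p ^ k) / of_nat (p ^ k))"
  by auto
termination
\<comment> \<open>The conditions \<open>0 < n\<close> and \<open>1 < p\<close> inside the summation
  set make \<open>n div p ^ k\<close> smaller than \<open>n\<close> for arbitrary arguments.\<close>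
proof (relation "Wellfounded.measure (\<lambda>(p, g, n). n)", goal_cases)
  case (2 p g n k)
  then have "1 < p ^ k" using one_less_power[of p k] by auto
  then show ?case using 2 by simp
qed simp

declare witt_coord.simps [simp del]

lemma ghost_witt_coord:
  assumes "1 < p" "0 < n"
  shows "g n = (\<Sum>k\<in>{k. k \<le> n \<and> p ^ k dvd n}. witt_coord p g (n div p ^ k) ^ (p ^ k) / of_nat (p ^ k))"
proof -
  have "{k. k \<le> n \<and> p ^ k dvd n} = insert 0 {k. 1 \<le> k \<and> k \<le> n \<and> p ^ k dvd n \<and> 0 < n \<and> 1 < p}"
    using assms by (auto simp: Suc_le_eq)
  then show ?thesis by (simp add: witt_coord.simps[of p g n])
qed

lemma sum_over_prime_power_divisors:
  assumes p: "1 < p" and N: "0 < N" and S: "finite S" "\<And>k. p ^ k dvd N \<Longrightarrow> N div p ^ k \<in> S"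
  shows "(\<Sum>i\<in>S. if \<exists>k. N = i * p ^ k then f i else 0) = (\<Sum>k\<in>{k. k \<le> N \<and> p ^ k dvd N}. f (N div p ^ k))"
proof -
  have "(\<Sum>i\<in>S. if \<exists>k. N = i * p ^ k then f i else 0) = sum f {i \<in> S. \<exists>k. N = i * p ^ k}"
    using S(1) by (simp add: sum.inter_filter)
  also have "{i \<in> S. \<exists>k. N = i * p ^ k} = (\<lambda>k. N div p ^ k) ` {k. k \<le> N \<and> p ^ k dvd N}"
  proof (intro equalityI subsetI)
    fix i assume "i \<in> {i \<in> S. \<exists>k. N = i * p ^ k}"
    then obtain k where k: "N = i * p ^ k" by auto
    have "k < p ^ k" using p by (intro power_gt_expt) simp
    also have "p ^ k \<le> N" using k N by (cases i) auto
    finally show "i \<in> (\<lambda>k. N div p ^ k) ` {k. k \<le> N \<and> p ^ k dvd N}"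
      using k p by (intro image_eqI[of _ _ k]) auto
  next
    fix i assume "i \<in> (\<lambda>k. N div p ^ k) ` {k. k \<le> N \<and> p ^ k dvd N}"
    then obtain k where "i = N div p ^ k" "p ^ k dvd N" by auto
    then show "i \<in> {i \<in> S. \<exists>k. N = i * p ^ k}" using S(2) by (auto intro!: exI[of _ k])
  qed
  also have "sum f \<dots> = (\<Sum>k\<in>{k. k \<le> N \<and> p ^ k dvd N}. f (N div p ^ k))"
  proof (rule sum.reindex_cong[OF _ refl refl], rule inj_onI)
    fix k k' assume *: "k \<in> {k. k \<le> N \<and> p ^ k dvd N}" "k' \<in> {k. k \<le> N \<and> p ^ k dvd N}" "N div p ^ k = N div p ^ k'"
    then have "N div p ^ k * p ^ k = N div p ^ k * p ^ k'" by (metis (mono_tags, lifting) dvd_div_mult_self mem_Collect_eq)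
    moreover have "0 < N div p ^ k" using * N by (auto simp: div_greater_zero_iff dvd_imp_le)
    ultimately have "p ^ k = p ^ k'" by simp
    then show "k = k'" using p power_inject_exp by blast
  qed
  finally show ?thesis .
qed

text \<open>The function \<open>h\<close> is 1 for the Artin-Hasse exponential and
  \<open>z^n - 1\<close> for \<open>pulita_exp\<close>, so one computation serves both
  factorizations.\<close>

lemma monom_substitution_log_deriv_nth:
  fixes l :: "'a::field_char_0"
  assumes p: "1 < p" and i: "0 < i" and L: "\<And>n. fps_nth L n = (if \<exists>k. n + 1 = p ^ k then h (n + 1) else 0)"
  shows "fps_nth ((L oo (fps_const l * fps_X ^ i)) * fps_deriv (fps_const l * fps_X ^ i)) n
     = (if \<exists>k. n + 1 = i * p ^ k then of_nat i * h ((n + 1) div i) * l ^ ((n + 1) div i) else 0)"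
proof -
  let ?m = "fps_const l * fps_X ^ i :: 'a fps"
  have "fps_deriv ?m = fps_const (of_nat i * l) * fps_X ^ (i - 1)"
    by (rule fps_ext) (use i in \<open>auto simp del: of_nat_Suc\<close>)
  then have "(L oo ?m) * fps_deriv ?m = fps_const (of_nat i * l) * (fps_X ^ (i - 1) * (L oo ?m))"
    by (simp only: mult_ac)
  then have "fps_nth ((L oo ?m) * fps_deriv ?m) n = of_nat i * l * fps_nth (fps_X ^ (i - 1) * (L oo ?m)) n"
    by (simp only: fps_mult_left_const_nth)
  also have "\<dots> = of_nat i * l * (if n < i - 1 then 0 else if i dvd n - (i - 1)
      then fps_nth L ((n - (i - 1)) div i) * l ^ ((n - (i - 1)) div i) else 0)"
    using i by (simp add: fps_X_power_mult_nth fps_compose_monom_nth)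
  also have "\<dots> = (if \<exists>k. n + 1 = i * p ^ k then of_nat i * h ((n + 1) div i) * l ^ ((n + 1) div i) else 0)"
  proof (cases "i dvd n + 1")
    case True
    then obtain q where q: "n + 1 = i * q" by auto
    then have "0 < q" by (cases q) auto
    then obtain q' where q': "q = q' + 1" by (metis Suc_eq_plus1 gr0_conv_Suc)
    have "n - (i - 1) = i * q'" "\<not> n < i - 1" using q q' i by auto
    moreover have "(\<exists>k. n + 1 = i * p ^ k) \<longleftrightarrow> (\<exists>k. q' + 1 = p ^ k)" using q q' i by (metis mult_left_cancel less_not_refl)
    moreover have "(n + 1) div i = q' + 1" using q q' i by simp
    ultimately show ?thesis using i L[of q'] by (simp add: power_add del: One_nat_def)
  next
    case False
    then have "\<not> (\<exists>k. n + 1 = i * p ^ k)" by (metis dvd_triv_left)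
    moreover have "\<not> i dvd n - (i - 1)" if "\<not> n < i - 1"
    proof
      assume "i dvd n - (i - 1)"
      then have "i dvd (n - (i - 1)) + i" by simp
      moreover have "(n - (i - 1)) + i = n + 1" using that i by simp
      ultimately show False using False by simp
    qed
    ultimately show ?thesis by simp
  qed
  finally show ?thesis .
qed

section \<open>The coordinates attached to a given equation\<close>

locale exponential_equation =
  fixes p D :: nat and \<zeta> :: "'k::ultrametric_field" and P :: "'k poly"
  assumes Q: "extends_Qp p TYPE('k)" "prime p" and D: "1 \<le> D"
    and prim: "primitive_root_of_unity (p ^ (log_idx p D 1 + 1)) \<zeta>"
    and P0: "coeff P 0 = 0" and deg: "degree P \<le> D"
begin

lemma p_gt_1: "1 < p"
  using Q prime_gt_1_nat by blast

text \<open>For \<open>1 \<le> i \<le> D\<close> a root of unity of order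
  \<open>p^(d_i + 1)\<close>, so that the logarithm of its exponential in \<open>T^i\<close> ends at
  \<open>T^(i p^(d_i))\<close>, the last such power of degree at most \<open>D\<close>.\<close>

definition zeta_at :: "nat \<Rightarrow> 'k" where
  "zeta_at i = \<zeta> ^ (p ^ (log_idx p D 1 - log_idx p D i))"

text \<open>For \<open>N = i p^k \<le> D\<close> the number \<open>zeta_at i ^ p ^ k - 1\<close> is
  \<open>\<pi>_(d_N)\<close>, which depends on \<open>N\<close> alone. After division by it, the
  coefficients of \<open>P\<close> must be the ghost components of the wanted vector.\<close>

definition lam :: "nat \<Rightarrow> 'k" where
  "lam = witt_coord p (\<lambda>n. coeff P n / pi_elt p D \<zeta> (log_idx p D n))"

lemma zeta_top_power: "(\<zeta> ^ p ^ log_idx p D 1) ^ p = 1"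
  using prim unfolding primitive_root_of_unity_def by (simp only: power_add power_one_right power_mult)

lemma zeta_at_power:
  assumes "1 \<le> i" "i \<le> D"
  shows "zeta_at i ^ p ^ log_idx p D i = \<zeta> ^ p ^ log_idx p D 1"
proof -
  have "log_idx p D 1 = (log_idx p D 1 - log_idx p D i) + log_idx p D i"
    using log_idx_le_1[OF p_gt_1 assms] by simp
  then show ?thesis unfolding zeta_at_def by (metis power_add power_mult)
qed

lemma zeta_at_order:
  assumes "1 \<le> i" "i \<le> D" "log_idx p D i < k"
  shows "zeta_at i ^ p ^ k = 1"
proof -
  define e where "e = k - log_idx p D i - 1"
  have "k = log_idx p D i + (1 + e)" using assms by (simp add: e_def)
  then have "p ^ k = p ^ log_idx p D i * (p * p ^ e)" by (simp only: power_add power_one_right)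
  then have "zeta_at i ^ p ^ k = ((\<zeta> ^ p ^ log_idx p D 1) ^ p) ^ p ^ e"
    by (simp only: power_mult zeta_at_power[OF assms(1,2)])
  then show ?thesis by (simp only: zeta_top_power power_one)
qed

lemma pi_elt_nonzero: "pi_elt p D \<zeta> k \<noteq> 0"
proof
  assume "pi_elt p D \<zeta> k = 0"
  then have 1: "\<zeta> ^ p ^ (log_idx p D 1 - k) = 1" by (simp add: pi_elt_def)
  have "p ^ (log_idx p D 1 - k) < p ^ (log_idx p D 1 + 1)" using p_gt_1 by (intro power_strict_increasing) auto
  moreover have "0 < p ^ (log_idx p D 1 - k)" using p_gt_1 by simp
  ultimately show False using prim 1 unfolding primitive_root_of_unity_def by blast
qed

lemma zeta_top_neq_1: "\<zeta> ^ p ^ log_idx p D 1 \<noteq> 1"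
  using pi_elt_nonzero[of 0] by (simp add: pi_elt_def)

lemma ghost_lam:
  assumes "1 \<le> n"
  shows "coeff P n / pi_elt p D \<zeta> (log_idx p D n)
     = (\<Sum>k\<in>{k. k \<le> n \<and> p ^ k dvd n}. lam (n div p ^ k) ^ (p ^ k) / of_nat (p ^ k))"
  using ghost_witt_coord[OF p_gt_1, of n "\<lambda>n. coeff P n / pi_elt p D \<zeta> (log_idx p D n)"] assms by (simp add: lam_def)

lemma div_prime_power_scaled:
  fixes x :: 'k
  assumes "p ^ k dvd N"
  shows "of_nat (N div p ^ k) * x = of_nat N * (x / of_nat (p ^ k))"
proof -
  have "(of_nat N :: 'k) = of_nat (N div p ^ k) * of_nat (p ^ k)" using assms by (metis dvd_div_mult_self of_nat_mult)
  moreover have "(of_nat (p ^ k) :: 'k) \<noteq> 0" using p_gt_1 by simp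
  ultimately show ?thesis using p_gt_1 by (simp add: field_simps del: of_nat_power)
qed

text \<open>Up to degree \<open>D\<close> the logarithmic derivatives agree by the choice of
  \<open>lam\<close>. Beyond \<open>D\<close> a contribution with \<open>N = i p^k\<close> has
  \<open>k > d_i\<close>, so \<open>zeta_at i ^ p ^ k = 1\<close> and it vanishes, as does the
  coefficient of \<open>P\<close>.\<close>

lemma exp_poly_eq_pulita_product:
  "exp_poly P = (\<Prod>i\<in>{1..D}. pulita_exp p (zeta_at i) oo (fps_const (lam i) * fps_X ^ i))"
proof (rule log_deriv_ode_unique)
  let ?m = "\<lambda>i. fps_const (lam i) * fps_X ^ i :: 'k fps"
  let ?L = "\<lambda>i. (pulita_log_deriv p (zeta_at i) oo ?m i) * fps_deriv (?m i)"
  have "log_deriv_ode (\<Sum>i\<in>{1..D}. ?L i) (\<Prod>i\<in>{1..D}. pulita_exp p (zeta_at i) oo ?m i)"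
    by (intro log_deriv_ode_prod log_deriv_ode_compose log_deriv_ode_pulita_exp) auto
  moreover have "fps_nth (\<Sum>i\<in>{1..D}. ?L i) n = fps_nth (fps_of_poly (pderiv P)) n" for n
  proof -
    define N where "N = n + 1"
    have N: "1 \<le> N" by (simp add: N_def)
    have L: "fps_nth (?L i) n = (if \<exists>k. N = i * p ^ k then
        of_nat i * ((zeta_at i ^ (N div i) - 1) * lam i ^ (N div i)) else 0)" if "i \<in> {1..D}" for i
      using monom_substitution_log_deriv_nth[OF p_gt_1, of i "pulita_log_deriv p (zeta_at i)" "\<lambda>n. zeta_at i ^ n - 1" "lam i" n] that
      by (simp add: pulita_log_deriv_def N_def mult.assoc)
    have sum: "fps_nth (\<Sum>i\<in>{1..D}. ?L i) n = (\<Sum>i\<in>{1..D}. if \<exists>k. N = i * p ^ k then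
        of_nat i * ((zeta_at i ^ (N div i) - 1) * lam i ^ (N div i)) else 0)"
      unfolding fps_sum_nth by (rule sum.cong[OF refl L])
    have target: "fps_nth (fps_of_poly (pderiv P)) n = of_nat N * coeff P N"
      by (simp add: coeff_pderiv N_def del: of_nat_Suc of_nat_add)
    show ?thesis
    proof (cases "N \<le> D")
      case False
      then have "coeff P N = 0" using deg by (intro coeff_eq_0) simp
      moreover have "(if \<exists>k. N = i * p ^ k then
        of_nat i * ((zeta_at i ^ (N div i) - 1) * lam i ^ (N div i)) else 0) = 0" if i: "i \<in> {1..D}" for i
      proof (cases "\<exists>k. N = i * p ^ k")
        case True
        then obtain k where k: "N = i * p ^ k" by auto
        have "log_idx p D i < k"
        proof (rule ccontr)
          assume "\<not> log_idx p D i < k"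
          then have "i * p ^ k \<le> i * p ^ log_idx p D i" using p_gt_1 by (intro mult_le_mono2 power_increasing) auto
          also have "\<dots> \<le> D" using i by (intro log_idx_bounds p_gt_1) auto
          finally show False using False k by simp
        qed
        then have "zeta_at i ^ (p ^ k) = 1" using i by (intro zeta_at_order) auto
        moreover have "N div i = p ^ k" using k i by simp
        ultimately show ?thesis by simp
      qed simp
      ultimately show ?thesis unfolding sum target by (simp add: sum.neutral del: of_nat_mult)
    next
      case True
      have "(\<Sum>i\<in>{1..D}. if \<exists>k. N = i * p ^ k then
            of_nat i * ((zeta_at i ^ (N div i) - 1) * lam i ^ (N div i)) else 0)
         = (\<Sum>k\<in>{k. k \<le> N \<and> p ^ k dvd N}. of_nat (N div p ^ k) * ((zeta_at (N div p ^ k) ^ (N div (N div p ^ k)) - 1)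
              * lam (N div p ^ k) ^ (N div (N div p ^ k))))"
      proof (rule sum_over_prime_power_divisors[OF p_gt_1])
        fix k assume k: "p ^ k dvd N"
        then have "0 < N div p ^ k" using N p_gt_1 by (auto simp: div_greater_zero_iff dvd_imp_le)
        moreover have "N div p ^ k \<le> D" using True div_le_dividend[of N "p ^ k"] by linarith
        ultimately show "N div p ^ k \<in> {1..D}" by simp
      qed (use N in auto)
      also have "\<dots> = (\<Sum>k\<in>{k. k \<le> N \<and> p ^ k dvd N}. of_nat N * pi_elt p D \<zeta> (log_idx p D N) *
            (lam (N div p ^ k) ^ (p ^ k) / of_nat (p ^ k)))"
      proof (rule sum.cong[OF refl])
        fix k assume "k \<in> {k. k \<le> N \<and> p ^ k dvd N}"
        then have k: "p ^ k dvd N" by simp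
        define i where "i = N div p ^ k"
        have i0: "0 < i" unfolding i_def using k N p_gt_1 by (auto simp: div_greater_zero_iff dvd_imp_le)
        have Ni: "N = i * p ^ k" unfolding i_def using k by simp
        have iD: "i \<le> D" using True div_le_dividend[of N "p ^ k"] unfolding i_def by linarith
        have Nk: "N div i = p ^ k" using Ni i0 by simp
        have "log_idx p D 1 - log_idx p D N = (log_idx p D 1 - log_idx p D i) + k"
          using log_idx_div[OF p_gt_1 N True k] log_idx_le_1[OF p_gt_1, of i D] i0 iD by (simp add: i_def)
        then have "zeta_at i ^ p ^ k - 1 = pi_elt p D \<zeta> (log_idx p D N)"
          unfolding zeta_at_def pi_elt_def by (simp only: power_add power_mult)
        then show "of_nat (N div p ^ k) * ((zeta_at (N div p ^ k) ^ (N div (N div p ^ k)) - 1)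
              * lam (N div p ^ k) ^ (N div (N div p ^ k)))
          = of_nat N * pi_elt p D \<zeta> (log_idx p D N) * (lam (N div p ^ k) ^ (p ^ k) / of_nat (p ^ k))"
          unfolding i_def[symmetric] Nk div_prime_power_scaled[OF k, folded i_def]
          by (simp only: times_divide_eq_right mult.assoc)
      qed
      also have "\<dots> = of_nat N * coeff P N"
        unfolding sum_distrib_left[symmetric] ghost_lam[OF N, symmetric]
        using pi_elt_nonzero[of "log_idx p D N"] by simp
      finally show ?thesis unfolding sum target .
    qed
  qed
  ultimately show "log_deriv_ode (fps_of_poly (pderiv P)) (\<Prod>i\<in>{1..D}. pulita_exp p (zeta_at i) oo ?m i)"
    by (simp only: fps_ext[of "\<Sum>i\<in>{1..D}. ?L i" "fps_of_poly (pderiv P)"])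
  show "log_deriv_ode (fps_of_poly (pderiv P)) (exp_poly P)" by (rule log_deriv_ode_exp_poly[OF P0])
qed

text \<open>Dividing coefficient \<open>N\<close> of the logarithm by \<open>\<pi>_(d_N)\<close>
  turns the factors into Artin-Hasse exponentials. Their logarithms do not stop at degree
  \<open>D\<close>, so the equality holds only up to there.\<close>

lemma exp_P_tilde_nth:
  assumes m: "1 \<le> m" "\<not> p dvd m" and n: "n \<le> D"
  shows "fps_nth (exp_poly (P_tilde p D \<zeta> P m)) n
     = fps_nth (\<Prod>j\<in>{j. m * p ^ j \<le> D}. artin_hasse p oo (fps_const (lam (m * p ^ j)) * fps_X ^ (m * p ^ j))) n"
proof (rule log_deriv_ode_unique_upto[OF _ _ _ n])
  let ?J = "{j. m * p ^ j \<le> D}"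
  let ?m = "\<lambda>j. fps_const (lam (m * p ^ j)) * fps_X ^ (m * p ^ j) :: 'k fps"
  let ?L = "\<lambda>j. (artin_hasse_log_deriv p oo ?m j) * fps_deriv (?m j)"
  have mp: "0 < m * p ^ j" for j using m p_gt_1 by simp
  have finJ: "finite ?J"
  proof (rule finite_subset)
    show "?J \<subseteq> {..D}"
    proof
      fix j assume "j \<in> ?J"
      have "j < p ^ j" using p_gt_1 by (intro power_gt_expt) simp
      also have "p ^ j \<le> m * p ^ j" using m by simp
      finally show "j \<in> {..D}" using \<open>j \<in> ?J\<close> by simp
    qed
  qed simp
  have injJ: "inj_on (\<lambda>j. m * p ^ j) ?J"
    using m(1) power_inject_exp[OF p_gt_1] by (intro inj_onI) auto
  have Pt: "coeff (P_tilde p D \<zeta> P m) N = (if \<exists>j. N = m * p ^ j \<and> N \<le> D then coeff P N / pi_elt p D \<zeta> (log_idx p D N) else 0)" for N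
  proof -
    have "coeff (P_tilde p D \<zeta> P m) N = (\<Sum>i\<in>(\<lambda>j. m * p ^ j) ` ?J. if i = N then coeff P i / pi_elt p D \<zeta> (log_idx p D i) else 0)"
      unfolding P_tilde_def by (simp add: coeff_sum sum.reindex[OF injJ])
    also have "\<dots> = (if N \<in> (\<lambda>j. m * p ^ j) ` ?J then coeff P N / pi_elt p D \<zeta> (log_idx p D N) else 0)"
      using finJ by simp
    also have "N \<in> (\<lambda>j. m * p ^ j) ` ?J \<longleftrightarrow> (\<exists>j. N = m * p ^ j \<and> N \<le> D)" by auto
    finally show ?thesis .
  qed
  have "coeff (P_tilde p D \<zeta> P m) 0 = 0" unfolding Pt using mp by auto
  then show "log_deriv_ode (fps_of_poly (pderiv (P_tilde p D \<zeta> P m))) (exp_poly (P_tilde p D \<zeta> P m))"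
    by (rule log_deriv_ode_exp_poly)
  show "log_deriv_ode (\<Sum>j\<in>?J. ?L j) (\<Prod>j\<in>?J. artin_hasse p oo ?m j)"
  proof (rule log_deriv_ode_prod)
    fix j
    show "log_deriv_ode (?L j) (artin_hasse p oo ?m j)"
      using m(1) p_gt_1 by (intro log_deriv_ode_compose log_deriv_ode_artin_hasse) simp
  qed
  fix n assume "n < D"
  define N where "N = n + 1"
  have N: "1 \<le> N" "N \<le> D" using \<open>n < D\<close> by (auto simp: N_def)
  have L: "fps_nth (?L j) n = (if \<exists>k. N = m * p ^ j * p ^ k then
      of_nat (m * p ^ j) * lam (m * p ^ j) ^ (N div (m * p ^ j)) else 0)" for j
    using monom_substitution_log_deriv_nth[OF p_gt_1 mp[of j], of "artin_hasse_log_deriv p" "\<lambda>n. 1" "lam (m * p ^ j)" n]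
    by (simp add: artin_hasse_log_deriv_def N_def)
  have target: "fps_nth (fps_of_poly (pderiv (P_tilde p D \<zeta> P m))) n = of_nat N * coeff (P_tilde p D \<zeta> P m) N"
    by (simp add: coeff_pderiv N_def del: of_nat_Suc of_nat_add)
  have sum: "fps_nth (\<Sum>j\<in>?J. ?L j) n = (\<Sum>i\<in>(\<lambda>j. m * p ^ j) ` ?J. if \<exists>k. N = i * p ^ k then
      of_nat i * lam i ^ (N div i) else 0)"
    unfolding fps_sum_nth L by (simp add: sum.reindex[OF injJ])
  have "fps_nth (\<Sum>j\<in>?J. ?L j) n = of_nat N * coeff (P_tilde p D \<zeta> P m) N"
  proof (cases "\<exists>J. N = m * p ^ J")
    case False
    have "(if \<exists>k. N = i * p ^ k then of_nat i * lam i ^ (N div i) else 0) = 0" if "i \<in> (\<lambda>j. m * p ^ j) ` ?J" for i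
    proof -
      obtain j where "i = m * p ^ j" using \<open>i \<in> (\<lambda>j. m * p ^ j) ` ?J\<close> by auto
      then have "N \<noteq> i * p ^ k" for k using False by (auto simp: mult.assoc simp flip: power_add)
      then show ?thesis by simp
    qed
    then have "fps_nth (\<Sum>j\<in>?J. ?L j) n = 0" unfolding sum by (intro sum.neutral) blast
    then show ?thesis unfolding Pt using False by auto
  next
    case True
    then obtain J where J: "N = m * p ^ J" by auto
    have "(\<Sum>i\<in>(\<lambda>j. m * p ^ j) ` ?J. if \<exists>k. N = i * p ^ k then of_nat i * lam i ^ (N div i) else 0)
       = (\<Sum>k\<in>{k. k \<le> N \<and> p ^ k dvd N}. of_nat (N div p ^ k) * lam (N div p ^ k) ^ (N div (N div p ^ k)))"
    proof (rule sum_over_prime_power_divisors[OF p_gt_1])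
      fix k assume k: "p ^ k dvd N"
      \<comment> \<open>Since \<open>m\<close> is prime to \<open>p\<close>, dividing
        \<open>m p^J\<close> by powers of \<open>p\<close> stays within the exponents
        \<open>m p^j\<close>; so the classes of different \<open>m\<close> do not interact.\<close>
      have "k \<le> J"
      proof (rule ccontr)
        assume "\<not> k \<le> J"
        then have "p ^ Suc J dvd p ^ k" by (intro le_imp_power_dvd) simp
        then have "p ^ Suc J dvd m * p ^ J" using dvd_trans[OF _ k] J by blast
        then show False using m p_gt_1 by simp
      qed
      then have "N = m * p ^ (J - k) * p ^ k" using J by (simp add: mult.assoc flip: power_add)
      then have "N div p ^ k = m * p ^ (J - k)" using p_gt_1 by simp
      moreover have "m * p ^ (J - k) \<le> D" using N(2) div_le_dividend[of N "p ^ k"] calculation by simp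
      ultimately show "N div p ^ k \<in> (\<lambda>j. m * p ^ j) ` ?J" by auto
    qed (use N finJ in auto)
    also have "\<dots> = (\<Sum>k\<in>{k. k \<le> N \<and> p ^ k dvd N}. of_nat N * (lam (N div p ^ k) ^ (p ^ k) / of_nat (p ^ k)))"
    proof (rule sum.cong[OF refl])
      fix k assume "k \<in> {k. k \<le> N \<and> p ^ k dvd N}"
      then have k: "p ^ k dvd N" by simp
      define i where "i = N div p ^ k"
      have "0 < i" unfolding i_def using k N p_gt_1 by (auto simp: div_greater_zero_iff dvd_imp_le)
      moreover have "N = i * p ^ k" unfolding i_def using k by simp
      ultimately have "N div i = p ^ k" by simp
      then have "N div (N div p ^ k) = p ^ k" unfolding i_def .
      then show "of_nat (N div p ^ k) * lam (N div p ^ k) ^ (N div (N div p ^ k))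
          = of_nat N * (lam (N div p ^ k) ^ (p ^ k) / of_nat (p ^ k))"
        unfolding div_prime_power_scaled[OF k] by simp
    qed
    also have "\<dots> = of_nat N * coeff (P_tilde p D \<zeta> P m) N"
      unfolding sum_distrib_left[symmetric] ghost_lam[OF N(1), symmetric] Pt using True N(2) by simp
    finally show ?thesis unfolding sum .
  qed
  then show "fps_nth (fps_of_poly (pderiv (P_tilde p D \<zeta> P m))) n = fps_nth (\<Sum>j\<in>?J. ?L j) n"
    unfolding target by simp
qed

end


section \<open>Integrality of the coordinates and the index\<close>

context exponential_equation
begin

definition support :: "nat set" where
  "support = {i \<in> {1..D}. lam i \<noteq> 0}"

definition prime_free :: "nat \<Rightarrow> nat" where
  "prime_free i = i div p ^ multiplicity p i"

text \<open>The number \<open>N_i\<close> of the overview; it satisfies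
  \<open>i p^(d_i) = p^j N_i\<close> for \<open>i = m p^j\<close> with \<open>m\<close> prime to
  \<open>p\<close>.\<close>

definition slope :: "nat \<Rightarrow> nat" where
  "slope i = prime_free i * p ^ log_idx p D i"

lemma prime_free_mult: "i = prime_free i * p ^ multiplicity p i"
  by (simp add: prime_free_def multiplicity_dvd)

lemma prime_free_not_dvd:
  assumes "0 < i" shows "\<not> p dvd prime_free i"
proof -
  have "\<not> is_unit p" using p_gt_1 by simp
  then show ?thesis using assms multiplicity_decompose[of i p] by (simp add: prime_free_def)
qed

lemma prime_free_eqI:
  assumes m: "\<not> p dvd m"
  shows "prime_free (m * p ^ j) = m" "multiplicity p (m * p ^ j) = j"
proof -
  have "0 < m" using m by (cases m) auto
  then have "multiplicity p (m * p ^ j) = multiplicity p m + j"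
    using Q(2) p_gt_1 by (simp add: prime_elem_multiplicity_mult_distrib)
  then show 1: "multiplicity p (m * p ^ j) = j" using m by (simp add: not_dvd_imp_multiplicity_0)
  then show "prime_free (m * p ^ j) = m" unfolding prime_free_def using p_gt_1 by simp
qed

lemma slope_prime_power_multiple:
  assumes "\<not> p dvd m" "m * p ^ j \<le> D"
  shows "slope (m * p ^ j) = m * p ^ (log_idx p D m - j)"
proof -
  have "1 \<le> m" using assms(1) by (cases m) auto
  then show ?thesis
    unfolding slope_def prime_free_eqI[OF assms(1)] by (simp only: log_idx_mult(2)[OF p_gt_1 _ assms(2)])
qed

text \<open>The slope determines \<open>m\<close> and \<open>d_i\<close>, and
  \<open>d_i = d_m - j\<close> returns the exponent \<open>j\<close>. This is what makes the
  dominant factor unique.\<close>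

lemma inj_on_slope: "inj_on slope {1..D}"
proof (rule inj_onI)
  fix i k assume ik: "i \<in> {1..D}" "k \<in> {1..D}" "slope i = slope k"
  have n: "\<not> p dvd prime_free i" "\<not> p dvd prime_free k" using ik prime_free_not_dvd[of i] prime_free_not_dvd[of k] by auto
  have eq: "prime_free i * p ^ log_idx p D i = prime_free k * p ^ log_idx p D k" using ik(3) by (simp add: slope_def)
  define m where "m = prime_free i"
  have m: "prime_free k = m"
    using arg_cong[OF eq, of prime_free] n by (simp add: prime_free_eqI m_def)
  have d: "log_idx p D i = log_idx p D k"
    using arg_cong[OF eq, of "multiplicity p"] n by (simp add: prime_free_eqI)
  have im: "i = m * p ^ multiplicity p i" using prime_free_mult[of i] by (simp add: m_def)
  have km: "k = m * p ^ multiplicity p k" using prime_free_mult[of k] by (simp add: m)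
  have m1: "1 \<le> m" using n by (cases m) (auto simp: m_def)
  have "log_idx p D i = log_idx p D m - multiplicity p i" "multiplicity p i \<le> log_idx p D m"
    using log_idx_mult[OF p_gt_1 m1, of "multiplicity p i" D] ik(1) im by auto
  moreover have "log_idx p D k = log_idx p D m - multiplicity p k" "multiplicity p k \<le> log_idx p D m"
    using log_idx_mult[OF p_gt_1 m1, of "multiplicity p k" D] ik(2) km by auto
  ultimately have "multiplicity p i = multiplicity p k" using d by linarith
  then show "i = k" using im km by metis
qed

lemma exp_poly_eq_prod_support:
  "exp_poly P = (\<Prod>i\<in>support. pulita_exp p (zeta_at i) oo (fps_const (lam i) * fps_X ^ i))"
  unfolding exp_poly_eq_pulita_product
proof (rule prod.mono_neutral_right)
  show "\<forall>i\<in>{1..D} - support. pulita_exp p (zeta_at i) oo (fps_const (lam i) * fps_X ^ i) = 1"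
    using log_deriv_ode_0[OF log_deriv_ode_pulita_exp] by (auto simp: support_def)
qed (auto simp: support_def)

lemma log_deriv_ode_exp_P: "log_deriv_ode (fps_of_poly (pderiv P)) (exp_poly P)"
  by (rule log_deriv_ode_exp_poly[OF P0])

text \<open>The radius is kept general: \<open>r0 = 1\<close> gives the index, while
  \<open>r0 < 1\<close> is needed to refute a coordinate of absolute value above 1.\<close>

lemma index_at_critical_radius:
  assumes r0: "0 < r0" "\<And>i. i \<in> support \<Longrightarrow> absv (lam i) * r0 ^ i \<le> 1"
    and i0: "i0 \<in> support" "absv (lam i0) * r0 ^ i0 = 1"
      "\<And>i. i \<in> support \<Longrightarrow> absv (lam i) * r0 ^ i = 1 \<Longrightarrow> slope i \<le> slope i0"
  shows "\<exists>R>r0. \<forall>r. r0 < r \<and> r \<le> R \<longrightarrow>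
    (\<forall>f\<in>bounded_fps r. diff_op (pderiv P) f = 0 \<longrightarrow> f = 0) \<and>
    (\<exists>b. (\<forall>i<slope i0 - 1. \<exists>N. \<forall>k\<ge>N. fps_nth (b i) k = 0) \<and>
       spans_mod (slope i0 - 1) b (bounded_fps r) (diff_op (pderiv P) ` bounded_fps r) \<and>
       indep_mod (slope i0 - 1) b (diff_op (pderiv P) ` bounded_fps r))"
proof -
  have "\<exists>R>r0. \<forall>r. r0 < r \<and> r \<le> R \<longrightarrow> (\<exists>q \<theta> b. 0 < q \<and>
     monomial_perturbation (\<lambda>f. fps_nth (taylor_twist (exp_poly P) * taylor f) q) r \<theta> b
       ((prime_free i0 * p ^ log_idx p D i0 - 1) * q))"
  proof (rule perturbation_of_pulita_product[where I = support and l = lam and z = zeta_at and m = prime_free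
        and j = "multiplicity p" and s = "log_idx p D" and D = D, OF Q])
    show "inj_on (\<lambda>i. prime_free i * p ^ log_idx p D i) support"
      using inj_on_slope unfolding slope_def[abs_def] by (rule inj_on_subset) (auto simp: support_def)
    show "i * p ^ log_idx p D i \<le> D" if "i \<in> support" for i
      using that by (intro log_idx_bounds p_gt_1) (auto simp: support_def)
    show "zeta_at i ^ p ^ log_idx p D i = \<zeta> ^ p ^ log_idx p D 1" if "i \<in> support" for i
      using that by (intro zeta_at_power) (auto simp: support_def)
    show "(\<zeta> ^ p ^ log_idx p D 1) ^ p = 1" by (rule zeta_top_power)
    show "\<zeta> ^ p ^ log_idx p D 1 \<noteq> 1" by (rule zeta_top_neq_1)
    show "exp_poly P = (\<Prod>i\<in>support. pulita_exp p (zeta_at i) oo (fps_const (lam i) * fps_X ^ i))"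
      by (rule exp_poly_eq_prod_support)
    show "\<not> p dvd prime_free i" if "i \<in> support" for i
      using that by (intro prime_free_not_dvd) (auto simp: support_def)
    show "i = prime_free i * p ^ multiplicity p i" if "i \<in> support" for i by (rule prime_free_mult)
    show "prime_free i * p ^ log_idx p D i \<le> prime_free i0 * p ^ log_idx p D i0"
      if "i \<in> support" "absv (lam i) * r0 ^ i = 1" for i
      using i0(3)[OF that] by (simp add: slope_def)
  qed (use r0 i0 in \<open>auto simp: support_def\<close>)
  then obtain R where R: "r0 < R" and pert: "\<And>r. r0 < r \<Longrightarrow> r \<le> R \<Longrightarrow> \<exists>q \<theta> b. 0 < q \<and>
     monomial_perturbation (\<lambda>f. fps_nth (taylor_twist (exp_poly P) * taylor f) q) r \<theta> b ((slope i0 - 1) * q)"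
    unfolding slope_def by blast
  show ?thesis
  proof (intro exI[of _ R] conjI allI impI R)
    fix r assume r: "r0 < r \<and> r \<le> R"
    then obtain q \<theta> b where q: "0 < q" and
      mp: "monomial_perturbation (\<lambda>f. fps_nth (taylor_twist (exp_poly P) * taylor f) q) r \<theta> b ((slope i0 - 1) * q)"
      using pert by blast
    have *: "(\<forall>f\<in>bounded_fps r. diff_op (pderiv P) f = 0 \<longrightarrow> f = 0) \<and>
      (\<exists>n b. n * q = (slope i0 - 1) * q \<and> (\<forall>i<n. \<exists>N. \<forall>k\<ge>N. fps_nth (b i) k = 0) \<and>
       spans_mod n b (bounded_fps r) (diff_op (pderiv P) ` bounded_fps r) \<and>
       indep_mod n b (diff_op (pderiv P) ` bounded_fps r))"
    proof (rule monomial_perturbation_index[OF mp])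
      show "(diff_op (pderiv P) ^^ q) f = fps_const (fact q) * fps_nth (taylor_twist (exp_poly P) * taylor f) q" for f
        by (rule diff_op_pow[OF log_deriv_ode_exp_P])
      show "diff_op (pderiv P) f \<in> bounded_fps r" if "f \<in> bounded_fps r" for f
        using that r r0 by (intro diff_op_bounded) auto
    qed (use q in \<open>auto simp: diff_op_add diff_op_scale\<close>)
    then show "\<forall>f\<in>bounded_fps r. diff_op (pderiv P) f = 0 \<longrightarrow> f = 0" by blast
    from * q show "\<exists>b. (\<forall>i<slope i0 - 1. \<exists>N. \<forall>k\<ge>N. fps_nth (b i) k = 0) \<and>
       spans_mod (slope i0 - 1) b (bounded_fps r) (diff_op (pderiv P) ` bounded_fps r) \<and>
       indep_mod (slope i0 - 1) b (diff_op (pderiv P) ` bounded_fps r)"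
      by (metis mult_right_cancel less_not_refl)
  qed
qed

text \<open>Beyond the critical radius \<open>r\<^sub>0 = min |\<lambda>\<^sub>i|\<^bsup>-1/i\<^esup>\<close> the operator is injective, so
  its solution cannot converge there; hence solubility forces \<open>r\<^sub>0 \<ge> 1\<close>.\<close>

lemma absv_lam_le_1:
  assumes sol: "soluble P" and i: "i \<in> {1..D}"
  shows "absv (lam i) \<le> 1"
proof (rule ccontr)
  assume big: "\<not> absv (lam i) \<le> 1"
  have fin: "finite support" by (simp add: support_def)
  have iS: "i \<in> support" using i big by (auto simp: support_def)
  \<comment> \<open>\<open>\<rho> k\<close> is the radius at which the argument
    \<open>lam k * T^k\<close> reaches norm 1; the least of them is the critical radius.\<close>
  define \<rho> where "\<rho> k = root k (1 / absv (lam k))" for k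
  have \<rho>: "0 < \<rho> k" "\<rho> k ^ k = 1 / absv (lam k)" if "k \<in> support" for k
    using that absv_pos[of "lam k"] by (auto simp: support_def \<rho>_def)
  define r0 where "r0 = Min (\<rho> ` support)"
  have r0_in: "r0 \<in> \<rho> ` support" unfolding r0_def using fin iS by (intro Min_in) auto
  have r0_le: "r0 \<le> \<rho> k" if "k \<in> support" for k unfolding r0_def using fin that by (intro Min_le) auto
  have r0: "0 < r0" using r0_in \<rho> by auto
  have "\<rho> i ^ i < 1" using \<rho>(2)[OF iS] big by simp
  then have "\<rho> i < 1" using \<rho>(1)[OF iS] by (metis less_imp_le not_less one_le_power)
  then have r01: "r0 < 1" using r0_le[OF iS] by simp
  have le1: "absv (lam k) * r0 ^ k \<le> 1" if k: "k \<in> support" for k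
  proof -
    have "r0 ^ k \<le> \<rho> k ^ k" using r0 r0_le[OF k] by (intro power_mono) auto
    then show ?thesis using \<rho>(2)[OF k] absv_pos[of "lam k"] k by (simp add: support_def field_simps)
  qed
  define C where "C = {k \<in> support. absv (lam k) * r0 ^ k = 1}"
  have "C \<noteq> {}"
  proof -
    obtain k where "k \<in> support" "r0 = \<rho> k" using r0_in by auto
    then have "k \<in> C" using \<rho>(2)[of k] by (auto simp: C_def support_def)
    then show ?thesis by auto
  qed
  moreover have "finite C" using fin by (simp add: C_def)
  ultimately have "Max (slope ` C) \<in> slope ` C" by (intro Max_in) auto
  then obtain i0 where i0: "i0 \<in> C" "slope i0 = Max (slope ` C)" by auto
  have "slope k \<le> slope i0" if "k \<in> C" for k unfolding i0(2) using \<open>finite C\<close> that by (intro Max_ge) auto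
  then obtain R where R: "r0 < R" and inj: "\<And>r f. r0 < r \<Longrightarrow> r \<le> R \<Longrightarrow> f \<in> bounded_fps r \<Longrightarrow>
      diff_op (pderiv P) f = 0 \<Longrightarrow> f = 0"
    using index_at_critical_radius[OF r0 le1, of i0] i0(1) unfolding C_def by auto
  \<comment> \<open>A radius beyond \<open>r0\<close>, where the operator is injective, yet below 1,
    where solubility makes the solution bounded.\<close>
  define r where "r = min R ((1 + r0) / 2)"
  have r: "r0 < r" "r \<le> R" "r < 1" using R r01 by (auto simp: r_def min_def)
  have "ereal r < ultra_radius (exp_poly P)"
    using sol r(3) unfolding soluble_def by (metis ereal_less(3) less_le_trans one_ereal_def)
  then have "exp_poly P \<in> bounded_fps r" using r r0 by (intro bounded_fps_of_ultra_radius) auto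
  moreover have e: "fps_nth (exp_poly P) 0 = 1" "fps_deriv (exp_poly P) = fps_of_poly (pderiv P) * exp_poly P"
    using log_deriv_ode_exp_P by (auto simp: log_deriv_ode_def)
  moreover have "diff_op (pderiv P) (exp_poly P) = 0" by (simp add: diff_op_def e)
  ultimately have "exp_poly P = 0" using inj r by blast
  then show False using e(1) by simp
qed

lemma has_index_major:
  assumes le1: "\<And>i. i \<in> {1..D} \<Longrightarrow> absv (lam i) \<le> 1"
    and i0: "i0 \<in> {1..D}" "absv (lam i0) = 1"
    and max: "\<And>i. i \<in> {1..D} \<Longrightarrow> absv (lam i) = 1 \<Longrightarrow> slope i \<le> slope i0"
  shows "has_index (pderiv P) (1 - real (slope i0))"
proof -
  have i0S: "i0 \<in> support" using i0 by (auto simp: support_def)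
  have "\<And>i. i \<in> support \<Longrightarrow> absv (lam i) * 1 ^ i \<le> 1" "absv (lam i0) * 1 ^ i0 = 1"
    "\<And>i. i \<in> support \<Longrightarrow> absv (lam i) * 1 ^ i = 1 \<Longrightarrow> slope i \<le> slope i0"
    using le1 i0 max by (auto simp: support_def)
  from index_at_critical_radius[OF zero_less_one this(1) i0S this(2,3)]
  obtain R where R: "1 < R" and *: "\<And>r. 1 < r \<Longrightarrow> r \<le> R \<Longrightarrow>
    (\<forall>f\<in>bounded_fps r. diff_op (pderiv P) f = 0 \<longrightarrow> f = 0) \<and>
    (\<exists>b. (\<forall>i<slope i0 - 1. \<exists>N. \<forall>k\<ge>N. fps_nth (b i) k = 0) \<and>
       spans_mod (slope i0 - 1) b (bounded_fps r) (diff_op (pderiv P) ` bounded_fps r) \<and>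
       indep_mod (slope i0 - 1) b (diff_op (pderiv P) ` bounded_fps r))"
    by blast
  have "has_index (pderiv P) (- real (slope i0 - 1))"
    by (rule has_index_of_constant_dimension[OF R]) (use * in blast)+
  moreover have "1 \<le> slope i0"
    using prime_free_not_dvd[of i0] i0 p_gt_1 unfolding slope_def by (cases "prime_free i0") (auto simp: Suc_le_eq)
  ultimately show ?thesis by (simp add: of_nat_diff)
qed

text \<open>Each factor is an integral series in \<open>lam i * T^i\<close>, so it stays bounded by
  1 on a disc of radius slightly above 1; hence so do the solution and its inverse.\<close>

lemma has_index_minor:
  assumes less1: "\<And>i. i \<in> {1..D} \<Longrightarrow> absv (lam i) < 1"
  shows "has_index (pderiv P) 1"
proof -
  have "eventually (\<lambda>t. \<forall>i\<in>{1..D}. absv (lam i) * t ^ i < 1) (at_right 1)"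
    using less1 by (intro eventually_ball_finite ballI eventually_power_less) auto
  then obtain t1 where t1: "1 < t1" and near: "\<And>t. 1 < t \<Longrightarrow> t < t1 \<Longrightarrow> \<forall>i\<in>{1..D}. absv (lam i) * t ^ i < 1"
    unfolding eventually_at_right_field by auto
  define t where "t = (1 + t1) / 2"
  have t: "1 < t" "t < t1" using t1 by (auto simp: t_def)
  have e: "coeff_bound t 1 (exp_poly P)"
    unfolding exp_poly_eq_pulita_product
  proof (rule coeff_bound_prod)
    fix i assume i: "i \<in> {1..D}"
    have "zeta_at i ^ p ^ (log_idx p D i + 1) = 1" using i by (intro zeta_at_order) auto
    then have "absv (zeta_at i) \<le> 1" using absv_root_of_unity[of "zeta_at i"] p_gt_1 by fastforce
    then show "coeff_bound t 1 (pulita_exp p (zeta_at i) oo (fps_const (lam i) * fps_X ^ i))"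
      using i t near[OF t] by (intro coeff_bound_compose_monom coeff_bound_pulita_exp Q) (auto simp: less_imp_le)
  qed (use t in auto)
  have "coeff_bound t 1 (inverse (exp_poly P))"
    using log_deriv_ode_exp_P t by (intro coeff_bound_inverse e) (auto simp: log_deriv_ode_def)
  then show ?thesis
    using e t by (intro has_index_of_overconvergent_solution[OF Q log_deriv_ode_exp_P]) (auto simp: overconvergent_iff intro: bounded_fpsI)
qed

end


section \<open>The order of the reduced exponentials\<close>

lemma residue_0: "residue 0 = 0"
  by (simp add: residue_def zero_residue_field_def)

lemma residue_1: "residue 1 = 1"
  by (simp add: residue_def one_residue_field_def)

lemma residue_eq_0_iff: "absv x \<le> 1 \<Longrightarrow> residue x = 0 \<longleftrightarrow> absv x < 1"
  using residue_eq_iff[of x 0] by (simp add: residue_0)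

lemma order_0_eqI:
  fixes q :: "'a::idom poly"
  assumes "\<And>k. k < n \<Longrightarrow> coeff q k = 0" "coeff q n \<noteq> 0"
  shows "order 0 q = n"
proof (rule order_unique_lemma)
  have "[:- 0, 1:] ^ k = (monom 1 k :: 'a poly)" for k by (simp add: monom_altdef)
  then show "[:- 0, 1:] ^ n dvd q" "\<not> [:- 0, 1:] ^ Suc n dvd q"
    using assms by (auto simp only: monom_1_dvd_iff')
qed

lemma coeff_pcompose_monom:
  fixes q :: "'a::comm_ring_1 poly"
  assumes "0 < m"
  shows "coeff (pcompose q (monom 1 m)) i = (if m dvd i then coeff q (i div m) else 0)"
proof (induction q arbitrary: i)
  case (pCons a q)
  show ?case
  proof (cases "i < m")
    case True
    then show ?thesis using assms by (cases "i = 0") (auto simp: pcompose_pCons coeff_monom_mult coeff_pCons dest: dvd_imp_le split: nat.splits)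
  next
    case False
    then obtain k where k: "i = k + m" by (metis add.commute le_Suc_ex not_less)
    have "coeff (pcompose (pCons a q) (monom 1 m)) i = coeff (pcompose q (monom 1 m)) k"
      using assms k by (auto simp: pcompose_pCons coeff_monom_mult coeff_pCons split: nat.splits)
    then show ?thesis using pCons k assms by simp
  qed
qed simp

text \<open>\<open>f = 1 + c T\<^sup>n + \<dots>\<close> modulo the maximal ideal.\<close>

definition residually_tangent :: "nat \<Rightarrow> 'k::ultrametric_field \<Rightarrow> 'k fps \<Rightarrow> bool" where
  "residually_tangent n c f \<longleftrightarrow> coeff_bound 1 1 f \<and> fps_nth f 0 = 1 \<and>
     (\<forall>k. 0 < k \<and> k < n \<longrightarrow> absv (fps_nth f k) < 1) \<and> absv (fps_nth f n - c) < 1"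

text \<open>In degree at most \<open>n\<close> each mixed product contains a coefficient of
  \<open>f\<close> of index strictly between 0 and \<open>n\<close>, which lies in the maximal
  ideal; so the leading coefficients add.\<close>

lemma residually_tangent_mult:
  assumes n: "0 < n" and f: "residually_tangent n c f" and g: "residually_tangent n d g"
  shows "residually_tangent n (c + d) (f * g)"
proof -
  have le: "absv (fps_nth f k) \<le> 1" "absv (fps_nth g k) \<le> 1" for k
    using f g by (auto simp: residually_tangent_def coeff_bound_def)
  have inner: "absv (\<Sum>i\<in>{1..<k}. fps_nth f i * fps_nth g (k - i)) < 1" if "k \<le> n" for k
  proof (rule absv_sum_less)
    fix i assume i: "i \<in> {1..<k}"
    then have "absv (fps_nth f i) < 1" using that f by (auto simp: residually_tangent_def)
    moreover have "absv (fps_nth f i) * absv (fps_nth g (k - i)) \<le> absv (fps_nth f i)"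
      using le(2) by (intro mult_left_le) auto
    ultimately have "absv (fps_nth f i) * absv (fps_nth g (k - i)) < 1" by simp
    then show "absv (fps_nth f i * fps_nth g (k - i)) < 1" by (simp add: absv_mult)
  qed simp
  have dec: "fps_nth (f * g) k = fps_nth g k + fps_nth f k + (\<Sum>i\<in>{1..<k}. fps_nth f i * fps_nth g (k - i))" if "0 < k" for k
  proof -
    have "{0..k} = insert 0 (insert k {1..<k})" using that by auto
    then show ?thesis using that f g by (simp add: fps_mult_nth residually_tangent_def)
  qed
  have "absv (fps_nth (f * g) k) < 1" if k: "0 < k" "k < n" for k
  proof -
    have "absv (fps_nth g k) < 1" "absv (fps_nth f k) < 1" using f g k by (auto simp: residually_tangent_def)
    then have "absv (fps_nth g k + fps_nth f k) < 1"
      using absv_ultrametric[of "fps_nth g k" "fps_nth f k"] by simp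
    then have "max (absv (fps_nth g k + fps_nth f k)) (absv (\<Sum>i\<in>{1..<k}. fps_nth f i * fps_nth g (k - i))) < 1"
      using inner[of k] k by (simp only: max_less_iff_conj less_imp_le simp_thms)
    then show ?thesis unfolding dec[OF k(1)] by (rule le_less_trans[OF absv_ultrametric])
  qed
  moreover have "absv (fps_nth (f * g) n - (c + d)) < 1"
  proof -
    have "absv (fps_nth g n - d) < 1" "absv (fps_nth f n - c) < 1" using f g by (auto simp: residually_tangent_def)
    then have "absv ((fps_nth g n - d) + (fps_nth f n - c)) < 1"
      using absv_ultrametric[of "fps_nth g n - d" "fps_nth f n - c"] by simp
    then have "max (absv ((fps_nth g n - d) + (fps_nth f n - c))) (absv (\<Sum>i\<in>{1..<n}. fps_nth f i * fps_nth g (n - i))) < 1"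
      using inner[of n] by (simp only: max_less_iff_conj order_refl simp_thms)
    from le_less_trans[OF absv_ultrametric this]
    show ?thesis unfolding dec[OF n] by (simp add: algebra_simps)
  qed
  moreover have "coeff_bound 1 (1 * 1) (f * g)" using f g by (intro coeff_bound_mult) (auto simp: residually_tangent_def)
  ultimately show ?thesis using f g by (simp add: residually_tangent_def)
qed

lemma residually_tangent_prod:
  assumes "finite A" "0 < n" "\<And>i. i \<in> A \<Longrightarrow> residually_tangent n (c i) (f i)"
  shows "residually_tangent n (sum c A) (prod f A)"
  using assms(1,3)
proof (induction A rule: finite_induct)
  case empty
  then show ?case using assms(2) by (auto simp: residually_tangent_def coeff_bound_1)
qed (auto intro: residually_tangent_mult assms(2))

context exponential_equation
begin

definition exponents :: "nat \<Rightarrow> nat set" where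
  "exponents m = {j. m * p ^ j \<le> D}"

text \<open>Written in the variable \<open>U = T^m\<close>, so that its reduction is
  \<open>e_hat\<close> itself and not a series in \<open>T^m\<close>.\<close>

definition artin_hasse_prod :: "nat \<Rightarrow> 'k fps" where
  "artin_hasse_prod m = (\<Prod>j\<in>exponents m. artin_hasse p oo (fps_const (lam (m * p ^ j)) * fps_X ^ p ^ j))"

context
  fixes m :: nat
  assumes m: "1 \<le> m" "m \<le> D" "\<not> p dvd m" and le1: "\<And>i. i \<in> {1..D} \<Longrightarrow> absv (lam i) \<le> 1"
begin

lemma exponents_lam: "j \<in> exponents m \<Longrightarrow> absv (lam (m * p ^ j)) \<le> 1"
  using m p_gt_1 by (intro le1) (auto simp: exponents_def Suc_le_eq)

lemma finite_exponents: "finite (exponents m)"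
proof (rule finite_subset)
  show "(exponents m) \<subseteq> {..D}"
  proof
    fix j assume j: "j \<in> exponents m"
    have "j < p ^ j" using p_gt_1 by (intro power_gt_expt) simp
    also have "p ^ j \<le> m * p ^ j" using m by simp
    finally show "j \<in> {..D}" using j by (simp add: exponents_def)
  qed
qed simp

lemma exp_P_tilde_nth':
  assumes "n \<le> D"
  shows "fps_nth (exp_poly (P_tilde p D \<zeta> P m)) n = (if m dvd n then fps_nth (artin_hasse_prod m) (n div m) else 0)"
proof -
  have X0: "fps_nth (fps_X ^ m :: 'k fps) 0 = 0" using m by simp
  have "(artin_hasse p oo (fps_const c * fps_X ^ p ^ j)) oo fps_X ^ m = artin_hasse p oo (fps_const c * fps_X ^ (m * p ^ j))"
    for c :: 'k and j
  proof -
    have "fps_nth (fps_const c * fps_X ^ p ^ j :: 'k fps) 0 = 0" using p_gt_1 by simp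
    from fps_compose_assoc[OF X0 this, of "artin_hasse p"] show ?thesis
      by (simp add: fps_compose_mult_distrib[OF X0] fps_compose_power[OF X0, symmetric]
          fps_X_fps_compose_startby0[OF X0] power_mult)
  qed
  then have "artin_hasse_prod m oo fps_X ^ m
     = (\<Prod>j\<in>exponents m. artin_hasse p oo (fps_const (lam (m * p ^ j)) * fps_X ^ (m * p ^ j)))"
    unfolding artin_hasse_prod_def fps_compose_prod_distrib[OF X0] by simp
  then have "fps_nth (exp_poly (P_tilde p D \<zeta> P m)) n = fps_nth (artin_hasse_prod m oo fps_X ^ m) n"
    using exp_P_tilde_nth[OF m(1,3) assms] by (simp add: exponents_def)
  moreover have "fps_nth (artin_hasse_prod m oo fps_X ^ m) n = (if m dvd n then fps_nth (artin_hasse_prod m) (n div m) else 0)"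
    using m fps_compose_monom_nth[of m "artin_hasse_prod m" 1 n] by simp
  ultimately show ?thesis by simp
qed

text \<open>The description defining \<open>e_hat\<close> denotes: the exponential of
  \<open>P_tilde\<close> is a series in \<open>T^m\<close> up to degree \<open>D\<close>, and the
  substitution of \<open>T^m\<close> for \<open>U\<close> is injective on polynomials.\<close>

lemma coeff_e_hat:
  "coeff (e_hat p D \<zeta> P m) k = (if k \<le> D div m then residue (fps_nth (artin_hasse_prod m) k) else 0)"
proof -
  define q where "q = (\<Sum>k\<le>D div m. monom (residue (fps_nth (artin_hasse_prod m) k)) k)"
  have q: "coeff q k = (if k \<le> D div m then residue (fps_nth (artin_hasse_prod m) k) else 0)" for k
    by (simp add: q_def coeff_sum)
  have T: "coeff (e_hat_T p D \<zeta> P m) i = (if i \<le> D then residue (fps_nth (exp_poly (P_tilde p D \<zeta> P m)) i) else 0)" for i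
    by (simp add: e_hat_T_def coeff_sum)
  have m0: "0 < m" using m by simp
  have "e_hat p D \<zeta> P m = q" unfolding e_hat_def
  proof (rule the_equality, intro conjI)
    show "degree q \<le> D div m" by (rule degree_le) (simp add: q)
    show "pcompose q (monom 1 m) = e_hat_T p D \<zeta> P m"
    proof (rule poly_eqI)
      fix i
      have "i div m \<le> D div m \<longleftrightarrow> i \<le> D" if "m dvd i"
        using that m0 by (auto simp: less_eq_div_iff_mult_less_eq intro: div_le_mono elim!: dvdE)
      then show "coeff (pcompose q (monom 1 m)) i = coeff (e_hat_T p D \<zeta> P m) i"
        unfolding coeff_pcompose_monom[OF m0] T q by (auto simp: exp_P_tilde_nth' residue_0)
    qed
    fix q' assume q': "degree q' \<le> D div m \<and> pcompose q' (monom 1 m) = e_hat_T p D \<zeta> P m"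
    show "q' = q"
    proof (rule poly_eqI)
      fix k
      have "coeff q' k = coeff (pcompose q' (monom 1 m)) (m * k)" using m0 by (simp add: coeff_pcompose_monom)
      also have "\<dots> = coeff (pcompose q (monom 1 m)) (m * k)"
        using q' \<open>pcompose q (monom 1 m) = e_hat_T p D \<zeta> P m\<close> by simp
      also have "\<dots> = coeff q k" using m0 by (simp add: coeff_pcompose_monom)
      finally show "coeff q' k = coeff q k" .
    qed
  qed
  then show ?thesis by (simp add: q)
qed

lemma artin_hasse_prod_tangent:
  assumes n: "0 < n" and c: "\<And>j. j \<in> exponents m \<Longrightarrow>
    residually_tangent n (c j) (artin_hasse p oo (fps_const (lam (m * p ^ j)) * fps_X ^ p ^ j))"
  shows "residually_tangent n (sum c (exponents m)) (artin_hasse_prod m)"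
  unfolding artin_hasse_prod_def by (rule residually_tangent_prod[OF finite_exponents n c])

lemma artin_hasse_factor:
  assumes "j \<in> exponents m"
  defines "f \<equiv> artin_hasse p oo (fps_const (lam (m * p ^ j)) * fps_X ^ p ^ j)"
  shows "coeff_bound 1 1 f" "fps_nth f 0 = 1"
    "\<And>k. fps_nth f k = (if p ^ j dvd k then fps_nth (artin_hasse p) (k div p ^ j) * lam (m * p ^ j) ^ (k div p ^ j) else 0)"
proof -
  have pj: "0 < p ^ j" using p_gt_1 by simp
  show "coeff_bound 1 1 f" unfolding f_def
    using exponents_lam[OF assms(1)] pj by (intro coeff_bound_compose_monom coeff_bound_artin_hasse Q) auto
  show "fps_nth f 0 = 1" unfolding f_def by (simp add: artin_hasse_nth_0)
  show "fps_nth f k = (if p ^ j dvd k then fps_nth (artin_hasse p) (k div p ^ j) * lam (m * p ^ j) ^ (k div p ^ j) else 0)" for k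
    unfolding f_def by (rule fps_compose_monom_nth[OF pj])
qed

lemma factor_small:
  assumes j: "j \<in> exponents m" and small: "absv (lam (m * p ^ j)) < 1" and k: "0 < k"
  shows "absv (fps_nth (artin_hasse p oo (fps_const (lam (m * p ^ j)) * fps_X ^ p ^ j)) k) < 1"
proof (cases "p ^ j dvd k")
  case True
  then have kp: "0 < k div p ^ j" using k p_gt_1 by (auto simp: div_greater_zero_iff dvd_imp_le)
  have "absv (fps_nth (artin_hasse p :: 'k fps) (k div p ^ j)) \<le> 1"
    using coeff_boundD[OF coeff_bound_artin_hasse[OF Q], of "k div p ^ j"] by simp
  moreover have "absv (lam (m * p ^ j)) ^ (k div p ^ j) < 1"
    using small kp by (intro power_less_one_iff[THEN iffD2]) auto
  moreover have "absv (fps_nth (artin_hasse p :: 'k fps) (k div p ^ j)) * absv (lam (m * p ^ j)) ^ (k div p ^ j)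
      \<le> absv (lam (m * p ^ j)) ^ (k div p ^ j)"
    using calculation(1) by (intro mult_left_le_one_le) auto
  ultimately have "absv (fps_nth (artin_hasse p :: 'k fps) (k div p ^ j)) * absv (lam (m * p ^ j)) ^ (k div p ^ j) < 1"
    by linarith
  then show ?thesis using True by (simp add: artin_hasse_factor(3)[OF j] absv_mult absv_power)
qed (simp add: artin_hasse_factor(3)[OF j])

lemma e_hat_eq_1:
  assumes small: "\<And>j. j \<in> exponents m \<Longrightarrow> absv (lam (m * p ^ j)) < 1"
  shows "e_hat p D \<zeta> P m = 1"
proof (rule poly_eqI)
  fix k
  have "absv (fps_nth (artin_hasse_prod m) k) < 1 \<and> absv (fps_nth (artin_hasse_prod m) k) \<le> 1" if k: "0 < k" for k
  proof -
    \<comment> \<open>Tangency with coefficient 0 holds at every order \<open>k\<close>, so all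
      coefficients of positive degree reduce to 0.\<close>
    have "residually_tangent k (\<Sum>j\<in>exponents m. 0) (artin_hasse_prod m)"
      using k factor_small[OF _ small] artin_hasse_factor
      by (intro artin_hasse_prod_tangent) (auto simp: residually_tangent_def)
    then show ?thesis by (simp add: residually_tangent_def)
  qed
  moreover have "fps_nth (artin_hasse_prod m) 0 = 1"
    unfolding artin_hasse_prod_def using artin_hasse_factor(2) by (intro fps_prod_nth_0_eq_1)
  ultimately show "coeff (e_hat p D \<zeta> P m) k = coeff 1 k"
    by (cases "k = 0") (auto simp: coeff_e_hat residue_1 residue_eq_0_iff)
qed

text \<open>Factors with \<open>i < j\<close> reduce to 1, the factor \<open>j\<close> begins with
  \<open>1 + lam U^(p^j)\<close> because the linear coefficient of the Artin-Hasse series is 1, and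
  factors with \<open>i > j\<close> begin only beyond degree \<open>p^j\<close>.\<close>

lemma e_hat_order:
  assumes j: "j \<in> exponents m" "absv (lam (m * p ^ j)) = 1" and least: "\<And>i. i < j \<Longrightarrow> absv (lam (m * p ^ i)) < 1"
  shows "e_hat p D \<zeta> P m \<noteq> 1" "order 0 (e_hat p D \<zeta> P m - 1) = p ^ j"
proof -
  have pj: "0 < p ^ j" using p_gt_1 by simp
  let ?c = "\<lambda>i. if i = j then lam (m * p ^ j) else 0"
  have "residually_tangent (p ^ j) (sum ?c (exponents m)) (artin_hasse_prod m)"
  proof (rule artin_hasse_prod_tangent[OF pj])
    fix i assume i: "i \<in> exponents m"
    note f = artin_hasse_factor[OF i]
    consider "i < j" | "i = j" | "j < i" by linarith
    then show "residually_tangent (p ^ j) (?c i) (artin_hasse p oo (fps_const (lam (m * p ^ i)) * fps_X ^ p ^ i))"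
    proof cases
      case 1
      then show ?thesis using f(1,2) factor_small[OF i least[OF 1]] pj by (simp add: residually_tangent_def)
    next
      case 2
      have nd: "\<not> p ^ j dvd k" if "0 < k" "k < p ^ j" for k using that by (simp add: nat_dvd_not_less)
      have "fps_nth (artin_hasse p :: 'k fps) (Suc 0) = 1" using artin_hasse_nth_1 by simp
      then show ?thesis unfolding 2 using artin_hasse_factor(1,2)[OF j(1)] pj nd
        by (simp add: residually_tangent_def artin_hasse_factor(3)[OF j(1)])
    next
      case 3
      then have "p ^ j < p ^ i" using p_gt_1 by (intro power_strict_increasing) auto
      then have "\<not> p ^ i dvd k" if "0 < k" "k \<le> p ^ j" for k using that by (simp add: nat_dvd_not_less)
      then show ?thesis using f(1,2) 3 pj by (simp add: residually_tangent_def f(3))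
    qed
  qed
  moreover have "sum ?c (exponents m) = lam (m * p ^ j)" using finite_exponents j(1) by simp
  ultimately have t: "residually_tangent (p ^ j) (lam (m * p ^ j)) (artin_hasse_prod m)" by simp
  then have le: "absv (fps_nth (artin_hasse_prod m) k) \<le> 1" for k by (simp add: residually_tangent_def coeff_bound_def)
  have low: "coeff (e_hat p D \<zeta> P m - 1) k = 0" if "k < p ^ j" for k
    using t that le[of k] by (cases "k = 0") (auto simp: coeff_e_hat residually_tangent_def residue_1 residue_eq_0_iff)
  have "p ^ j \<le> D div m" using j(1) m by (simp add: exponents_def less_eq_div_iff_mult_less_eq mult.commute)
  moreover have "absv (fps_nth (artin_hasse_prod m) (p ^ j)) = 1"
  proof -
    have "absv (fps_nth (artin_hasse_prod m) (p ^ j) - lam (m * p ^ j)) < absv (lam (m * p ^ j))"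
      using t j(2) by (simp add: residually_tangent_def)
    from absv_add_dominant[OF this] show ?thesis using j(2) by simp
  qed
  ultimately have top: "coeff (e_hat p D \<zeta> P m - 1) (p ^ j) \<noteq> 0"
    using pj p_gt_1 by (simp add: coeff_e_hat residue_eq_0_iff)
  show "e_hat p D \<zeta> P m \<noteq> 1" using top by auto
  show "order 0 (e_hat p D \<zeta> P m - 1) = p ^ j" using low top by (rule order_0_eqI)
qed

text \<open>The order picks the least \<open>j\<close> with a unit coordinate. Since
  \<open>slope (m * p ^ j) = m p^(d_m - j)\<close> decreases in \<open>j\<close>, this is the
  largest slope in the class of \<open>m\<close>, and it equals
  \<open>m p^(d_m) / p^j\<close>.\<close>

lemma index_term_cases:
  "index_term p D \<zeta> P m = 0 \<and> (\<forall>j\<in>exponents m. absv (lam (m * p ^ j)) < 1)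
   \<or> (\<exists>j\<in>exponents m. absv (lam (m * p ^ j)) = 1 \<and> index_term p D \<zeta> P m = real (slope (m * p ^ j)) \<and>
        (\<forall>i\<in>exponents m. absv (lam (m * p ^ i)) = 1 \<longrightarrow> slope (m * p ^ i) \<le> slope (m * p ^ j)))"
proof (cases "\<exists>j\<in>exponents m. absv (lam (m * p ^ j)) = 1")
  case False
  then have "\<forall>j\<in>exponents m. absv (lam (m * p ^ j)) < 1" using exponents_lam by (metis order_le_less)
  then show ?thesis using e_hat_eq_1 by (simp add: index_term_def)
next
  case True
  define j where "j = (LEAST j. j \<in> exponents m \<and> absv (lam (m * p ^ j)) = 1)"
  have j: "j \<in> exponents m" "absv (lam (m * p ^ j)) = 1" using LeastI_ex[of "\<lambda>j. j \<in> exponents m \<and> absv (lam (m * p ^ j)) = 1"] True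
    by (auto simp: j_def)
  have below: "j \<le> i" if "i \<in> exponents m" "absv (lam (m * p ^ i)) = 1" for i
    unfolding j_def using that by (intro Least_le) auto
  have "absv (lam (m * p ^ i)) < 1" if "i < j" for i
  proof -
    have le: "m * p ^ i \<le> m * p ^ j" using that p_gt_1 by (intro mult_le_mono2 power_increasing) auto
    have "i \<in> exponents m" using le_trans[OF le] j(1) unfolding exponents_def by blast
    then show ?thesis using exponents_lam[of i] below[of i] that by (metis leD order_le_less)
  qed
  note o = e_hat_order[OF j this]
  have sl: "slope (m * p ^ i) = m * p ^ (log_idx p D m - i)" if "i \<in> exponents m" for i
    using that m by (intro slope_prime_power_multiple) (auto simp: exponents_def)
  have "j \<le> log_idx p D m" using log_idx_mult(1)[OF p_gt_1 m(1), of j D] j(1) by (simp add: exponents_def)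
  then have "p ^ log_idx p D m = p ^ (log_idx p D m - j) * p ^ j" by (simp flip: power_add)
  then have "index_term p D \<zeta> P m = real (slope (m * p ^ j))"
    unfolding index_term_def sl[OF j(1)] using o p_gt_1 by simp
  moreover have "slope (m * p ^ i) \<le> slope (m * p ^ j)" if "i \<in> exponents m" "absv (lam (m * p ^ i)) = 1" for i
    unfolding sl[OF that(1)] sl[OF j(1)] using below[OF that] p_gt_1 by (intro mult_le_mono2 power_increasing) auto
  ultimately show ?thesis using j by blast
qed

end

lemma has_index_max:
  assumes sol: "soluble P"
  shows "has_index (pderiv P)
           (1 - Max ((\<lambda>m. index_term p D \<zeta> P m) ` {m. 1 \<le> m \<and> m \<le> D \<and> \<not> p dvd m}))"
proof -
  let ?M = "{m. 1 \<le> m \<and> m \<le> D \<and> \<not> p dvd m}"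
  note le1 = absv_lam_le_1[OF sol]
  have fin: "finite ?M" by simp
  have in_range: "m * p ^ j \<in> {1..D}" if "m \<in> ?M" "m * p ^ j \<le> D" for m j
    using that p_gt_1 by (auto simp: Suc_le_eq)
  define U where "U = {i \<in> {1..D}. absv (lam i) = 1}"
  have cases: "index_term p D \<zeta> P m = 0 \<and> (\<forall>j\<in>exponents m. absv (lam (m * p ^ j)) < 1) \<or>
     (\<exists>j. m * p ^ j \<in> U \<and> index_term p D \<zeta> P m = real (slope (m * p ^ j)) \<and>
        (\<forall>i. m * p ^ i \<in> U \<longrightarrow> slope (m * p ^ i) \<le> slope (m * p ^ j)))" if m: "m \<in> ?M" for m
  proof -
    have "m * p ^ j \<in> U \<longleftrightarrow> j \<in> exponents m \<and> absv (lam (m * p ^ j)) = 1" for j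
      using in_range[OF m, of j] by (auto simp: U_def exponents_def)
    moreover have "1 \<le> m" "m \<le> D" "\<not> p dvd m" using m by auto
    from index_term_cases[OF this le1] 
    have "index_term p D \<zeta> P m = 0 \<and> (\<forall>j\<in>exponents m. absv (lam (m * p ^ j)) < 1)
      \<or> (\<exists>j\<in>exponents m. absv (lam (m * p ^ j)) = 1 \<and> index_term p D \<zeta> P m = real (slope (m * p ^ j)) \<and>
        (\<forall>i\<in>exponents m. absv (lam (m * p ^ i)) = 1 \<longrightarrow> slope (m * p ^ i) \<le> slope (m * p ^ j)))" .
    ultimately show ?thesis by blast
  qed
  show ?thesis
  proof (cases "U = {}")
    case True
    have "index_term p D \<zeta> P m = 0" if "m \<in> ?M" for m using cases[OF that] True by blast
    then have "(\<lambda>m. index_term p D \<zeta> P m) ` ?M = (\<lambda>m. 0) ` ?M" by (rule image_cong[OF refl])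
    \<comment> \<open>The set of admissible \<open>m\<close> is nonempty because it contains 1, so
      the maximum is 0 and not an unspecified value.\<close>
    also have "\<dots> = {0}" using D p_gt_1 by (intro image_constant[of 1]) auto
    finally have "(\<lambda>m. index_term p D \<zeta> P m) ` ?M = {0}" .
    moreover have "absv (lam i) < 1" if "i \<in> {1..D}" for i using le1[OF that] True that by (auto simp: U_def order_le_less)
    ultimately show ?thesis using has_index_minor by simp
  next
    case False
    have finU: "finite U" by (simp add: U_def)
    then have "Max (slope ` U) \<in> slope ` U" using False by (intro Max_in) auto
    then obtain i0 where i0: "i0 \<in> U" "slope i0 = Max (slope ` U)" by auto
    have max: "slope i \<le> slope i0" if "i \<in> U" for i unfolding i0(2) using finU that by (intro Max_ge) auto
    define m where "m = prime_free i0"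
    define j where "j = multiplicity p i0"
    have i0m: "i0 = m * p ^ j" using prime_free_mult[of i0] by (simp add: m_def j_def)
    have i0D: "1 \<le> i0" "i0 \<le> D" using i0 by (auto simp: U_def)
    have "\<not> p dvd m" unfolding m_def using i0D by (intro prime_free_not_dvd) simp
    moreover have "1 \<le> m" using i0D i0m by (cases m) auto
    moreover have "m \<le> D" using i0D(2) p_gt_1 unfolding i0m
      by (metis le_trans mult.right_neutral mult_le_mono2 one_le_power less_imp_le)
    ultimately have mM: "m \<in> ?M" by simp
    have "Max ((\<lambda>m. index_term p D \<zeta> P m) ` ?M) = real (slope i0)"
    proof (rule Max_eqI)
      show "finite ((\<lambda>m. index_term p D \<zeta> P m) ` ?M)" using fin by simp
      fix y assume "y \<in> (\<lambda>m. index_term p D \<zeta> P m) ` ?M"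
      then obtain m' where "m' \<in> ?M" "y = index_term p D \<zeta> P m'" by auto
      then show "y \<le> real (slope i0)" using cases[of m'] max by auto
    next
      have "absv (lam (m * p ^ j)) = 1" using i0 unfolding i0m[symmetric] by (simp add: U_def)
      moreover have "j \<in> exponents m" using i0D(2) by (simp add: exponents_def flip: i0m)
      ultimately have "\<not> (\<forall>j\<in>exponents m. absv (lam (m * p ^ j)) < 1)" by (metis less_irrefl)
      \<comment> \<open>The exponent found inside the class of \<open>m\<close> need not be known to
        be \<open>j\<close>; the two slopes coincide because each is maximal over a set containing
        the other index.\<close>
      then obtain j' where j': "m * p ^ j' \<in> U" "index_term p D \<zeta> P m = real (slope (m * p ^ j'))"
        "\<And>i. m * p ^ i \<in> U \<Longrightarrow> slope (m * p ^ i) \<le> slope (m * p ^ j')"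
        using cases[OF mM] by blast
      have "slope i0 \<le> slope (m * p ^ j')" using j'(3)[of j] i0(1) by (simp flip: i0m)
      then have "index_term p D \<zeta> P m = real (slope i0)" using max[OF j'(1)] j'(2) by simp
      then show "real (slope i0) \<in> (\<lambda>m. index_term p D \<zeta> P m) ` ?M" using mM by (metis image_eqI)
    qed
    moreover have "has_index (pderiv P) (1 - real (slope i0))"
      using i0(1) max le1 by (intro has_index_major) (auto simp: U_def)
    ultimately show ?thesis by simp
  qed
qed

end

theorem mainTheorem3:
  fixes p D :: nat and \<zeta> :: "'k::ultrametric_field" and P :: "'k poly"
  assumes "prime p"
    and "extends_Qp p TYPE('k)"
    and "D \<ge> 1"
    and "primitive_root_of_unity (p ^ (log_idx p D 1 + 1)) \<zeta>"
    and "coeff P 0 = 0"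
    and "degree P \<le> D"
    and "soluble P"
  shows "has_index (pderiv P)
           (1 - Max ((\<lambda>m. index_term p D \<zeta> P m) ` {m. 1 \<le> m \<and> m \<le> D \<and> \<not> p dvd m}))"
proof -
  interpret exponential_equation p D \<zeta> P
    using assms by unfold_locales
  show ?thesis using assms(7) by (rule has_index_max)
qed

end
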